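(* Let $a>0$ and let $\alpha\in\mathbb{F}_a$ be such that $\alpha\{x\}<a$ for every $x\in\mathbb{R}$. For $w\in\mathbb{C}\setminus\mathbb{R}$ put $\zeta(w)=\int_{\mathbb{R}}\log(1+wx)\,\alpha(dx)$. Then for all real $x_1<x_2$: (1) if $a=1$, $$\mu_\alpha(x_1,x_2)=\frac1\pi\lim_{\varepsilon\downarrow0}\mathrm{Im}\int_{x_1}^{x_2}\frac{1}{-\lambda-i\varepsilon}\exp\left\{-\zeta\left(\frac{1}{-\lambda-i\varepsilon}\right)\right\}d\lambda;$$ (2) if $a>1$, $$\mu_\alpha(x_1,x_2)=\frac{a-1}{\pi}\lim_{\varepsilon\downarrow0}\mathrm{Im}\int_{x_1}^{x_2}\frac{1}{-\lambda-i\varepsilon}\int_0^1\exp\left\{-\zeta\left(\frac{u}{-\lambda-i\varepsilon}\right)\right\}(1-u)^{a-2}\,du\,d\lambda;$$ (3) if $a\in(0,1)$, $$\mu_\alpha(x_1,x_2)=\frac1\pi\lim_{\varepsilon\downarrow0}\mathrm{Im}\int_{x_1}^{x_2}\frac{1}{(1-e^{2\pi i(a-1)})(-\lambda-i\varepsilon)}\int_0^{(1+)}\exp\left\{-\zeta\left(\frac{w}{-\lambda-i\varepsilon}\right)\right\}b(w;1,a-1)\,dw\,d\lambda.$$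
   Context: For $a>0$, $\mathbb{F}_a$ is the set of finite measures $\alpha$ on $(\mathbb{R},\mathscr{B}(\mathbb{R}))$ with $\alpha(\mathbb{R})=a$ and $\int_{\mathbb{R}}\log(1+|x|)\,\alpha(dx)<+\infty$. A random probability measure $\tilde\varphi$ on $\mathbb{R}$ is a Dirichlet process with parameter $\alpha$ (law $\mathscr{D}_\alpha$) if, for every finite measurable partition $C_1,\ldots,C_{n+1}$ of $\mathbb{R}$, $(\tilde\varphi(C_1),\ldots,\tilde\varphi(C_n))$ has the Dirichlet distribution with parameter $(\alpha(C_1),\ldots,\alpha(C_{n+1}))$ (components with $\alpha(C_i)=0$ being a.s. $0$). For $\alpha\in\mathbb{F}_a$, $\int|x|\,\tilde\varphi(dx)<\infty$ a.s., and $\mu_\alpha$ is the probability distribution of $\tilde\varphi(I)=\int x\,\tilde\varphi(dx)$ under $\mathscr{D}_\alpha$; $\mu_\alpha(x_1,x_2)$ is the mass of the open interval. $\log$ is the principal logarithm, $\arg\in(-\pi,\pi]$. $b(w;1,a-1)=\frac{\Gamma(a)}{\Gamma(a-1)}(1-w)^{a-2}$. $\int_0^{(1+)}$ denotes integration along a contour which starts at the origin, lies (except for its endpoints) in $\{\mathrm{Re}\,w>0\}$, encircles $1$ once counterclockwise without crossing the segment $(0,1]$ (first passing below the segment, then around $1$, then back above the segment), and returns to the origin. In (3), for given $\lambda,\varepsilon$, the contour is taken close enough to $[0,1]$ that $\mathrm{Im}\big(w/(-\lambda-i\varepsilon)\big)>0$ along it (except at its endpoints). The branch of $(1-w)^{a-2}$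 is the one continuous along the contour for which $\arg(1-w)$ tends to $0$ just below the segment $(0,1)$ and to $2\pi$ just above it. *)

theory Defs
  imports "HOL-Probability.Probability" "HOL-Complex_Analysis.Complex_Analysis"
begin

definition log_finite_measures :: "real \<Rightarrow> real measure set" where
  "log_finite_measures a =
     {\<alpha>. sets \<alpha> = sets borel \<and> finite_measure \<alpha> \<and> measure \<alpha> UNIV = a \<and>
         integrable \<alpha> (\<lambda>x. ln (1 + \<bar>x\<bar>))}"

text \<open>Dirichlet density, with all parameters \<open>\<beta> i\<close> (\<open>i \<in> J\<close>) positive, in the coordinates
  \<open>i \<in> J - {k}\<close>; the coordinate \<open>k\<close> is one minus the sum of the others.\<close>

definition dirichlet_density :: "nat set \<Rightarrow> nat \<Rightarrow> (nat \<Rightarrow> real) \<Rightarrow> (nat \<Rightarrow> real) \<Rightarrow> real" where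
  "dirichlet_density J k \<beta> x =
     (if (\<forall>i\<in>J - {k}. 0 < x i) \<and> (\<Sum>i\<in>J - {k}. x i) < 1
      then Gamma (\<Sum>i\<in>J. \<beta> i) / (\<Prod>i\<in>J. Gamma (\<beta> i)) *
             (\<Prod>i\<in>J - {k}. x i powr (\<beta> i - 1)) *
             (1 - (\<Sum>i\<in>J - {k}. x i)) powr (\<beta> k - 1)
      else 0)"

text \<open>Law of the first \<open>n\<close> coordinates of a Dirichlet vector with nonnegative, not all zero,
  parameters \<open>\<beta> 0, \<dots>, \<beta> n\<close>. Coordinates with parameter zero vanish; those with positive
  parameter (index set \<open>J\<close>) have the density above, the last of them being determined by
  the others.\<close>

definition dirichlet_dist :: "nat \<Rightarrow> (nat \<Rightarrow> real) \<Rightarrow> (nat \<Rightarrow> real) measure" where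
  "dirichlet_dist n \<beta> =
     (let J = {i. i \<le> n \<and> 0 < \<beta> i}; k = Max J in
      distr (density (PiM (J - {k}) (\<lambda>_. lborel)) (\<lambda>x. ennreal (dirichlet_density J k \<beta> x)))
        (PiM {..<n} (\<lambda>_. borel))
        (\<lambda>x. \<lambda>i\<in>{..<n}. if i \<in> J - {k} then x i
                        else if i = k then 1 - (\<Sum>j\<in>J - {k}. x j) else 0))"

definition dirichlet_process :: "real measure \<Rightarrow> 'w measure \<Rightarrow> ('w \<Rightarrow> real measure) \<Rightarrow> bool" where
  "dirichlet_process \<alpha> M \<phi> \<longleftrightarrow>
     prob_space M \<and> \<phi> \<in> M \<rightarrow>\<^sub>M prob_algebra borel \<and>
     (\<forall>n C. (\<forall>i\<le>n. C i \<in> sets borel) \<and> disjoint_family_on C {..n} \<and> (\<Union>i\<le>n. C i) = UNIV \<longrightarrow>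
        distr M (PiM {..<n} (\<lambda>_. borel)) (\<lambda>\<omega>. \<lambda>i\<in>{..<n}. measure (\<phi> \<omega>) (C i)) =
        dirichlet_dist n (\<lambda>i. measure \<alpha> (C i)))"

definition mean_law :: "'w measure \<Rightarrow> ('w \<Rightarrow> real measure) \<Rightarrow> real measure" where
  "mean_law M \<phi> = distr M borel (\<lambda>\<omega>. LINT x|\<phi> \<omega>. x)"

definition zeta_transform :: "real measure \<Rightarrow> complex \<Rightarrow> complex" where
  "zeta_transform \<alpha> w = (LINT x|\<alpha>. Ln (1 + w * of_real x))"

text \<open>The function \<open>b(w; 1, a - 1)\<close>. On the complement of \<open>(-\<infinity>, 1]\<close> the function
  \<open>Arg2pi (1 - w)\<close> is continuous; it tends to \<open>0\<close> just below the segment \<open>(0, 1)\<close> and to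
  \<open>2\<pi>\<close> just above it.\<close>

definition beta_kernel :: "real \<Rightarrow> complex \<Rightarrow> complex" where
  "beta_kernel a w =
     of_real (Gamma a / Gamma (a - 1)) *
     exp (of_real (a - 2) * (of_real (ln (cmod (1 - w))) + \<i> * of_real (Arg2pi (1 - w))))"

text \<open>Contours of the integral from \<open>0\<close> to \<open>(1+)\<close>.\<close>

definition loop_contour :: "(real \<Rightarrow> complex) \<Rightarrow> bool" where
  "loop_contour \<gamma> \<longleftrightarrow>
     valid_path \<gamma> \<and> pathstart \<gamma> = 0 \<and> pathfinish \<gamma> = 0 \<and>
     (\<forall>t\<in>{0<..<1}. 0 < Re (\<gamma> t) \<and> \<gamma> t \<notin> complex_of_real ` {0<..1}) \<and>
     winding_number \<gamma> 1 = 1 \<and>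
     (\<forall>\<^sub>F t in at_right 0. Im (\<gamma> t) < 0) \<and> (\<forall>\<^sub>F t in at_left 1. 0 < Im (\<gamma> t))"

end

theory Submission
  imports Defs
begin

text \<open>
  Let \<open>\<mu>\<close> be the law of the mean \<open>\<phi>(I)\<close>. The three formulas invert one and the same
  transform of \<open>\<mu>\<close>. They rest on the Markov--Krein identity

    \<open>\<integral> (1 + w x) powr (- a) \<mu>(dx) = exp (- \<zeta>(w))\<close> for \<open>Im w > 0\<close>,

  on a lowering of the exponent from \<open>a\<close> to \<open>1\<close>, and on Stieltjes inversion.

  The Markov--Krein identity comes from the gamma process. If \<open>T\<close> is independent of \<open>\<phi>\<close> with
  the Gamma law of parameter \<open>a\<close>, then on the cells of a finite partition the masses of \<open>T \<phi>\<close> are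
  independent gamma variables (\<open>gamma_dirichlet_nn_integral\<close>). Computing the characteristic
  function of \<open>T \<phi>(f)\<close>, once by conditioning on \<open>\<phi>\<close> and once by independence, gives
  \<open>E (1 - i \<phi>(f)) powr (- a) = exp (- \<integral> Ln (1 - i f) d\<alpha>)\<close> for simple \<open>f\<close>
  (\<open>dirichlet_process_simple\<close>). Both sides pass to the limit by dominated convergence for every
  \<open>f\<close> with \<open>\<integral> ln (1 + |f|) d\<alpha> < \<infinity>\<close> (\<open>dirichlet_process_markov_krein\<close>), once \<open>\<phi>(|f|) < \<infinity>\<close> a.s.
  is known; that follows from the same formula for \<open>t |f|\<close> as \<open>t \<rightarrow> 0\<close>
  (\<open>dirichlet_process_AE_finite\<close>). Only affine \<open>f(x) = t (x - c)\<close> are used afterwards: with all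
  real \<open>t\<close> and \<open>c\<close> they cover the half-plane (\<open>half_plane_identity\<close>), and \<open>t \<rightarrow> \<infinity>\<close> shows that
  \<open>\<mu>\<close> has no atom at \<open>c\<close> unless \<open>\<alpha>\<close> is concentrated there (\<open>no_atom\<close>).

  To lower the exponent put \<open>G(v) = \<integral> (1 + v w x) powr (1 - a) / (1 + w x) \<mu>(dx)\<close>. Then
  \<open>- (1 - v) powr (a - 1) G(v)\<close> is a primitive of
  \<open>(a - 1) (1 - v) powr (a - 2) exp (- \<zeta>(v w))\<close> (\<open>resolvent_power_ode\<close>), so that integration over
  the segment \<open>[0, 1]\<close> when \<open>a > 1\<close>, or around the loop when \<open>a < 1\<close>, returns a constant times
  \<open>G(0) = \<integral> 1 / (1 + w x) \<mu>(dx)\<close> (\<open>euler_integral\<close>, \<open>loop_integral\<close>). For \<open>a = 1\<close> this integral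
  is the Markov--Krein transform itself.

  Finally \<open>w = 1 / (- \<lambda> - i \<epsilon>)\<close> makes \<open>w / (1 + w x) = 1 / (x - \<lambda> - i \<epsilon>)\<close>, whose
  imaginary part is \<open>\<pi>\<close> times the Poisson kernel; integrated over \<open>\<lambda> \<in> [x1, x2]\<close> it tends to \<open>\<pi>\<close> times
  the indicator of the interval, except at the endpoints, which carry no mass
  (\<open>stieltjes_inversion\<close>).
\<close>

section \<open>Gamma densities and their Fourier transforms\<close>

definition gamma_density :: "real \<Rightarrow> real \<Rightarrow> real" where
  "gamma_density b t = (if 0 < t then t powr (b - 1) * exp (- t) / Gamma b else 0)"

lemma gamma_density_measurable [measurable]: "gamma_density b \<in> borel_measurable borel"
  unfolding gamma_density_def by measurable

lemma gamma_density_nonneg: "b > 0 \<Longrightarrow> gamma_density b t \<ge> 0"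
  by (auto simp: gamma_density_def intro!: divide_nonneg_pos Gamma_real_pos)

lemma gamma_rate_nn_integral:
  fixes b c :: real
  assumes "b > 0" "c > 0"
  shows "(\<integral>\<^sup>+t. ennreal (indicator {0<..} t * (t powr (b - 1) * exp (- c * t))) \<partial>lborel)
         = ennreal (Gamma b / c powr b)"
proof -
  let ?f = "\<lambda>t::real. ennreal (indicator {0<..} t * (t powr (b - 1) * exp (- c * t)))"
  have "ennreal (Gamma b) = (\<integral>\<^sup>+t. ennreal (indicator {0..} t * t powr (b - 1) / exp t) \<partial>lborel)"
    by (rule Gamma_conv_nn_integral_real[OF assms(1)])
  also have "\<dots> = (\<integral>\<^sup>+t. ennreal (indicator {0<..} t * (t powr (b - 1) * exp (- t))) \<partial>lborel)"
    by (intro nn_integral_cong) (auto simp: indicator_def exp_minus field_simps)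
  also have "\<dots> = ennreal \<bar>c\<bar> * (\<integral>\<^sup>+t. ennreal (indicator {0<..} (0 + c * t) *
      ((0 + c * t) powr (b - 1) * exp (- (0 + c * t)))) \<partial>lborel)"
    by (rule nn_integral_real_affine) (use assms in auto)
  also have "(\<integral>\<^sup>+t. ennreal (indicator {0<..} (0 + c * t) *
      ((0 + c * t) powr (b - 1) * exp (- (0 + c * t)))) \<partial>lborel) =
      (\<integral>\<^sup>+t. ennreal (c powr (b - 1)) * ?f t \<partial>lborel)"
    by (intro nn_integral_cong)
       (use assms in \<open>auto simp: indicator_def zero_less_mult_iff powr_mult ennreal_mult[symmetric] mult_ac\<close>)
  also have "\<dots> = ennreal (c powr (b - 1)) * (\<integral>\<^sup>+t. ?f t \<partial>lborel)"
    by (intro nn_integral_cmult) auto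
  finally have "ennreal (Gamma b) = ennreal (c powr b) * (\<integral>\<^sup>+t. ?f t \<partial>lborel)"
    using assms by (simp add: mult.assoc[symmetric] ennreal_mult[symmetric] powr_diff)
  moreover have "ennreal (Gamma b) = ennreal (c powr b) * ennreal (Gamma b / c powr b)"
    using assms by (subst ennreal_mult[symmetric]) (auto simp: Gamma_real_nonneg)
  ultimately show ?thesis
    using assms by (metis ennreal_mult_cancel_left ennreal_eq_0_iff ennreal_neq_top not_le powr_gt_zero less_irrefl)
qed

lemma gamma_rate_integral:
  fixes b c :: real
  assumes "b > 0" "c > 0"
  shows "has_bochner_integral lborel (\<lambda>t. indicator {0<..} t * (t powr (b - 1) * exp (- c * t))) (Gamma b / c powr b)"
  by (rule has_bochner_integral_nn_integral)
     (use gamma_rate_nn_integral[OF assms] assms in \<open>auto simp: Gamma_real_nonneg\<close>)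

text \<open>
  For real \<open>A\<close> this is a rescaling of the Gamma integral. For complex \<open>A\<close> write
  \<open>exp (- A t) = exp (- c t) exp ((c - A) t)\<close> with a real \<open>c > 0\<close> and expand the second factor: the
  integrated series is the binomial series of \<open>(A / c) powr (- b)\<close>, which converges absolutely
  as soon as \<open>|c - A| < c\<close>.
\<close>

lemma complex_gamma_integral:
  fixes b :: real and A :: complex
  assumes b: "b > 0" and A: "Re A > 0"
  shows "(LINT t|lborel. of_real (indicator {0<..} t * t powr (b - 1)) * exp (- A * of_real t))
         = of_real (Gamma b) * A powr (- of_real b)"
proof -
  \<comment> \<open>The condition \<open>|c - A| < c\<close> means \<open>2 c Re A > |A|\<^sup>2\<close>; the choice below is twice the critical value.\<close>
  obtain c where c: "c > 0" "norm (of_real c - A) < c"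
  proof -
    define c where "c = (cmod A)\<^sup>2 / Re A"
    have "A \<noteq> 0" using A by auto
    then have c0: "c > 0" using A by (simp add: c_def)
    have "(norm (of_real c - A))\<^sup>2 = (c - Re A)\<^sup>2 + (Im A)\<^sup>2"
      by (simp add: cmod_power2)
    also have "\<dots> = c\<^sup>2 - 2 * (c * Re A) + (cmod A)\<^sup>2"
      unfolding cmod_power2[of A] by (simp add: power2_eq_square algebra_simps)
    also have "c * Re A = (cmod A)\<^sup>2" using A by (simp add: c_def)
    finally have "(norm (of_real c - A))\<^sup>2 < c\<^sup>2"
      using \<open>A \<noteq> 0\<close> by simp
    then have "norm (of_real c - A) < c" using c0 by (meson less_le_not_le linorder_not_less power_mono norm_ge_zero less_imp_le power_less_imp_less_base)
    with c0 show thesis by (rule that)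
  qed
  define q where "q = of_real c - A"
  define r where "r = norm q / c"
  have r: "0 \<le> r" "r < 1" using c by (auto simp: r_def q_def)
  define f where "f n t = of_real (indicator {0<..} t * (t powr (b + real n - 1) * exp (- c * t))) * (q ^ n / fact n)" for n :: nat and t :: real
  define p where "p n = Gamma (b + real n) / c powr (b + real n)" for n :: nat
  have hb: "has_bochner_integral lborel (\<lambda>t. indicator {0<..} t * (t powr (b + real n - 1) * exp (- c * t))) (p n)" for n
    unfolding p_def using gamma_rate_integral[of "b + real n" c] b c by simp
  have hf: "has_bochner_integral lborel (f n) (of_real (p n) * (q ^ n / fact n))" for n
    unfolding f_def by (intro has_bochner_integral_mult_left has_bochner_integral_of_real hb)
  have hn: "has_bochner_integral lborel (\<lambda>t. norm (f n t)) (p n * (norm q ^ n / fact n))" for n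
  proof -
    have "(\<lambda>t. norm (f n t)) = (\<lambda>t. indicator {0<..} t * (t powr (b + real n - 1) * exp (- c * t)) * (norm q ^ n / fact n))"
      by (auto simp: f_def norm_mult norm_divide norm_power indicator_def fun_eq_iff)
    then show ?thesis by (simp only:) (intro has_bochner_integral_mult_left hb)
  qed
  have poch: "Gamma (b + real n) = Gamma b * pochhammer b n" for n
  proof -
    have "b \<notin> \<int>\<^sub>\<le>\<^sub>0" using b by (auto elim!: nonpos_Ints_cases)
    from pochhammer_Gamma[OF this, of n] show ?thesis using Gamma_real_pos[OF b] by (simp add: field_simps)
  qed
  have gb: "complex_of_real (pochhammer b n / fact n) * z ^ n = ((- of_real b) gchoose n) * (- z) ^ n" for n z
    by (simp add: gbinomial_pochhammer pochhammer_of_real power_minus[of z] )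
  have ps: "complex_of_real (p n) * (z ^ n / fact n) = of_real (Gamma b / c powr b) * (((- of_real b) gchoose n) * (- (z / of_real c)) ^ n)" for n z
    unfolding gb[symmetric] using c by (simp add: p_def poch powr_add powr_realpow field_simps)
  have sums: "(\<lambda>n. of_real (p n) * (z ^ n / fact n)) sums (of_real (Gamma b / c powr b) * (1 - z / of_real c) powr (- of_real b))"
    if "norm z < c" for z :: complex
    unfolding ps using gen_binomial_complex[of "- (z / of_real c)" "- of_real b"] that c
    by (intro sums_mult) (simp add: norm_divide field_simps)
  have norm_sum: "summable (\<lambda>n. p n * (norm q ^ n / fact n))"
  proof -
    have "summable (\<lambda>n. complex_of_real (p n * (norm q ^ n / fact n)))"
      using sums_summable[OF sums[of "of_real (norm q)"]] c by (simp add: q_def del: summable_complex_of_real)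
    then show ?thesis by (rule summable_complex_of_real[THEN iffD1])
  qed
  have fsum: "(\<lambda>n. f n t) sums (of_real (indicator {0<..} t * t powr (b - 1)) * exp (- A * of_real t))" for t
  proof (cases "t > 0")
    case True
    have "f n t = of_real (t powr (b - 1) * exp (- c * t)) * ((q * of_real t) ^ n /\<^sub>R fact n)" for n
    proof -
      have "t powr (b + real n - 1) = t powr (b - 1) * t ^ n"
        using True by (simp add: powr_add[symmetric] powr_realpow[symmetric] algebra_simps)
      then show ?thesis using True by (simp add: f_def power_mult_distrib scaleR_conv_of_real field_simps)
    qed
    moreover have "(\<lambda>n. of_real (t powr (b - 1) * exp (- c * t)) * ((q * of_real t) ^ n /\<^sub>R fact n)) sums
       (of_real (t powr (b - 1) * exp (- c * t)) * exp (q * of_real t))"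
      by (intro sums_mult exp_converges)
    moreover have "of_real (t powr (b - 1) * exp (- c * t)) * exp (q * of_real t) = of_real (t powr (b - 1)) * exp (- A * of_real t)"
      by (simp add: exp_of_real[symmetric] mult.assoc exp_add[symmetric] q_def algebra_simps)
    ultimately show ?thesis using True by (simp add: mult.assoc)
  next
    case False
    then show ?thesis by (simp add: f_def)
  qed
  have "(LINT t|lborel. of_real (indicator {0<..} t * t powr (b - 1)) * exp (- A * of_real t))
      = (LINT t|lborel. (\<Sum>n. f n t))"
    using fsum by (simp add: sums_iff)
  also have "\<dots> = (\<Sum>n. integral\<^sup>L lborel (f n))"
  proof (rule integral_suminf)
    show "integrable lborel (f n)" for n using hf by (simp add: has_bochner_integral_iff)
    show "summable (\<lambda>n. LINT t|lborel. norm (f n t))"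
      using hn norm_sum by (simp add: has_bochner_integral_iff)
    show "AE t in lborel. summable (\<lambda>n. norm (f n t))"
    proof (intro AE_I2)
      fix t :: real
      show "summable (\<lambda>n. norm (f n t))"
      proof (cases "t > 0")
        case True
        have "norm (f n t) = (t powr (b - 1) * exp (- c * t)) * ((norm q * t) ^ n /\<^sub>R fact n)" for n
        proof -
          have "t powr (b + real n - 1) = t powr (b - 1) * t ^ n"
            using True by (simp add: powr_add[symmetric] powr_realpow[symmetric] algebra_simps)
          then show ?thesis using True by (simp add: f_def norm_mult norm_divide norm_power power_mult_distrib field_simps)
        qed
        moreover have "summable (\<lambda>n. (t powr (b - 1) * exp (- c * t)) * ((norm q * t) ^ n /\<^sub>R fact n))"
          by (intro summable_mult summable_exp_generic)
        ultimately show ?thesis by simp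
      qed (simp add: f_def)
    qed
  qed
  also have "\<dots> = (\<Sum>n. of_real (p n) * (q ^ n / fact n))"
    using hf by (simp add: has_bochner_integral_iff)
  also have "\<dots> = of_real (Gamma b / c powr b) * (1 - q / of_real c) powr (- of_real b)"
    using sums[of q] c by (simp add: q_def sums_iff)
  also have "1 - q / of_real c = A / of_real c" using c by (simp add: q_def field_simps)
  also have "(A / of_real c) powr (- of_real b) = A powr (- of_real b) * of_real (c powr b)"
  proof -
    have "Ln (A / of_real c) = Ln A - of_real (ln c)"
      using A c by (subst Ln_divide_of_real) auto
    then have "(A / of_real c) powr (- of_real b) = exp (- of_real b * (Ln A - of_real (ln c)))"
      using A c by (auto simp: powr_def)
    also have "\<dots> = exp (- of_real b * Ln A) * exp (of_real (b * ln c))"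
      by (simp add: exp_add[symmetric] algebra_simps)
    finally show ?thesis using A c by (auto simp: powr_def exp_of_real[symmetric])
  qed
  finally show ?thesis using c by simp
qed

lemma gamma_density_nn_integral: "b > 0 \<Longrightarrow> (\<integral>\<^sup>+t. ennreal (gamma_density b t) \<partial>lborel) = 1"
proof -
  assume b: "b > 0"
  have "(\<integral>\<^sup>+t. ennreal (gamma_density b t) \<partial>lborel) =
     (\<integral>\<^sup>+t. ennreal (1 / Gamma b) * ennreal (indicator {0<..} t * (t powr (b - 1) * exp (- 1 * t))) \<partial>lborel)"
    using Gamma_real_pos[OF b] by (intro nn_integral_cong) (auto simp: gamma_density_def indicator_def ennreal_mult[symmetric])
  also have "\<dots> = ennreal (1 / Gamma b) * ennreal (Gamma b / 1 powr b)"
    using gamma_rate_nn_integral[OF b, of 1] by (subst nn_integral_cmult) (auto simp: mult_ac)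
  also have "\<dots> = 1" using Gamma_real_pos[OF b] by (subst ennreal_mult[symmetric]) auto
  finally show ?thesis .
qed

lemma gamma_density_fourier:
  assumes b: "b > 0"
  shows "(LINT t|lborel. of_real (gamma_density b t) * exp (\<i> * of_real (u * t))) = (1 - \<i> * of_real u) powr (- of_real b)"
proof -
  have "(LINT t|lborel. of_real (gamma_density b t) * exp (\<i> * of_real (u * t))) =
        (LINT t|lborel. of_real (1 / Gamma b) * (of_real (indicator {0<..} t * t powr (b - 1)) * exp (- (1 - \<i> * of_real u) * of_real t)))"
    by (intro Bochner_Integration.integral_cong)
       (auto simp: gamma_density_def indicator_def exp_of_real[symmetric] exp_add[symmetric] algebra_simps exp_diff exp_minus field_simps)
  also have "\<dots> = of_real (1 / Gamma b) * (of_real (Gamma b) * (1 - \<i> * of_real u) powr (- of_real b))"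
    by (subst integral_mult_right_zero, subst complex_gamma_integral[OF b]) auto
  finally show ?thesis using Gamma_real_pos[OF b] by simp
qed

lemma nn_integral_PiM_lborel_scale:
  fixes s :: real and f :: "('i \<Rightarrow> real) \<Rightarrow> ennreal"
  assumes "finite K" "s > 0" "f \<in> borel_measurable (PiM K (\<lambda>_. lborel))"
  shows "(\<integral>\<^sup>+x. f x \<partial>PiM K (\<lambda>_. lborel)) = ennreal (s ^ card K) * (\<integral>\<^sup>+x. f (\<lambda>i\<in>K. s * x i) \<partial>PiM K (\<lambda>_. lborel))"
  using assms(1,3)
proof (induction K arbitrary: f rule: finite_induct)
  case empty
  show ?case by (simp add: PiM_empty nn_integral_count_space_finite restrict_def)
next
  case (insert j K)
  interpret product_sigma_finite "\<lambda>_::'i. lborel :: real measure" by standard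
  note [measurable] = insert.prems
  have [measurable]: "(\<lambda>x. \<lambda>i\<in>insert j K. s * x i) \<in> PiM (insert j K) (\<lambda>_. lborel) \<rightarrow>\<^sub>M PiM (insert j K) (\<lambda>_. lborel)"
    by (rule measurable_restrict) measurable
  have [measurable]: "(\<lambda>x. \<lambda>i\<in>K. s * x i) \<in> PiM K (\<lambda>_. lborel) \<rightarrow>\<^sub>M PiM K (\<lambda>_. lborel)"
    by (rule measurable_restrict) measurable
  have m: "(\<lambda>y. \<integral>\<^sup>+x. f (x(j := y)) \<partial>PiM K (\<lambda>_. lborel)) \<in> borel_measurable borel"
  proof -
    interpret K: sigma_finite_measure "PiM K (\<lambda>_. lborel :: real measure)" by (rule sigma_finite) fact
    show ?thesis by measurable
  qed
  have "(\<integral>\<^sup>+x. f x \<partial>PiM (insert j K) (\<lambda>_. lborel)) = (\<integral>\<^sup>+y. (\<integral>\<^sup>+x. f (x(j := y)) \<partial>PiM K (\<lambda>_. lborel)) \<partial>lborel)"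
    by (rule product_nn_integral_insert_rev) (use insert in auto)
  also have "\<dots> = ennreal \<bar>s\<bar> * (\<integral>\<^sup>+y. (\<integral>\<^sup>+x. f (x(j := 0 + s * y)) \<partial>PiM K (\<lambda>_. lborel)) \<partial>lborel)"
    by (rule nn_integral_real_affine[OF m]) (use assms in auto)
  also have "\<dots> = ennreal s * (\<integral>\<^sup>+y. ennreal (s ^ card K) * (\<integral>\<^sup>+x. f ((\<lambda>i\<in>K. s * x i)(j := s * y)) \<partial>PiM K (\<lambda>_. lborel)) \<partial>lborel)"
    using assms(2) by (subst insert.IH) auto
  also have "\<dots> = ennreal s * (ennreal (s ^ card K) * (\<integral>\<^sup>+y. (\<integral>\<^sup>+x. f ((\<lambda>i\<in>K. s * x i)(j := s * y)) \<partial>PiM K (\<lambda>_. lborel)) \<partial>lborel))"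
  proof (subst nn_integral_cmult)
    interpret K: sigma_finite_measure "PiM K (\<lambda>_. lborel :: real measure)" by (rule sigma_finite) fact
    show "(\<lambda>y. \<integral>\<^sup>+x. f ((\<lambda>i\<in>K. s * x i)(j := s * y)) \<partial>PiM K (\<lambda>_. lborel)) \<in> borel_measurable lborel"
      by measurable
  qed auto
  also have "\<dots> = ennreal (s ^ card (insert j K)) * (\<integral>\<^sup>+y. (\<integral>\<^sup>+x. f ((\<lambda>i\<in>K. s * x i)(j := s * y)) \<partial>PiM K (\<lambda>_. lborel)) \<partial>lborel)"
    using assms(2) insert by (simp add: ennreal_mult mult.assoc)
  also have "(\<integral>\<^sup>+y. (\<integral>\<^sup>+x. f ((\<lambda>i\<in>K. s * x i)(j := s * y)) \<partial>PiM K (\<lambda>_. lborel)) \<partial>lborel) =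
             (\<integral>\<^sup>+y. (\<integral>\<^sup>+x. f (\<lambda>i\<in>insert j K. s * (x(j := y)) i) \<partial>PiM K (\<lambda>_. lborel)) \<partial>lborel)"
    using insert.hyps by (intro nn_integral_cong arg_cong[where f = f]) (auto simp: fun_eq_iff restrict_def)
  also have "\<dots> = (\<integral>\<^sup>+x. f (\<lambda>i\<in>insert j K. s * x i) \<partial>PiM (insert j K) (\<lambda>_. lborel))"
    by (rule product_nn_integral_insert_rev[symmetric]) (use insert in auto)
  finally show ?case .
qed

section \<open>Splitting independent gamma variables into total and proportions\<close>

lemma dirichlet_density_measurable [measurable]:
  assumes "finite J"
  shows "dirichlet_density J k \<beta> \<in> borel_measurable (PiM (J - {k}) (\<lambda>_. lborel))"
proof -
  have [simp]: "finite (J - {k})" using assms by simp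
  show ?thesis unfolding dirichlet_density_def by measurable
qed

lemma dirichlet_density_nonneg:
  assumes "finite J" "\<And>i. i \<in> J \<Longrightarrow> 0 < \<beta> i"
  shows "dirichlet_density J k \<beta> x \<ge> 0"
proof -
  have "Gamma (\<Sum>i\<in>J. \<beta> i) \<ge> 0"
    using assms by (cases "J = {}") (auto intro!: Gamma_real_nonneg sum_pos)
  then show ?thesis
    using assms(2)
    by (auto simp: dirichlet_density_def intro!: mult_nonneg_nonneg divide_nonneg_nonneg prod_nonneg)
qed

text \<open>
  The exponentials of the independent gamma densities multiply to \<open>exp (- t)\<close>, which depends on
  the total \<open>t\<close> only, and the powers of \<open>t\<close> collect to \<open>t powr (a - 1)\<close>. The factor
  \<open>t ^ card (J - {k})\<close> is the Jacobian of \<open>p \<mapsto> t p\<close>.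
\<close>

lemma gamma_dirichlet_density:
  assumes "finite J" "k \<in> J" "\<And>i. i \<in> J \<Longrightarrow> 0 < \<beta> i" "t > 0"
  shows "gamma_density (\<Sum>i\<in>J. \<beta> i) t * dirichlet_density J k \<beta> p =
         t ^ card (J - {k}) * ((\<Prod>i\<in>J - {k}. gamma_density (\<beta> i) (t * p i)) *
           gamma_density (\<beta> k) (t - (\<Sum>i\<in>J - {k}. t * p i)))"
proof (cases "(\<forall>i\<in>J - {k}. 0 < p i) \<and> (\<Sum>i\<in>J - {k}. p i) < 1")
  case False
  then have "(\<exists>i\<in>J - {k}. gamma_density (\<beta> i) (t * p i) = 0) \<or> gamma_density (\<beta> k) (t - (\<Sum>i\<in>J - {k}. t * p i)) = 0"
    using assms(4) by (auto simp: gamma_density_def zero_less_mult_iff sum_distrib_left[symmetric])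
  then show ?thesis using False assms(1) by (auto simp: dirichlet_density_def)
next
  case True
  let ?K = "J - {k}"
  define s where "s = (\<Sum>i\<in>?K. p i)"
  have s: "s < 1" using True by (simp add: s_def)
  have a: "(\<Sum>i\<in>J. \<beta> i) = \<beta> k + (\<Sum>i\<in>?K. \<beta> i)" "(\<Prod>i\<in>J. Gamma (\<beta> i)) = Gamma (\<beta> k) * (\<Prod>i\<in>?K. Gamma (\<beta> i))"
    using assms by (auto simp: sum.remove prod.remove)
  have ga: "Gamma (\<Sum>i\<in>J. \<beta> i) > 0"
    using assms by (intro Gamma_real_pos sum_pos) auto
  have gk: "Gamma (\<beta> k) > 0" using assms by auto
  have gp: "(\<Prod>i\<in>?K. Gamma (\<beta> i)) > 0" using assms by (intro prod_pos) auto
  have sumt: "(\<Sum>i\<in>?K. t * p i) = t * s" by (simp add: s_def sum_distrib_left)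
  have "(\<Prod>i\<in>?K. gamma_density (\<beta> i) (t * p i)) =
        (\<Prod>i\<in>?K. t powr (\<beta> i - 1) * exp (- (t * p i)) * p i powr (\<beta> i - 1) / Gamma (\<beta> i))"
    using True assms(4) by (intro prod.cong) (auto simp: gamma_density_def powr_mult)
  also have "\<dots> = t powr (\<Sum>i\<in>?K. \<beta> i - 1) * exp (- (t * s)) * (\<Prod>i\<in>?K. p i powr (\<beta> i - 1)) / (\<Prod>i\<in>?K. Gamma (\<beta> i))"
    using assms(1,4) by (simp add: prod_dividef prod.distrib powr_sum exp_sum[symmetric] sum_negf sumt)
  finally have P: "(\<Prod>i\<in>?K. gamma_density (\<beta> i) (t * p i)) = \<dots>" .
  have D: "gamma_density (\<beta> k) (t - (\<Sum>i\<in>?K. t * p i)) =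
     t powr (\<beta> k - 1) * (1 - s) powr (\<beta> k - 1) * exp (- t) * exp (t * s) / Gamma (\<beta> k)"
  proof -
    have "t - t * s = t * (1 - s)" by (simp add: algebra_simps)
    then show ?thesis using s assms(4)
      by (simp add: sumt gamma_density_def powr_mult exp_add[symmetric])
  qed
  have T: "t powr ((\<Sum>i\<in>J. \<beta> i) - 1) = t ^ card ?K * (t powr (\<Sum>i\<in>?K. \<beta> i - 1) * t powr (\<beta> k - 1))"
    using assms(4) by (simp add: powr_realpow[symmetric] powr_add[symmetric] a sum_subtractf algebra_simps)
  have E: "exp (- (t * s)) * exp (t * s) = 1" by (simp add: exp_add[symmetric])
  have "gamma_density (\<Sum>i\<in>J. \<beta> i) t * dirichlet_density J k \<beta> p =
      t powr ((\<Sum>i\<in>J. \<beta> i) - 1) * (exp (- (t * s)) * exp (t * s)) * (exp (- t) * (\<Prod>i\<in>?K. p i powr (\<beta> i - 1)) *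
        (1 - s) powr (\<beta> k - 1) / (Gamma (\<beta> k) * (\<Prod>i\<in>?K. Gamma (\<beta> i))))"
    unfolding E a(2)[symmetric] using True ga assms(4)
    by (simp add: dirichlet_density_def gamma_density_def s_def[symmetric])
  also have "\<dots> = t ^ card ?K * ((\<Prod>i\<in>?K. gamma_density (\<beta> i) (t * p i)) *
           gamma_density (\<beta> k) (t - (\<Sum>i\<in>?K. t * p i)))"
    unfolding P D T by (simp add: mult_ac)
  finally show ?thesis .
qed

text \<open>
  If \<open>T\<close> is gamma distributed and \<open>p\<close> is an independent Dirichlet vector, then \<open>T p\<close> has
  independent gamma coordinates. Only linear statistics of \<open>T p\<close> are needed, and nonnegative
  test functions avoid every integrability question. The left side is unfolded by the scaling
  \<open>x = t p\<close>, the order of integration is exchanged, and \<open>t\<close> is translated by the sum of the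
  coordinates \<open>x\<close>.
\<close>

lemma gamma_dirichlet_nn_integral:
  fixes u :: "nat \<Rightarrow> real" and f :: "real \<Rightarrow> ennreal"
  assumes J: "finite J" "k \<in> J" "\<And>i. i \<in> J \<Longrightarrow> 0 < \<beta> i"
    and [measurable]: "f \<in> borel_measurable borel"
  shows "(\<integral>\<^sup>+t. (\<integral>\<^sup>+p. ennreal (gamma_density (\<Sum>i\<in>J. \<beta> i) t * dirichlet_density J k \<beta> p) *
             f (t * ((\<Sum>i\<in>J - {k}. u i * p i) + u k * (1 - (\<Sum>i\<in>J - {k}. p i)))) \<partial>PiM (J - {k}) (\<lambda>_. lborel)) \<partial>lborel) =
         (\<integral>\<^sup>+x. (\<integral>\<^sup>+y. ennreal ((\<Prod>i\<in>J - {k}. gamma_density (\<beta> i) (x i)) * gamma_density (\<beta> k) y) *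
             f ((\<Sum>i\<in>J - {k}. u i * x i) + u k * y) \<partial>lborel) \<partial>PiM (J - {k}) (\<lambda>_. lborel))"
proof -
  let ?K = "J - {k}"
  have finK [simp]: "finite ?K" using J by simp
  interpret product_sigma_finite "\<lambda>_::nat. lborel :: real measure" by standard
  interpret K: sigma_finite_measure "PiM ?K (\<lambda>_. lborel :: real measure)" by (rule sigma_finite) (rule finK)
  interpret P: pair_sigma_finite "lborel :: real measure" "PiM ?K (\<lambda>_. lborel :: real measure)" ..
  \<comment> \<open>The integrand in terms of the coordinates \<open>x = t p\<close> and the total \<open>t\<close>.\<close>
  define h where "h t x = ennreal ((\<Prod>i\<in>?K. gamma_density (\<beta> i) (x i)) * gamma_density (\<beta> k) (t - (\<Sum>i\<in>?K. x i))) *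
      f ((\<Sum>i\<in>?K. u i * x i) + u k * (t - (\<Sum>i\<in>?K. x i)))" for t :: real and x :: "nat \<Rightarrow> real"
  have h_meas [measurable]: "(\<lambda>(t, x). h t x) \<in> borel_measurable (lborel \<Otimes>\<^sub>M PiM ?K (\<lambda>_. lborel))"
    unfolding h_def by measurable
  have h_meas2 [measurable]: "h t \<in> borel_measurable (PiM ?K (\<lambda>_. lborel))" for t
    unfolding h_def by measurable
  have "(\<integral>\<^sup>+p. ennreal (gamma_density (\<Sum>i\<in>J. \<beta> i) t * dirichlet_density J k \<beta> p) *
             f (t * ((\<Sum>i\<in>?K. u i * p i) + u k * (1 - (\<Sum>i\<in>?K. p i)))) \<partial>PiM ?K (\<lambda>_. lborel)) =
        (\<integral>\<^sup>+x. h t x \<partial>PiM ?K (\<lambda>_. lborel))" for t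
  proof (cases "t > 0")
    case True
    have eq: "ennreal (gamma_density (\<Sum>i\<in>J. \<beta> i) t * dirichlet_density J k \<beta> p) *
             f (t * ((\<Sum>i\<in>?K. u i * p i) + u k * (1 - (\<Sum>i\<in>?K. p i)))) =
          ennreal (t ^ card ?K) * h t (\<lambda>i\<in>?K. t * p i)" for p
    proof -
      have "t * ((\<Sum>i\<in>?K. u i * p i) + u k * (1 - (\<Sum>i\<in>?K. p i))) =
            (\<Sum>i\<in>?K. u i * (t * p i)) + u k * (t - (\<Sum>i\<in>?K. t * p i))"
        by (simp add: sum_distrib_left algebra_simps)
      moreover have "ennreal (t ^ card ?K * r) = ennreal (t ^ card ?K) * ennreal r" for r
        using True by (intro ennreal_mult') simp
      ultimately show ?thesis
        by (subst gamma_dirichlet_density) (use J True in \<open>auto simp: h_def mult.assoc\<close>)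
    qed
    have [measurable]: "(\<lambda>x. \<lambda>i\<in>?K. t * x i) \<in> PiM ?K (\<lambda>_. lborel) \<rightarrow>\<^sub>M PiM ?K (\<lambda>_. lborel)"
      by (rule measurable_restrict) measurable
    show ?thesis
      unfolding eq nn_integral_PiM_lborel_scale[OF finK True h_meas2]
      by (rule nn_integral_cmult) measurable
  next
    case False
    have "h t x = 0" for x
    proof (cases "\<forall>i\<in>?K. 0 < x i")
      case True
      then have "0 \<le> (\<Sum>i\<in>?K. x i)" by (intro sum_nonneg) (auto intro: less_imp_le)
      then have "gamma_density (\<beta> k) (t - (\<Sum>i\<in>?K. x i)) = 0"
        using \<open>\<not> t > 0\<close> by (simp add: gamma_density_def)
      then show ?thesis by (simp add: h_def)
    next
      case False
      then have "(\<Prod>i\<in>?K. gamma_density (\<beta> i) (x i)) = 0"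
        by (intro prod_zero[OF finK]) (auto simp: gamma_density_def)
      then show ?thesis by (simp add: h_def)
    qed
    then show ?thesis using False by (simp add: gamma_density_def)
  qed
  then have "(\<integral>\<^sup>+t. (\<integral>\<^sup>+p. ennreal (gamma_density (\<Sum>i\<in>J. \<beta> i) t * dirichlet_density J k \<beta> p) *
             f (t * ((\<Sum>i\<in>?K. u i * p i) + u k * (1 - (\<Sum>i\<in>?K. p i)))) \<partial>PiM ?K (\<lambda>_. lborel)) \<partial>lborel) =
        (\<integral>\<^sup>+t. (\<integral>\<^sup>+x. h t x \<partial>PiM ?K (\<lambda>_. lborel)) \<partial>lborel)"
    by simp
  also have "\<dots> = (\<integral>\<^sup>+x. (\<integral>\<^sup>+t. h t x \<partial>lborel) \<partial>PiM ?K (\<lambda>_. lborel))"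
    by (rule P.Fubini'[symmetric]) measurable
  also have "\<dots> = (\<integral>\<^sup>+x. (\<integral>\<^sup>+y. h ((\<Sum>i\<in>?K. x i) + 1 * y) x \<partial>lborel) \<partial>PiM ?K (\<lambda>_. lborel))"
  proof (rule nn_integral_cong)
    fix x :: "nat \<Rightarrow> real"
    have [measurable]: "(\<lambda>t. h t x) \<in> borel_measurable borel" unfolding h_def by measurable
    show "(\<integral>\<^sup>+t. h t x \<partial>lborel) = (\<integral>\<^sup>+y. h ((\<Sum>i\<in>?K. x i) + 1 * y) x \<partial>lborel)"
      using nn_integral_real_affine[of "\<lambda>t. h t x" 1 "\<Sum>i\<in>?K. x i"] by simp
  qed
  finally show ?thesis by (simp add: h_def)
qed

lemma gamma_density_integrable:
  assumes "b > 0"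
  shows "integrable lborel (gamma_density b)"
  by (rule integrableI_nonneg) (use assms gamma_density_nn_integral in \<open>auto simp: gamma_density_nonneg\<close>)

lemma gamma_density_fourier_integrable:
  assumes "b > 0"
  shows "integrable lborel (\<lambda>t. complex_of_real (gamma_density b t) * exp (\<i> * of_real (u * t)))"
  by (rule Bochner_Integration.integrable_bound[OF gamma_density_integrable[OF assms]])
     (auto simp: norm_mult)

text \<open>
  Both sides are the characteristic function at \<open>1\<close> of the same variable, a linear combination of
  independent gamma variables: on the left it is evaluated by integrating the total mass first,
  on the right by independence.
\<close>

lemma dirichlet_density_markov_krein:
  fixes u :: "nat \<Rightarrow> real"
  assumes J: "finite J" "k \<in> J" "\<And>i. i \<in> J \<Longrightarrow> 0 < \<beta> i"
  defines "L \<equiv> \<lambda>p. (\<Sum>i\<in>J - {k}. u i * p i) + u k * (1 - (\<Sum>i\<in>J - {k}. p i))"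
  shows "(LINT p|PiM (J - {k}) (\<lambda>_. lborel). of_real (dirichlet_density J k \<beta> p) *
            (1 - \<i> * of_real (L p)) powr (- of_real (\<Sum>i\<in>J. \<beta> i))) =
         (\<Prod>i\<in>J. (1 - \<i> * of_real (u i)) powr (- of_real (\<beta> i)))"
proof -
  let ?K = "J - {k}"
  let ?P = "PiM ?K (\<lambda>_. lborel :: real measure)"
  define a where "a = (\<Sum>i\<in>J. \<beta> i)"
  have a: "a > 0" unfolding a_def using J by (intro sum_pos) auto
  have finK: "finite ?K" using J by simp
  note J(1) [simp]
  interpret product_sigma_finite "\<lambda>_::nat. lborel :: real measure" by standard
  interpret K: sigma_finite_measure ?P by (rule sigma_finite) (rule finK)
  interpret P: pair_sigma_finite "lborel :: real measure" ?P ..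
  have L_meas [measurable]: "L \<in> borel_measurable ?P" unfolding L_def by measurable
  define g1 where "g1 = (\<lambda>(t, p). gamma_density a t * dirichlet_density J k \<beta> p)"
  define g2 where "g2 = (\<lambda>(y, x). (\<Prod>i\<in>?K. gamma_density (\<beta> i) (x i)) * gamma_density (\<beta> k) y)"
  have g1_meas [measurable]: "g1 \<in> borel_measurable (lborel \<Otimes>\<^sub>M ?P)" unfolding g1_def by measurable
  have g2_meas [measurable]: "g2 \<in> borel_measurable (lborel \<Otimes>\<^sub>M ?P)" unfolding g2_def by measurable
  have g1_nonneg: "g1 z \<ge> 0" for z
    unfolding g1_def using J a by (auto intro!: mult_nonneg_nonneg gamma_density_nonneg dirichlet_density_nonneg split: prod.split)
  have g2_nonneg: "g2 z \<ge> 0" for z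
    unfolding g2_def using J by (auto intro!: mult_nonneg_nonneg prod_nonneg gamma_density_nonneg split: prod.split)
  define V1 where "V1 = (\<lambda>(t::real, p). t * L p)"
  define V2 where "V2 = (\<lambda>(y, x). (\<Sum>i\<in>?K. u i * x i) + u k * y)"
  have V1_meas [measurable]: "V1 \<in> borel_measurable (lborel \<Otimes>\<^sub>M ?P)" unfolding V1_def by measurable
  have V2_meas [measurable]: "V2 \<in> borel_measurable (lborel \<Otimes>\<^sub>M ?P)" unfolding V2_def by measurable
  have key: "(\<integral>\<^sup>+z. ennreal (g1 z) * f (V1 z) \<partial>(lborel \<Otimes>\<^sub>M ?P)) = (\<integral>\<^sup>+z. ennreal (g2 z) * f (V2 z) \<partial>(lborel \<Otimes>\<^sub>M ?P))"
    if [measurable]: "f \<in> borel_measurable borel" for f :: "real \<Rightarrow> ennreal"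
  proof -
    have "(\<integral>\<^sup>+z. ennreal (g1 z) * f (V1 z) \<partial>(lborel \<Otimes>\<^sub>M ?P)) = (\<integral>\<^sup>+t. \<integral>\<^sup>+p. ennreal (g1 (t, p)) * f (V1 (t, p)) \<partial>?P \<partial>lborel)"
      by (rule K.nn_integral_fst[symmetric]) measurable
    also have "\<dots> = (\<integral>\<^sup>+x. \<integral>\<^sup>+y. ennreal (g2 (y, x)) * f (V2 (y, x)) \<partial>lborel \<partial>?P)"
      using gamma_dirichlet_nn_integral[OF J that, where u = u]
      by (simp add: g1_def g2_def V1_def V2_def L_def a_def)
    also have "\<dots> = (\<integral>\<^sup>+z. ennreal (g2 z) * f (V2 z) \<partial>(lborel \<Otimes>\<^sub>M ?P))"
      by (rule P.nn_integral_snd) measurable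
    finally show ?thesis .
  qed
  have mass2: "(\<integral>\<^sup>+z. ennreal (g2 z) \<partial>(lborel \<Otimes>\<^sub>M ?P)) = 1"
  proof -
    have "(\<integral>\<^sup>+z. ennreal (g2 z) \<partial>(lborel \<Otimes>\<^sub>M ?P)) = (\<integral>\<^sup>+x. \<integral>\<^sup>+y. ennreal (g2 (y, x)) \<partial>lborel \<partial>?P)"
      by (rule P.nn_integral_snd[symmetric]) measurable
    also have "\<dots> = (\<integral>\<^sup>+x. \<integral>\<^sup>+y. ennreal (\<Prod>i\<in>?K. gamma_density (\<beta> i) (x i)) * ennreal (gamma_density (\<beta> k) y) \<partial>lborel \<partial>?P)"
      unfolding g2_def using J by (intro nn_integral_cong) (auto intro!: ennreal_mult prod_nonneg gamma_density_nonneg)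
    also have "\<dots> = (\<integral>\<^sup>+x. ennreal (\<Prod>i\<in>?K. gamma_density (\<beta> i) (x i)) \<partial>?P)"
      using J by (simp add: nn_integral_cmult gamma_density_nn_integral)
    also have "\<dots> = (\<integral>\<^sup>+x. (\<Prod>i\<in>?K. ennreal (gamma_density (\<beta> i) (x i))) \<partial>?P)"
      using J by (intro nn_integral_cong) (auto intro!: prod_ennreal[symmetric] gamma_density_nonneg)
    also have "\<dots> = (\<Prod>i\<in>?K. \<integral>\<^sup>+t. ennreal (gamma_density (\<beta> i) t) \<partial>lborel)"
      by (rule product_nn_integral_prod) (use finK in auto)
    also have "\<dots> = 1" using J by (simp add: gamma_density_nn_integral)
    finally show ?thesis .
  qed
  have mass1: "(\<integral>\<^sup>+z. ennreal (g1 z) \<partial>(lborel \<Otimes>\<^sub>M ?P)) = 1"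
    using key[of "\<lambda>_. 1"] mass2 by simp
  have int: "integrable (lborel \<Otimes>\<^sub>M ?P) g1" "integrable (lborel \<Otimes>\<^sub>M ?P) g2"
    by (intro integrableI_nonneg; simp add: mass1 mass2 g1_nonneg g2_nonneg)+
  have int_exp: "integrable (lborel \<Otimes>\<^sub>M ?P) (\<lambda>z. complex_of_real (g z) * exp (\<i> * of_real (V z)))"
    if "integrable (lborel \<Otimes>\<^sub>M ?P) g" and [measurable]: "V \<in> borel_measurable (lborel \<Otimes>\<^sub>M ?P)" for g V
  proof -
    note [measurable] = borel_measurable_integrable[OF that(1)]
    show ?thesis by (rule Bochner_Integration.integrable_bound[OF that(1)]) (measurable, auto simp: norm_mult)
  qed
  have distr_eq: "distr (density (lborel \<Otimes>\<^sub>M ?P) g1) borel V1 = distr (density (lborel \<Otimes>\<^sub>M ?P) g2) borel V2"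
  proof (rule measure_eqI)
    fix A assume "A \<in> sets (distr (density (lborel \<Otimes>\<^sub>M ?P) g1) borel V1)"
    then have A [measurable]: "A \<in> sets borel" by simp
    have em: "emeasure (distr (density (lborel \<Otimes>\<^sub>M ?P) g) borel V) A = (\<integral>\<^sup>+z. ennreal (g z) * indicator A (V z) \<partial>(lborel \<Otimes>\<^sub>M ?P))"
      if [measurable]: "g \<in> borel_measurable (lborel \<Otimes>\<^sub>M ?P)" "V \<in> borel_measurable (lborel \<Otimes>\<^sub>M ?P)" for g V
    proof -
      have "emeasure (distr (density (lborel \<Otimes>\<^sub>M ?P) g) borel V) A = (\<integral>\<^sup>+v. indicator A v \<partial>distr (density (lborel \<Otimes>\<^sub>M ?P) g) borel V)"
        by simp
      also have "\<dots> = (\<integral>\<^sup>+z. ennreal (g z) * indicator A (V z) \<partial>(lborel \<Otimes>\<^sub>M ?P))"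
        by (subst nn_integral_distr) (auto simp: nn_integral_density)
      finally show ?thesis .
    qed
    show "emeasure (distr (density (lborel \<Otimes>\<^sub>M ?P) g1) borel V1) A = emeasure (distr (density (lborel \<Otimes>\<^sub>M ?P) g2) borel V2) A"
      unfolding em[OF g1_meas V1_meas] em[OF g2_meas V2_meas] by (rule key) simp
  qed simp
  have exp_distr: "(LINT v|distr (density (lborel \<Otimes>\<^sub>M ?P) g) borel V. exp (\<i> * complex_of_real v)) =
        (LINT z|(lborel \<Otimes>\<^sub>M ?P). complex_of_real (g z) * exp (\<i> * of_real (V z)))"
    if [measurable]: "g \<in> borel_measurable (lborel \<Otimes>\<^sub>M ?P)" "V \<in> borel_measurable (lborel \<Otimes>\<^sub>M ?P)" and "\<And>z. g z \<ge> 0" for g V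
    using that(3) by (subst integral_distr) (auto simp: integral_density scaleR_conv_of_real)
  have "(LINT z|(lborel \<Otimes>\<^sub>M ?P). complex_of_real (g1 z) * exp (\<i> * of_real (V1 z))) =
        (LINT z|(lborel \<Otimes>\<^sub>M ?P). complex_of_real (g2 z) * exp (\<i> * of_real (V2 z)))"
    using exp_distr[of g1 V1] exp_distr[of g2 V2] distr_eq g1_nonneg g2_nonneg by simp
  also have "(LINT z|(lborel \<Otimes>\<^sub>M ?P). complex_of_real (g1 z) * exp (\<i> * of_real (V1 z))) =
     (LINT p|?P. LINT t|lborel. complex_of_real (g1 (t, p)) * exp (\<i> * of_real (V1 (t, p))))"
    using P.integral_snd[of "\<lambda>t p. complex_of_real (g1 (t, p)) * exp (\<i> * of_real (V1 (t, p)))"] int_exp[OF int(1), of V1]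
    by (simp add: case_prod_unfold)
  also have "\<dots> = (LINT p|?P. of_real (dirichlet_density J k \<beta> p) *
            (1 - \<i> * of_real (L p)) powr (- of_real a))"
  proof (intro Bochner_Integration.integral_cong refl)
    fix p
    have "(LINT t|lborel. complex_of_real (g1 (t, p)) * exp (\<i> * of_real (V1 (t, p)))) =
          (LINT t|lborel. of_real (dirichlet_density J k \<beta> p) * (of_real (gamma_density a t) * exp (\<i> * of_real (L p * t))))"
      by (simp add: g1_def V1_def mult_ac)
    also have "\<dots> = of_real (dirichlet_density J k \<beta> p) * (1 - \<i> * of_real (L p)) powr (- of_real a)"
      by (subst integral_mult_right_zero, subst gamma_density_fourier[OF a]) auto
    finally show "(LINT t|lborel. complex_of_real (g1 (t, p)) * exp (\<i> * of_real (V1 (t, p)))) = \<dots>" .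
  qed
  also have "(LINT z|(lborel \<Otimes>\<^sub>M ?P). complex_of_real (g2 z) * exp (\<i> * of_real (V2 z))) =
     (LINT x|?P. LINT y|lborel. complex_of_real (g2 (y, x)) * exp (\<i> * of_real (V2 (y, x))))"
    using P.integral_snd[of "\<lambda>t p. complex_of_real (g2 (t, p)) * exp (\<i> * of_real (V2 (t, p)))"] int_exp[OF int(2), of V2]
    by (simp add: case_prod_unfold)
  also have "\<dots> = (LINT x|?P. (\<Prod>i\<in>?K. of_real (gamma_density (\<beta> i) (x i)) * exp (\<i> * of_real (u i * x i))) *
        (1 - \<i> * of_real (u k)) powr (- of_real (\<beta> k)))"
  proof (intro Bochner_Integration.integral_cong refl)
    fix x
    have "(LINT y|lborel. complex_of_real (g2 (y, x)) * exp (\<i> * of_real (V2 (y, x)))) =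
          (LINT y|lborel. (\<Prod>i\<in>?K. of_real (gamma_density (\<beta> i) (x i)) * exp (\<i> * of_real (u i * x i))) *
             (of_real (gamma_density (\<beta> k) y) * exp (\<i> * of_real (u k * y))))"
      by (simp add: g2_def V2_def ring_distribs exp_add exp_sum[OF finK] prod.distrib sum_distrib_left mult_ac)
    also have "\<dots> = (\<Prod>i\<in>?K. of_real (gamma_density (\<beta> i) (x i)) * exp (\<i> * of_real (u i * x i))) *
        (1 - \<i> * of_real (u k)) powr (- of_real (\<beta> k))"
      by (subst integral_mult_right_zero, subst gamma_density_fourier) (use J in auto)
    finally show "(LINT y|lborel. complex_of_real (g2 (y, x)) * exp (\<i> * of_real (V2 (y, x)))) = \<dots>" .
  qed
  also have "\<dots> = (\<Prod>i\<in>?K. LINT t|lborel. of_real (gamma_density (\<beta> i) t) * exp (\<i> * of_real (u i * t))) *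
        (1 - \<i> * of_real (u k)) powr (- of_real (\<beta> k))"
    by (subst integral_mult_left_zero, subst product_integral_prod)
       (use J finK in \<open>auto simp del: of_real_mult intro!: gamma_density_fourier_integrable\<close>)
  also have "\<dots> = (\<Prod>i\<in>?K. (1 - \<i> * of_real (u i)) powr (- of_real (\<beta> i))) * (1 - \<i> * of_real (u k)) powr (- of_real (\<beta> k))"
    using J by (intro arg_cong2[where f = "(*)"] prod.cong refl gamma_density_fourier) auto
  also have "\<dots> = (\<Prod>i\<in>J. (1 - \<i> * of_real (u i)) powr (- of_real (\<beta> i)))"
    using J by (simp add: prod.remove mult.commute)
  finally show ?thesis by (simp add: a_def)
qed

section \<open>The Dirichlet process on finite partitions\<close>

text \<open>
  Cells of mass zero disappear from the product because their factors are \<open>1\<close>, and from the linear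
  combination because their coordinates vanish; the weight left over by the first \<open>n\<close>
  coordinates belongs to cell \<open>n\<close>.
\<close>

lemma dirichlet_dist_markov_krein:
  fixes u :: "nat \<Rightarrow> real"
  assumes "\<And>i. i \<le> n \<Longrightarrow> 0 \<le> \<beta> i" "(\<Sum>i\<le>n. \<beta> i) > 0"
  shows "(LINT p|dirichlet_dist n \<beta>.
           (1 - \<i> * of_real ((\<Sum>i<n. u i * p i) + u n * (1 - (\<Sum>i<n. p i)))) powr (- of_real (\<Sum>i\<le>n. \<beta> i))) =
         (\<Prod>i\<le>n. (1 - \<i> * of_real (u i)) powr (- of_real (\<beta> i)))"
proof -
  define J where "J = {i. i \<le> n \<and> 0 < \<beta> i}"
  define k where "k = Max J"
  have finJ [simp]: "finite J" unfolding J_def by simp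
  have finK: "finite (J - {k})" by simp
  have "J \<noteq> {}"
  proof
    assume "J = {}"
    then have "\<beta> i = 0" if "i \<le> n" for i using assms(1)[OF that] that unfolding J_def by force
    then show False using assms(2) by simp
  qed
  then have k: "k \<in> J" unfolding k_def by (intro Max_in) auto
  have kmax: "i < k" if "i \<in> J - {k}" for i
    using that Max_ge[OF finJ, of i] unfolding k_def by (simp add: less_le)
  have kn: "k \<le> n" using k by (simp add: J_def)
  have Jn: "J \<subseteq> {..n}" by (auto simp: J_def)
  have outside: "\<beta> i = 0" if "i \<in> {..n} - J" for i
    using that assms(1)[of i] by (auto simp: J_def)
  have sumJ: "(\<Sum>i\<le>n. \<beta> i) = (\<Sum>i\<in>J. \<beta> i)"
    by (rule sum.mono_neutral_right) (use Jn outside in auto)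
  have nz: "1 - \<i> * complex_of_real y \<noteq> 0" for y
    by (auto simp: complex_eq_iff)
  have prodJ: "(\<Prod>i\<le>n. (1 - \<i> * of_real (u i)) powr (- of_real (\<beta> i))) =
      (\<Prod>i\<in>J. (1 - \<i> * of_real (u i)) powr (- of_real (\<beta> i)))"
    by (rule prod.mono_neutral_right) (use Jn outside nz in auto)
  \<comment> \<open>The coordinate map in the definition of the Dirichlet law. Index \<open>k\<close> may equal \<open>n\<close>, in which
    case the remaining weight is not one of the first \<open>n\<close> coordinates.\<close>
  define T where "T = (\<lambda>x. \<lambda>i\<in>{..<n}. if i \<in> J - {k} then x i
                        else if i = k then 1 - (\<Sum>j\<in>J - {k}. x j) else (0::real))"
  have T_meas [measurable]: "T \<in> PiM (J - {k}) (\<lambda>_. lborel) \<rightarrow>\<^sub>M PiM {..<n} (\<lambda>_. borel)"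
    unfolding T_def
  proof (rule measurable_restrict)
    fix i assume "i \<in> {..<n}"
    show "(\<lambda>x. if i \<in> J - {k} then x i else if i = k then 1 - (\<Sum>j\<in>J - {k}. x j) else 0)
       \<in> borel_measurable (PiM (J - {k}) (\<lambda>_. lborel))"
      by (cases "i \<in> J - {k}"; cases "i = k"; simp del: Diff_iff; measurable)
  qed
  have T_sum: "(\<Sum>i<n. v i * T x i) + v n * (1 - (\<Sum>i<n. T x i)) =
      (\<Sum>i\<in>J - {k}. v i * x i) + v k * (1 - (\<Sum>i\<in>J - {k}. x i))" for v x
  proof -
    define S where "S = (\<Sum>i\<in>J - {k}. x i)"
    have sub: "J - {k} \<subseteq> {..<n}" using kmax kn by fastforce
    have split: "(\<Sum>i<n. w i * T x i) = (\<Sum>i\<in>J - {k}. w i * x i) + (if k < n then w k * (1 - S) else 0)" for w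
    proof -
      have "(\<Sum>i<n. w i * T x i) = (\<Sum>i<n. (if i \<in> J - {k} then w i * x i else 0) + (if i = k then w k * (1 - S) else 0))"
        by (intro sum.cong) (auto simp: T_def S_def)
      also have "\<dots> = (\<Sum>i\<in>J - {k}. w i * x i) + (if k < n then w k * (1 - S) else 0)"
      proof -
        have "(\<Sum>i<n. if i \<in> J - {k} then w i * x i else 0) = (\<Sum>i\<in>J - {k}. w i * x i)"
          using sub by (simp add: sum.inter_restrict[symmetric] Int_absorb1 del: Diff_iff)
        then show ?thesis by (simp add: sum.distrib)
      qed
      finally show ?thesis .
    qed
    have "(\<Sum>i<n. T x i) = S + (if k < n then 1 - S else 0)"
      using split[of "\<lambda>_. 1"] by (simp add: S_def)
    then show ?thesis using kn unfolding split by (auto simp: S_def)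
  qed
  have D_meas [measurable]: "dirichlet_density J k \<beta> \<in> borel_measurable (PiM (J - {k}) (\<lambda>_. lborel))"
    by (rule dirichlet_density_measurable) simp
  have D_nonneg: "dirichlet_density J k \<beta> x \<ge> 0" for x
    by (rule dirichlet_density_nonneg) (auto simp: J_def)
  have "(LINT p|dirichlet_dist n \<beta>.
           (1 - \<i> * of_real ((\<Sum>i<n. u i * p i) + u n * (1 - (\<Sum>i<n. p i)))) powr (- of_real (\<Sum>i\<le>n. \<beta> i))) =
     (LINT p|distr (density (PiM (J - {k}) (\<lambda>_. lborel)) (\<lambda>x. ennreal (dirichlet_density J k \<beta> x)))
        (PiM {..<n} (\<lambda>_. borel)) T.
           (1 - \<i> * of_real ((\<Sum>i<n. u i * p i) + u n * (1 - (\<Sum>i<n. p i)))) powr (- of_real (\<Sum>i\<le>n. \<beta> i)))"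
    unfolding dirichlet_dist_def Let_def J_def[symmetric] k_def[symmetric] T_def[symmetric] by (rule refl)
  also have "\<dots> = (LINT x|density (PiM (J - {k}) (\<lambda>_. lborel)) (\<lambda>x. ennreal (dirichlet_density J k \<beta> x)).
           (1 - \<i> * of_real ((\<Sum>i\<in>J - {k}. u i * x i) + u k * (1 - (\<Sum>i\<in>J - {k}. x i)))) powr (- of_real (\<Sum>i\<le>n. \<beta> i)))"
    by (subst integral_distr) (auto simp: T_sum)
  also have "\<dots> = (LINT x|PiM (J - {k}) (\<lambda>_. lborel). of_real (dirichlet_density J k \<beta> x) *
           (1 - \<i> * of_real ((\<Sum>i\<in>J - {k}. u i * x i) + u k * (1 - (\<Sum>i\<in>J - {k}. x i)))) powr (- of_real (\<Sum>i\<le>n. \<beta> i)))"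
    by (subst integral_density) (auto simp: scaleR_conv_of_real D_nonneg)
  also have "\<dots> = (\<Prod>i\<in>J. (1 - \<i> * of_real (u i)) powr (- of_real (\<beta> i)))"
    unfolding sumJ by (rule dirichlet_density_markov_krein) (use k in \<open>auto simp: J_def\<close>)
  finally show ?thesis unfolding prodJ .
qed

lemma dirichlet_process_space:
  assumes "dirichlet_process \<alpha> M \<phi>" "\<omega> \<in> space M"
  shows "prob_space (\<phi> \<omega>)" "sets (\<phi> \<omega>) = sets borel" "space (\<phi> \<omega>) = UNIV"
proof -
  have "\<phi> \<omega> \<in> space (prob_algebra borel)"
    using assms by (auto simp: dirichlet_process_def dest: measurable_space)
  then show "prob_space (\<phi> \<omega>)" and s: "sets (\<phi> \<omega>) = sets borel" by (auto simp: space_prob_algebra)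
  then show "space (\<phi> \<omega>) = UNIV" using sets_eq_imp_space_eq[OF s] by simp
qed

lemma dirichlet_process_partition:
  fixes u :: "nat \<Rightarrow> real"
  assumes D: "dirichlet_process \<alpha> M \<phi>" and \<alpha>: "finite_measure \<alpha>" "sets \<alpha> = sets borel" "measure \<alpha> UNIV = a" "a > 0"
    and C: "\<And>i. i \<le> n \<Longrightarrow> C i \<in> sets borel" "disjoint_family_on C {..n}" "(\<Union>i\<le>n. C i) = UNIV"
  shows "(LINT \<omega>|M. (1 - \<i> * of_real (\<Sum>i\<le>n. u i * measure (\<phi> \<omega>) (C i))) powr (- of_real a)) =
         (\<Prod>i\<le>n. (1 - \<i> * of_real (u i)) powr (- of_real (measure \<alpha> (C i))))"
proof -
  interpret \<alpha>: finite_measure \<alpha> by fact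
  have spa: "space \<alpha> = UNIV" using sets_eq_imp_space_eq[OF \<alpha>(2)] by simp
  have "a = measure \<alpha> (\<Union>i\<le>n. C i)" using \<alpha>(3) C(3) by simp
  also have "\<dots> = (\<Sum>i\<le>n. measure \<alpha> (C i))"
    by (rule \<alpha>.finite_measure_finite_Union) (use C \<alpha> in auto)
  finally have a: "a = (\<Sum>i\<le>n. measure \<alpha> (C i))" .
  have \<phi> [measurable]: "\<phi> \<in> M \<rightarrow>\<^sub>M subprob_algebra borel"
    using D by (auto simp: dirichlet_process_def intro: measurable_prob_algebraD)
  have C' [measurable]: "C i \<in> sets borel" if "i \<in> {..n}" for i using C(1) that by simp
  define P where "P \<omega> = (\<lambda>i\<in>{..<n}. measure (\<phi> \<omega>) (C i))" for \<omega>
  have P_meas [measurable]: "P \<in> M \<rightarrow>\<^sub>M PiM {..<n} (\<lambda>_. borel)"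
    unfolding P_def
  proof (rule measurable_restrict)
    fix i assume "i \<in> {..<n}"
    then have [measurable]: "C i \<in> sets borel" using C(1) by simp
    show "(\<lambda>\<omega>. measure (\<phi> \<omega>) (C i)) \<in> borel_measurable M" by measurable
  qed
  have law: "distr M (PiM {..<n} (\<lambda>_. borel)) P = dirichlet_dist n (\<lambda>i. measure \<alpha> (C i))"
    using D C unfolding dirichlet_process_def P_def by blast
  have "(LINT \<omega>|M. (1 - \<i> * of_real (\<Sum>i\<le>n. u i * measure (\<phi> \<omega>) (C i))) powr (- of_real a)) =
        (LINT \<omega>|M. (1 - \<i> * of_real ((\<Sum>i<n. u i * P \<omega> i) + u n * (1 - (\<Sum>i<n. P \<omega> i)))) powr (- of_real a))"
  proof (rule Bochner_Integration.integral_cong)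
    fix \<omega> assume \<omega>: "\<omega> \<in> space M"
    interpret \<phi>: prob_space "\<phi> \<omega>" by (rule dirichlet_process_space[OF D \<omega>])
    have "1 = measure (\<phi> \<omega>) (\<Union>i\<le>n. C i)"
      using C(3) \<phi>.prob_space dirichlet_process_space[OF D \<omega>] by simp
    also have "\<dots> = (\<Sum>i\<le>n. measure (\<phi> \<omega>) (C i))"
      by (rule \<phi>.finite_measure_finite_Union) (use C dirichlet_process_space[OF D \<omega>] in auto)
    finally have "(\<Sum>i\<le>n. measure (\<phi> \<omega>) (C i)) = 1" by simp
    then have "measure (\<phi> \<omega>) (C n) = 1 - (\<Sum>i<n. P \<omega> i)"
      by (simp add: lessThan_Suc_atMost[symmetric] P_def)
    then show "(1 - \<i> * of_real (\<Sum>i\<le>n. u i * measure (\<phi> \<omega>) (C i))) powr (- complex_of_real a) =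
        (1 - \<i> * of_real ((\<Sum>i<n. u i * P \<omega> i) + u n * (1 - (\<Sum>i<n. P \<omega> i)))) powr (- of_real a)"
      by (simp add: lessThan_Suc_atMost[symmetric] P_def)
  qed simp
  also have "\<dots> = (LINT p|distr M (PiM {..<n} (\<lambda>_. borel)) P.
      (1 - \<i> * of_real ((\<Sum>i<n. u i * p i) + u n * (1 - (\<Sum>i<n. p i)))) powr (- of_real a))"
    by (subst integral_distr) auto
  also have "\<dots> = (\<Prod>i\<le>n. (1 - \<i> * of_real (u i)) powr (- of_real (measure \<alpha> (C i))))"
    unfolding law a by (rule dirichlet_dist_markov_krein) (use a \<alpha>(4) in auto)
  finally show ?thesis .
qed

lemma integral_finite_range:
  fixes f :: "'a \<Rightarrow> 'b" and g :: "'b \<Rightarrow> 'c :: {banach, second_countable_topology}"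
  assumes "finite_measure N" "inj_on u {..n::nat}" "range f = u ` {..n}" "\<And>i. i \<le> n \<Longrightarrow> f -` {u i} \<in> sets N"
  shows "(LINT x|N. g (f x)) = (\<Sum>i\<le>n. measure N (f -` {u i}) *\<^sub>R g (u i))"
proof -
  interpret finite_measure N by fact
  have "g (f x) = (\<Sum>i\<le>n. indicator (f -` {u i}) x *\<^sub>R g (u i))" for x
  proof -
    have "f x \<in> u ` {..n}" using assms(3) by blast
    then obtain j where j: "j \<le> n" "f x = u j" by auto
    have "(\<Sum>i\<le>n. indicator (f -` {u i}) x *\<^sub>R g (u i)) = (\<Sum>i\<le>n. if i = j then g (u i) else 0)"
      using j assms(2) by (intro sum.cong) (auto simp: indicator_def inj_on_def)
    then show ?thesis using j by simp
  qed
  then have "(LINT x|N. g (f x)) = (LINT x|N. (\<Sum>i\<le>n. indicator (f -` {u i}) x *\<^sub>R g (u i)))" by simp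
  also have "\<dots> = (\<Sum>i\<le>n. measure N (f -` {u i}) *\<^sub>R g (u i))"
  proof -
    have ind: "integrable N (indicator (f -` {u i}) :: 'a \<Rightarrow> real)" if "i \<le> n" for i
      using assms(4)[OF that] by (intro integrable_real_indicator) (auto simp: less_top[symmetric])
    have "(LINT x|N. indicator (f -` {u i}) x *\<^sub>R g (u i)) = measure N (f -` {u i}) *\<^sub>R g (u i)" if "i \<le> n" for i
      using assms(4)[OF that] ind[OF that] by (simp add: sets.Int_space_eq2)
    moreover have "(LINT x|N. (\<Sum>i\<le>n. indicator (f -` {u i}) x *\<^sub>R g (u i))) =
       (\<Sum>i\<le>n. LINT x|N. indicator (f -` {u i}) x *\<^sub>R g (u i))"
      by (rule Bochner_Integration.integral_sum) (use ind in \<open>auto intro: integrable_scaleR_left\<close>)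
    ultimately show ?thesis by simp
  qed
  finally show ?thesis .
qed

lemma dirichlet_process_simple:
  fixes f :: "real \<Rightarrow> real"
  assumes D: "dirichlet_process \<alpha> M \<phi>" and \<alpha>: "finite_measure \<alpha>" "sets \<alpha> = sets borel" "measure \<alpha> UNIV = a" "a > 0"
    and f: "f \<in> borel_measurable borel" "finite (range f)"
  shows "(LINT \<omega>|M. (1 - \<i> * of_real (LINT x|\<phi> \<omega>. f x)) powr (- of_real a)) =
         exp (- (LINT x|\<alpha>. Ln (1 - \<i> * of_real (f x))))"
proof -
  obtain h where h: "bij_betw h {0..<card (range f)} (range f)"
    using ex_bij_betw_nat_finite[OF f(2)] by blast
  define n where "n = card (range f) - 1"
  have "card (range f) > 0" using f(2) by (simp add: card_gt_0_iff)
  then have "{0..<card (range f)} = {..n}" unfolding n_def by auto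
  with h have h: "inj_on h {..n}" "range f = h ` {..n}" by (auto simp: bij_betw_def)
  define C where "C i = f -` {h i}" for i
  have C: "C i \<in> sets borel" for i
    unfolding C_def using measurable_sets[OF f(1), of "{h i}"] by simp
  have nz: "1 - \<i> * complex_of_real y \<noteq> 0" for y
    by (auto simp: complex_eq_iff)
  have "(LINT \<omega>|M. (1 - \<i> * of_real (LINT x|\<phi> \<omega>. f x)) powr (- of_real a)) =
        (LINT \<omega>|M. (1 - \<i> * of_real (\<Sum>i\<le>n. h i * measure (\<phi> \<omega>) (C i))) powr (- of_real a))"
  proof (rule Bochner_Integration.integral_cong)
    fix \<omega> assume \<omega>: "\<omega> \<in> space M"
    interpret \<phi>: prob_space "\<phi> \<omega>" by (rule dirichlet_process_space[OF D \<omega>])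
    have "(LINT x|\<phi> \<omega>. f x) = (\<Sum>i\<le>n. h i * measure (\<phi> \<omega>) (C i))"
      using integral_finite_range[of "\<phi> \<omega>" h n f "\<lambda>x. x"] \<phi>.finite_measure_axioms h C dirichlet_process_space(2)[OF D \<omega>]
      by (simp add: C_def mult.commute)
    then show "(1 - \<i> * of_real (LINT x|\<phi> \<omega>. f x)) powr (- complex_of_real a) =
       (1 - \<i> * of_real (\<Sum>i\<le>n. h i * measure (\<phi> \<omega>) (C i))) powr (- of_real a)" by simp
  qed simp
  also have "\<dots> = (\<Prod>i\<le>n. (1 - \<i> * of_real (h i)) powr (- of_real (measure \<alpha> (C i))))"
  proof (rule dirichlet_process_partition[OF D \<alpha>])
    show "disjoint_family_on C {..n}" using h(1) by (auto simp: disjoint_family_on_def C_def inj_on_def)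
    show "(\<Union>i\<le>n. C i) = UNIV" using h(2) by (auto simp: C_def) (metis atMost_iff imageE rangeI)
  qed (rule C)
  also have "\<dots> = exp (- (\<Sum>i\<le>n. measure \<alpha> (C i) *\<^sub>R Ln (1 - \<i> * of_real (h i))))"
    using nz by (simp add: exp_sum sum_negf[symmetric] powr_def scaleR_conv_of_real)
  also have "(\<Sum>i\<le>n. measure \<alpha> (C i) *\<^sub>R Ln (1 - \<i> * of_real (h i))) = (LINT x|\<alpha>. Ln (1 - \<i> * of_real (f x)))"
    unfolding C_def
    by (rule integral_finite_range[of \<alpha> h n f "\<lambda>y. Ln (1 - \<i> * of_real y)", symmetric]) (use \<alpha> h C in \<open>auto simp: C_def\<close>)
  finally show ?thesis .
qed

section \<open>Extension to log-integrable functions\<close>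

lemma norm_powr_of_real: "z \<noteq> 0 \<Longrightarrow> norm (z powr complex_of_real r) = norm z powr r"
  by (simp add: powr_def norm_exp_eq_Re)

text \<open>The characteristic function at \<open>y\<close> of the Gamma law with parameter \<open>a\<close>.\<close>

definition cauchy_kernel :: "real \<Rightarrow> real \<Rightarrow> complex" where
  "cauchy_kernel a y = (1 - \<i> * of_real y) powr (- of_real a)"

lemma one_minus_i_not_nonpos: "1 - \<i> * complex_of_real y \<notin> \<real>\<^sub>\<le>\<^sub>0"
  by (auto simp: complex_nonpos_Reals_iff)

lemma one_minus_i_nonzero: "1 - \<i> * complex_of_real y \<noteq> 0"
  by (auto simp: complex_eq_iff)

lemma norm_one_minus_i: "norm (1 - \<i> * complex_of_real y) = sqrt (1 + y\<^sup>2)"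
  by (simp add: cmod_def)

lemma norm_one_minus_i_bounds:
  "1 \<le> norm (1 - \<i> * complex_of_real y)" "\<bar>y\<bar> \<le> norm (1 - \<i> * complex_of_real y)"
  "norm (1 - \<i> * complex_of_real y) \<le> 1 + \<bar>y\<bar>"
proof -
  show "1 \<le> norm (1 - \<i> * complex_of_real y)" "\<bar>y\<bar> \<le> norm (1 - \<i> * complex_of_real y)"
    unfolding norm_one_minus_i by (auto intro!: real_le_rsqrt)
  have "norm (1 - \<i> * complex_of_real y) \<le> norm (1::complex) + norm (\<i> * complex_of_real y)"
    by (rule norm_triangle_ineq4)
  then show "norm (1 - \<i> * complex_of_real y) \<le> 1 + \<bar>y\<bar>" by (simp add: norm_mult)
qed

lemma continuous_on_Ln_one_minus_i: "continuous_on UNIV (\<lambda>y. Ln (1 - \<i> * complex_of_real y))"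
  by (intro continuous_intros) (use one_minus_i_not_nonpos in auto)

lemma measurable_Ln_one_minus_i [measurable]: "(\<lambda>y. Ln (1 - \<i> * complex_of_real y)) \<in> borel_measurable borel"
  by (rule borel_measurable_continuous_onI[OF continuous_on_Ln_one_minus_i])

lemma isCont_Ln_one_minus_i: "isCont (\<lambda>y. Ln (1 - \<i> * complex_of_real y)) y"
  using continuous_on_Ln_one_minus_i by (simp add: continuous_on_eq_continuous_at)

lemma cauchy_kernel_exp: "cauchy_kernel a y = exp (- of_real a * Ln (1 - \<i> * of_real y))"
  using one_minus_i_nonzero by (simp add: cauchy_kernel_def powr_def)

lemma cauchy_kernel_measurable [measurable]: "cauchy_kernel a \<in> borel_measurable borel"
  unfolding cauchy_kernel_exp[abs_def] by measurable

lemma isCont_cauchy_kernel: "isCont (cauchy_kernel a) y"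
  unfolding cauchy_kernel_exp[abs_def] by (intro continuous_intros isCont_Ln_one_minus_i)

lemma cauchy_kernel_0 [simp]: "cauchy_kernel a 0 = 1"
  by (simp add: cauchy_kernel_def)

lemma norm_cauchy_kernel: "norm (cauchy_kernel a y) = norm (1 - \<i> * complex_of_real y) powr (- a)"
  unfolding cauchy_kernel_def using norm_powr_of_real[OF one_minus_i_nonzero, of y "- a"] by simp

lemma norm_cauchy_kernel_le: "a > 0 \<Longrightarrow> norm (cauchy_kernel a y) \<le> 1"
  unfolding norm_cauchy_kernel using norm_one_minus_i_bounds(1)[of y]
  powr_mono2'[of "- a" 1 "norm (1 - \<i> * complex_of_real y)"] by simp

text \<open>
  This is what makes the kernel blind to infinite means: in the limit they contribute \<open>0\<close>.
\<close>

lemma cauchy_kernel_at_top: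
  assumes a: "a > 0" and f: "filterlim f at_top F"
  shows "((\<lambda>x. cauchy_kernel a (f x)) \<longlongrightarrow> 0) F"
proof (rule tendsto_norm_zero_cancel, rule tendsto_sandwich[where f = "\<lambda>_. 0" and h = "\<lambda>x. f x powr (- a)"])
  have "((\<lambda>y::real. y powr (- a)) \<longlongrightarrow> 0) at_top"
    by (rule tendsto_neg_powr) (use a filterlim_ident in auto)
  then show "((\<lambda>x. f x powr (- a)) \<longlongrightarrow> 0) F"
    using f by (rule filterlim_compose)
  have "eventually (\<lambda>x. f x > 0) F" using f by (auto simp: filterlim_at_top_dense)
  then show "\<forall>\<^sub>F x in F. norm (cauchy_kernel a (f x)) \<le> f x powr (- a)"
  proof eventually_elim
    case (elim x)
    then show ?case unfolding norm_cauchy_kernel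
      using norm_one_minus_i_bounds(2)[of "f x"] a by (intro powr_mono2') auto
  qed
qed auto

lemma norm_Ln_one_minus_i_le: "norm (Ln (1 - \<i> * complex_of_real y)) \<le> ln (1 + \<bar>y\<bar>) + pi"
proof -
  let ?z = "1 - \<i> * complex_of_real y"
  have "norm (Ln ?z) \<le> \<bar>Re (Ln ?z)\<bar> + \<bar>Im (Ln ?z)\<bar>" by (rule cmod_le)
  moreover have "\<bar>Re (Ln ?z)\<bar> \<le> ln (1 + \<bar>y\<bar>)"
    using norm_one_minus_i_bounds[of y] one_minus_i_nonzero[of y] by simp
  moreover have "\<bar>Im (Ln ?z)\<bar> \<le> pi"
    using mpi_less_Im_Ln[OF one_minus_i_nonzero[of y]] Im_Ln_le_pi[OF one_minus_i_nonzero[of y]] by linarith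
  ultimately show ?thesis by linarith
qed

text \<open>
  The real part of the logarithm grows like \<open>ln (1 + |h|)\<close> and the imaginary part is bounded, so
  logarithmic integrability of one dominating function suffices.
\<close>

lemma tendsto_integral_Ln_one_minus_i:
  fixes f :: "nat \<Rightarrow> real \<Rightarrow> real"
  assumes "finite_measure \<alpha>" "sets \<alpha> = sets borel" "integrable \<alpha> (\<lambda>x. ln (1 + \<bar>h x\<bar>))"
    and "\<And>n. f n \<in> borel_measurable borel" "g \<in> borel_measurable borel"
    and lim: "\<And>x. (\<lambda>n. f n x) \<longlonglongrightarrow> g x" and bound: "\<And>n x. \<bar>f n x\<bar> \<le> \<bar>h x\<bar>"
  shows "(\<lambda>n. LINT x|\<alpha>. Ln (1 - \<i> * of_real (f n x))) \<longlonglongrightarrow> (LINT x|\<alpha>. Ln (1 - \<i> * of_real (g x)))"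
proof (rule integral_dominated_convergence[where w = "\<lambda>x. ln (1 + \<bar>h x\<bar>) + pi"])
  interpret finite_measure \<alpha> by fact
  note [measurable_cong] = assms(2)
  note [measurable] = assms(4,5)
  show "(\<lambda>x. Ln (1 - \<i> * of_real (g x))) \<in> borel_measurable \<alpha>" by measurable
  show "(\<lambda>x. Ln (1 - \<i> * of_real (f n x))) \<in> borel_measurable \<alpha>" for n by measurable
  show "integrable \<alpha> (\<lambda>x. ln (1 + \<bar>h x\<bar>) + pi)" using assms(3) by simp
  show "AE x in \<alpha>. (\<lambda>n. Ln (1 - \<i> * of_real (f n x))) \<longlonglongrightarrow> Ln (1 - \<i> * of_real (g x))"
    using isCont_tendsto_compose[OF isCont_Ln_one_minus_i lim] by simp
  show "AE x in \<alpha>. norm (Ln (1 - \<i> * of_real (f n x))) \<le> ln (1 + \<bar>h x\<bar>) + pi" for n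
  proof (rule AE_I2)
    fix x
    have "ln (1 + \<bar>f n x\<bar>) \<le> ln (1 + \<bar>h x\<bar>)" using bound[of n x] by simp
    then show "norm (Ln (1 - \<i> * of_real (f n x))) \<le> ln (1 + \<bar>h x\<bar>) + pi"
      using norm_Ln_one_minus_i_le[of "f n x"] by linarith
  qed
qed

lemma dirichlet_process_measurable:
  assumes "dirichlet_process \<alpha> M \<phi>" "\<omega> \<in> space M" "f \<in> borel_measurable borel"
  shows "f \<in> borel_measurable (\<phi> \<omega>)"
  by (subst measurable_cong_sets[OF dirichlet_process_space(2)[OF assms(1,2)] refl]) (rule assms(3))

text \<open>
  Increasing simple functions \<open>g n\<close> with limit \<open>f\<close> give
  \<open>E [cauchy_kernel a (t Y); Y < \<infinity>] = exp (- \<integral> Ln (1 - i t f) d\<alpha>)\<close> for the possibly infinite mean \<open>Y\<close>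
  of \<open>f\<close>; as \<open>t \<rightarrow> 0\<close> the left side tends to the probability that \<open>Y\<close> is finite and the right side
  to \<open>1\<close>.
\<close>

lemma dirichlet_process_AE_finite:
  fixes f :: "real \<Rightarrow> real"
  assumes D: "dirichlet_process \<alpha> M \<phi>" and \<alpha>: "finite_measure \<alpha>" "sets \<alpha> = sets borel" "measure \<alpha> UNIV = a" "a > 0"
    and f: "f \<in> borel_measurable borel" "\<And>x. f x \<ge> 0" and int: "integrable \<alpha> (\<lambda>x. ln (1 + \<bar>f x\<bar>))"
  shows "AE \<omega> in M. (\<integral>\<^sup>+x. ennreal (f x) \<partial>\<phi> \<omega>) < \<infinity>"
proof -
  interpret M: prob_space M using D by (simp add: dirichlet_process_def)
  have \<phi> [measurable]: "\<phi> \<in> M \<rightarrow>\<^sub>M subprob_algebra borel"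
    using D by (auto simp: dirichlet_process_def intro: measurable_prob_algebraD)
  note [measurable] = f(1)
  obtain s :: "nat \<Rightarrow> real \<Rightarrow> ennreal" where s: "\<And>i. simple_function borel (s i)" "incseq s" "\<And>i x. s i x < \<top>"
    "\<And>x. (SUP i. s i x) = ennreal (f x)"
    using borel_measurable_implies_simple_function_sequence'[of "\<lambda>x. ennreal (f x)" borel] by auto
  define g where "g n x = enn2real (s n x)" for n x
  have gs: "ennreal (g n x) = s n x" for n x using s(3)[of n x] by (simp add: g_def)
  have sl: "(\<lambda>n. s n x) \<longlonglongrightarrow> ennreal (f x)" for x
    using LIMSEQ_SUP[of "\<lambda>n. s n x"] s(2,4) by (auto simp: incseq_def le_fun_def)
  have s_le: "s n x \<le> ennreal (f x)" for n x
    unfolding s(4)[symmetric] by (rule SUP_upper) simp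
  have g_nonneg: "g n x \<ge> 0" for n x by (simp add: g_def)
  have g_le: "g n x \<le> f x" for n x
    using s_le[of n x] f(2)[of x] g_nonneg[of n x] unfolding gs[symmetric] by simp
  have g_lim: "(\<lambda>n. g n x) \<longlonglongrightarrow> f x" for x
    using sl[of x] f(2) g_nonneg unfolding gs[symmetric] by (simp add: tendsto_ennreal_iff)
  have s_meas [measurable]: "s n \<in> borel_measurable borel" for n
    by (rule borel_measurable_simple_function[OF s(1)])
  have g_meas [measurable]: "g n \<in> borel_measurable borel" for n
    unfolding g_def by measurable
  have g_fin: "finite (range (\<lambda>x. t * g n x))" for n t
  proof -
    have "finite (range (s n))" using simple_functionD(1)[OF s(1)[of n]] by simp
    then have "finite ((\<lambda>v. t * enn2real v) ` range (s n))" by simp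
    then show ?thesis by (simp add: image_image g_def)
  qed
  define Y where "Y \<omega> = (\<integral>\<^sup>+x. ennreal (f x) \<partial>\<phi> \<omega>)" for \<omega>
  define Z where "Z n \<omega> = (LINT x|\<phi> \<omega>. g n x)" for n \<omega>
  have Y_meas [measurable]: "Y \<in> borel_measurable M"
    unfolding Y_def by measurable
  have Z_meas [measurable]: "Z n \<in> borel_measurable M" for n
    unfolding Z_def by measurable
  \<comment> \<open>The value \<open>0\<close> is the limit of the kernel at infinity.\<close>
  define K where "K t \<omega> = (if Y \<omega> < \<infinity> then cauchy_kernel a (t * enn2real (Y \<omega>)) else 0)" for t \<omega>
  have K_meas [measurable]: "K t \<in> borel_measurable M" for t unfolding K_def by measurable
  have YZ: "(\<lambda>n. ennreal (Z n \<omega>)) \<longlonglongrightarrow> Y \<omega>" and Z_nonneg: "Z n \<omega> \<ge> 0" if \<omega>: "\<omega> \<in> space M" for \<omega> n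
  proof -
    interpret \<phi>: prob_space "\<phi> \<omega>" by (rule dirichlet_process_space[OF D \<omega>])
    show "Z n \<omega> \<ge> 0" unfolding Z_def by (intro integral_nonneg_AE) (simp add: g_nonneg)
    have "ennreal (Z n \<omega>) = (\<integral>\<^sup>+x. s n x \<partial>\<phi> \<omega>)" for n
    proof -
      obtain B where B: "norm (g n x) \<le> B" for x
        using finite_imp_bounded[OF g_fin[of 1 n]] by (auto simp: bounded_iff)
      have "integrable (\<phi> \<omega>) (g n)"
      proof (rule \<phi>.integrable_const_bound[of _ B])
        show "AE x in \<phi> \<omega>. norm (g n x) \<le> B" using B by simp
        show "g n \<in> borel_measurable (\<phi> \<omega>)"
          by (rule dirichlet_process_measurable[OF D \<omega> g_meas])
      qed
      then show ?thesis
        unfolding Z_def gs[symmetric] by (intro nn_integral_eq_integral[symmetric]) (auto simp: g_nonneg)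
    qed
    moreover have "(\<lambda>n. \<integral>\<^sup>+x. s n x \<partial>\<phi> \<omega>) \<longlonglongrightarrow> Y \<omega>"
      unfolding Y_def by (rule nn_integral_LIMSEQ[OF s(2)]) (use sl dirichlet_process_measurable[OF D \<omega> s_meas] in auto)
    ultimately show "(\<lambda>n. ennreal (Z n \<omega>)) \<longlonglongrightarrow> Y \<omega>" by simp
  qed
  have formula: "(LINT \<omega>|M. K t \<omega>) = exp (- (LINT x|\<alpha>. Ln (1 - \<i> * of_real (t * f x))))" if t: "0 < t" "t \<le> 1" for t
  proof (rule LIMSEQ_unique)
    have "(\<lambda>n. LINT \<omega>|M. cauchy_kernel a (t * Z n \<omega>)) \<longlonglongrightarrow> (LINT \<omega>|M. K t \<omega>)"
    proof (rule integral_dominated_convergence[where w = "\<lambda>_. 1"])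
      show "AE \<omega> in M. (\<lambda>n. cauchy_kernel a (t * Z n \<omega>)) \<longlonglongrightarrow> K t \<omega>"
      proof (rule AE_I2)
        fix \<omega> assume \<omega>: "\<omega> \<in> space M"
        show "(\<lambda>n. cauchy_kernel a (t * Z n \<omega>)) \<longlonglongrightarrow> K t \<omega>"
        proof (cases "Y \<omega> < \<infinity>")
          case True
          then have "Y \<omega> = ennreal (enn2real (Y \<omega>))" by simp
          with YZ[OF \<omega>] have "(\<lambda>n. ennreal (Z n \<omega>)) \<longlonglongrightarrow> ennreal (enn2real (Y \<omega>))" by simp
          then have "(\<lambda>n. Z n \<omega>) \<longlonglongrightarrow> enn2real (Y \<omega>)"
            using Z_nonneg[OF \<omega>] by (subst (asm) tendsto_ennreal_iff) auto
          then have "(\<lambda>n. t * Z n \<omega>) \<longlonglongrightarrow> t * enn2real (Y \<omega>)" by (intro tendsto_intros)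
          from isCont_tendsto_compose[OF isCont_cauchy_kernel this] True show ?thesis by (simp add: K_def)
        next
          case False
          then have "(\<lambda>n. ennreal (Z n \<omega>)) \<longlonglongrightarrow> \<infinity>" using YZ[OF \<omega>] by (simp add: less_top[symmetric])
          then have "filterlim (\<lambda>n. Z n \<omega>) at_top sequentially"
            by (simp add: ennreal_tendsto_top_eq_at_top)
          then have "filterlim (\<lambda>n. t * Z n \<omega>) at_top sequentially"
            using t by (intro filterlim_tendsto_pos_mult_at_top[OF tendsto_const]) auto
          from cauchy_kernel_at_top[OF \<alpha>(4) this] False show ?thesis by (simp add: K_def)
        qed
      qed
      show "AE \<omega> in M. norm (cauchy_kernel a (t * Z n \<omega>)) \<le> 1" for n
        by (simp add: norm_cauchy_kernel_le \<alpha>(4))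
    qed (auto simp: M.emeasure_space_1)
    then show "(\<lambda>n. LINT \<omega>|M. (1 - \<i> * of_real (LINT x|\<phi> \<omega>. t * g n x)) powr (- of_real a)) \<longlonglongrightarrow> (LINT \<omega>|M. K t \<omega>)"
      by (simp add: cauchy_kernel_def Z_def)
    have "(\<lambda>n. LINT x|\<alpha>. Ln (1 - \<i> * of_real (t * g n x))) \<longlonglongrightarrow> (LINT x|\<alpha>. Ln (1 - \<i> * of_real (t * f x)))"
    proof (rule tendsto_integral_Ln_one_minus_i[OF \<alpha>(1,2) int])
      show "(\<lambda>n. t * g n x) \<longlonglongrightarrow> t * f x" for x by (intro tendsto_intros g_lim)
      show "\<bar>t * g n x\<bar> \<le> \<bar>f x\<bar>" for n x
        using mult_mono[OF t(2) g_le[of n x]] g_nonneg[of n x] f(2)[of x] t(1) by (simp add: abs_mult)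
    qed auto
    then show "(\<lambda>n. LINT \<omega>|M. (1 - \<i> * of_real (LINT x|\<phi> \<omega>. t * g n x)) powr (- of_real a)) \<longlonglongrightarrow>
       exp (- (LINT x|\<alpha>. Ln (1 - \<i> * of_real (t * f x))))"
      by (subst dirichlet_process_simple[OF D \<alpha> _ g_fin]) (auto intro!: tendsto_intros)
  qed
  have inv0: "(\<lambda>n. inverse (real (Suc n))) \<longlonglongrightarrow> 0" by (rule LIMSEQ_inverse_real_of_nat)
  have l1: "(\<lambda>n. LINT \<omega>|M. K (inverse (real (Suc n))) \<omega>) \<longlonglongrightarrow> (LINT \<omega>|M. of_real (indicator {\<omega>\<in>space M. Y \<omega> < \<infinity>} \<omega>))"
  proof (rule integral_dominated_convergence[where w = "\<lambda>_. 1"])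
    show "AE \<omega> in M. (\<lambda>n. K (inverse (real (Suc n))) \<omega>) \<longlonglongrightarrow> complex_of_real (indicator {\<omega>\<in>space M. Y \<omega> < \<infinity>} \<omega>)"
    proof (rule AE_I2)
      fix \<omega> assume \<omega>: "\<omega> \<in> space M"
      have "(\<lambda>n. inverse (real (Suc n)) * enn2real (Y \<omega>)) \<longlonglongrightarrow> 0 * enn2real (Y \<omega>)"
        by (intro tendsto_intros inv0)
      from isCont_tendsto_compose[OF isCont_cauchy_kernel[where a = a] this] \<omega>
      show "(\<lambda>n. K (inverse (real (Suc n))) \<omega>) \<longlonglongrightarrow> complex_of_real (indicator {\<omega>\<in>space M. Y \<omega> < \<infinity>} \<omega>)"
        by (cases "Y \<omega> < \<infinity>") (simp_all add: K_def)
    qed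
    show "AE \<omega> in M. norm (K (inverse (real (Suc n))) \<omega>) \<le> 1" for n
      by (simp add: K_def norm_cauchy_kernel_le \<alpha>(4))
  qed (auto simp: M.emeasure_space_1)
  have l2: "(\<lambda>n. exp (- (LINT x|\<alpha>. Ln (1 - \<i> * of_real (inverse (real (Suc n)) * f x))))) \<longlonglongrightarrow> exp (- (LINT x|\<alpha>. Ln (1 - \<i> * of_real 0)))"
  proof (intro tendsto_exp tendsto_minus tendsto_integral_Ln_one_minus_i[OF \<alpha>(1,2) int])
    show "(\<lambda>n. inverse (real (Suc n)) * f x) \<longlonglongrightarrow> 0" for x
      using tendsto_mult_right[OF inv0, of "f x"] by simp
    have "inverse (real (Suc n)) \<le> 1" for n by (simp add: field_simps)
    then show "\<bar>inverse (real (Suc n)) * f x\<bar> \<le> \<bar>f x\<bar>" for n x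
      using f(2)[of x] by (simp add: abs_mult mult_left_le_one_le)
  qed auto
  have eq: "(LINT \<omega>|M. K (inverse (real (Suc n))) \<omega>) = exp (- (LINT x|\<alpha>. Ln (1 - \<i> * of_real (inverse (real (Suc n)) * f x))))" for n
    by (rule formula) (auto simp: field_simps)
  have "(LINT \<omega>|M. complex_of_real (indicator {\<omega>\<in>space M. Y \<omega> < \<infinity>} \<omega>)) = exp (- (LINT x|\<alpha>. Ln (1 - \<i> * of_real 0)))"
    by (rule LIMSEQ_unique[OF l1[unfolded eq] l2])
  then have "M.prob {\<omega>\<in>space M. Y \<omega> < \<infinity>} = 1"
    by (simp add: Int_absorb2)
  then show ?thesis
    by (subst (asm) M.prob_Collect_eq_1) (auto simp: Y_def[symmetric])
qed

lemma dirichlet_process_markov_krein: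
  fixes f :: "real \<Rightarrow> real"
  assumes D: "dirichlet_process \<alpha> M \<phi>" and \<alpha>: "finite_measure \<alpha>" "sets \<alpha> = sets borel" "measure \<alpha> UNIV = a" "a > 0"
    and f [measurable]: "f \<in> borel_measurable borel" and int: "integrable \<alpha> (\<lambda>x. ln (1 + \<bar>f x\<bar>))"
  shows "AE \<omega> in M. integrable (\<phi> \<omega>) f"
    and "(LINT \<omega>|M. cauchy_kernel a (LINT x|\<phi> \<omega>. f x)) = exp (- (LINT x|\<alpha>. Ln (1 - \<i> * of_real (f x))))"
proof -
  interpret M: prob_space M using D by (simp add: dirichlet_process_def)
  interpret \<alpha>: finite_measure \<alpha> by fact
  have \<phi> [measurable]: "\<phi> \<in> M \<rightarrow>\<^sub>M subprob_algebra borel"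
    using D by (auto simp: dirichlet_process_def intro: measurable_prob_algebraD)
  have fin: "AE \<omega> in M. (\<integral>\<^sup>+x. ennreal \<bar>f x\<bar> \<partial>\<phi> \<omega>) < \<infinity>"
    by (rule dirichlet_process_AE_finite[OF D \<alpha>]) (use int in auto)
  have int_iff: "integrable (\<phi> \<omega>) f" if "\<omega> \<in> space M" "(\<integral>\<^sup>+x. ennreal \<bar>f x\<bar> \<partial>\<phi> \<omega>) < \<infinity>" for \<omega>
    by (rule integrableI_bounded) (use that(2) dirichlet_process_measurable[OF D that(1) f] in simp_all)
  show AE_int: "AE \<omega> in M. integrable (\<phi> \<omega>) f"
    using fin AE_space by eventually_elim (rule int_iff)
  \<comment> \<open>Approximating simple functions dominated by \<open>2 |f|\<close>, hence the factor \<open>2\<close> in the logarithm.\<close>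
  obtain s where s: "\<And>i. simple_function borel (s i)" "\<And>x. (\<lambda>i. s i x) \<longlonglongrightarrow> f x" "\<And>i x. norm (s i x) \<le> 2 * norm (f x)"
    using borel_measurable_implies_sequence_metric[OF f, of 0] by auto
  have s_meas [measurable]: "s n \<in> borel_measurable borel" for n
    by (rule borel_measurable_simple_function[OF s(1)])
  have s_fin: "finite (range (s n))" for n using simple_functionD(1)[OF s(1)[of n]] by simp
  have int2: "integrable \<alpha> (\<lambda>x. ln (1 + \<bar>2 * f x\<bar>))"
  proof (rule Bochner_Integration.integrable_bound)
    show "integrable \<alpha> (\<lambda>x. ln 2 + ln (1 + \<bar>f x\<bar>))" using int by simp
    show "(\<lambda>x. ln (1 + \<bar>2 * f x\<bar>)) \<in> borel_measurable \<alpha>"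
      by (subst measurable_cong_sets[OF \<alpha>(2) refl]) measurable
    have "ln (1 + \<bar>2 * y\<bar>) \<le> ln 2 + ln (1 + \<bar>y\<bar>)" for y :: real
    proof -
      have "ln (1 + \<bar>2 * y\<bar>) \<le> ln (2 * (1 + \<bar>y\<bar>))" by (subst ln_le_cancel_iff) auto
      also have "\<dots> = ln 2 + ln (1 + \<bar>y\<bar>)" by (rule ln_mult_pos) auto
      finally show ?thesis .
    qed
    then show "AE x in \<alpha>. norm (ln (1 + \<bar>2 * f x\<bar>)) \<le> norm (ln 2 + ln (1 + \<bar>f x\<bar>))"
      by (intro AE_I2) simp
  qed
  show "(LINT \<omega>|M. cauchy_kernel a (LINT x|\<phi> \<omega>. f x)) = exp (- (LINT x|\<alpha>. Ln (1 - \<i> * of_real (f x))))"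
  proof (rule LIMSEQ_unique)
    show "(\<lambda>n. LINT \<omega>|M. cauchy_kernel a (LINT x|\<phi> \<omega>. s n x)) \<longlonglongrightarrow> (LINT \<omega>|M. cauchy_kernel a (LINT x|\<phi> \<omega>. f x))"
    proof (rule integral_dominated_convergence[where w = "\<lambda>_. 1"])
      show "AE \<omega> in M. (\<lambda>n. cauchy_kernel a (LINT x|\<phi> \<omega>. s n x)) \<longlonglongrightarrow> cauchy_kernel a (LINT x|\<phi> \<omega>. f x)"
        using AE_int AE_space
      proof eventually_elim
        case (elim \<omega>)
        have "(\<lambda>n. LINT x|\<phi> \<omega>. s n x) \<longlonglongrightarrow> (LINT x|\<phi> \<omega>. f x)"
          by (rule integral_dominated_convergence[where w = "\<lambda>x. 2 * norm (f x)"]) (use elim(1) s dirichlet_process_measurable[OF D elim(2) s_meas] in auto)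
        then show ?case by (rule isCont_tendsto_compose[OF isCont_cauchy_kernel])
      qed
      show "AE \<omega> in M. norm (cauchy_kernel a (LINT x|\<phi> \<omega>. s n x)) \<le> 1" for n
        by (simp add: norm_cauchy_kernel_le \<alpha>(4))
    qed auto
    have "(\<lambda>n. LINT x|\<alpha>. Ln (1 - \<i> * of_real (s n x))) \<longlonglongrightarrow> (LINT x|\<alpha>. Ln (1 - \<i> * of_real (f x)))"
      by (rule tendsto_integral_Ln_one_minus_i[OF \<alpha>(1,2) int2]) (use s in \<open>auto simp: abs_mult\<close>)
    then show "(\<lambda>n. LINT \<omega>|M. cauchy_kernel a (LINT x|\<phi> \<omega>. s n x)) \<longlonglongrightarrow> exp (- (LINT x|\<alpha>. Ln (1 - \<i> * of_real (f x))))"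
      unfolding cauchy_kernel_def dirichlet_process_simple[OF D \<alpha> s_meas s_fin] by (intro tendsto_intros)
  qed
qed

section \<open>The law of the mean and its Markov--Krein transform\<close>

lemma log_integrable_affine:
  fixes \<alpha> :: "real measure"
  assumes "finite_measure \<alpha>" "sets \<alpha> = sets borel" "integrable \<alpha> (\<lambda>x. ln (1 + \<bar>x\<bar>))"
  shows "integrable \<alpha> (\<lambda>x. ln (1 + \<bar>t * (x - c)\<bar>))"
proof (rule Bochner_Integration.integrable_bound)
  interpret finite_measure \<alpha> by fact
  show "integrable \<alpha> (\<lambda>x. (ln (1 + \<bar>t\<bar>) + ln (1 + \<bar>c\<bar>)) + ln (1 + \<bar>x\<bar>))"
    using assms(3) by simp
  show "(\<lambda>x. ln (1 + \<bar>t * (x - c)\<bar>)) \<in> borel_measurable \<alpha>"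
    by (subst measurable_cong_sets[OF assms(2) refl]) measurable
  have "ln (1 + \<bar>t * (x - c)\<bar>) \<le> (ln (1 + \<bar>t\<bar>) + ln (1 + \<bar>c\<bar>)) + ln (1 + \<bar>x\<bar>)" for x
  proof -
    have "\<bar>t * (x - c)\<bar> \<le> \<bar>t\<bar> * (\<bar>x\<bar> + \<bar>c\<bar>)"
      unfolding abs_mult by (intro mult_left_mono abs_triangle_ineq4) auto
    also have "1 + \<dots> \<le> (1 + \<bar>t\<bar>) * ((1 + \<bar>c\<bar>) * (1 + \<bar>x\<bar>))"
      by (simp add: algebra_simps)
    finally have "ln (1 + \<bar>t * (x - c)\<bar>) \<le> ln ((1 + \<bar>t\<bar>) * ((1 + \<bar>c\<bar>) * (1 + \<bar>x\<bar>)))"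
      by (subst ln_le_cancel_iff) (auto intro!: mult_pos_pos add_pos_nonneg)
    also have "\<dots> = ln (1 + \<bar>t\<bar>) + (ln (1 + \<bar>c\<bar>) + ln (1 + \<bar>x\<bar>))"
    proof -
      have p: "1 + \<bar>y\<bar> > 0" for y :: real by (simp add: add_pos_nonneg)
      show ?thesis using p[of t] p[of c] p[of x] by (simp only: ln_mult_pos mult_pos_pos)
    qed
    finally show ?thesis by simp
  qed
  then show "AE x in \<alpha>. norm (ln (1 + \<bar>t * (x - c)\<bar>)) \<le> norm ((ln (1 + \<bar>t\<bar>) + ln (1 + \<bar>c\<bar>)) + ln (1 + \<bar>x\<bar>))"
    by (intro AE_I2) simp
qed

text \<open>
  What the inversion needs to know about \<open>\<mu>\<close> and \<open>\<alpha>\<close>. The identity is kept in the form with real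
  parameters \<open>t\<close> and \<open>c\<close>, because its limit \<open>t \<rightarrow> \<infinity>\<close> excludes atoms directly, while the form on the
  upper half-plane is a consequence.
\<close>

locale markov_krein_pair = \<mu>: prob_space \<mu> + \<alpha>: finite_measure \<alpha>
  for \<mu> \<alpha> :: "real measure" +
  fixes a :: real
  assumes a_pos: "a > 0"
    and sets_mu: "sets \<mu> = sets borel" and sets_alpha: "sets \<alpha> = sets borel"
    and total_mass: "measure \<alpha> UNIV = a"
    and log_integrable: "integrable \<alpha> (\<lambda>x. ln (1 + \<bar>x\<bar>))"
    and identity: "\<And>t c. (LINT x|\<mu>. cauchy_kernel a (t * (x - c))) =
                   exp (- (LINT x|\<alpha>. Ln (1 - \<i> * of_real (t * (x - c)))))"
begin

lemma space_mu: "space \<mu> = UNIV" using sets_eq_imp_space_eq[OF sets_mu] by simp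
lemma space_alpha: "space \<alpha> = UNIV" using sets_eq_imp_space_eq[OF sets_alpha] by simp

lemma borel_measurable_mu: "f \<in> borel_measurable borel \<Longrightarrow> f \<in> borel_measurable \<mu>"
  by (subst measurable_cong_sets[OF sets_mu refl])

lemma borel_measurable_alpha: "f \<in> borel_measurable borel \<Longrightarrow> f \<in> borel_measurable \<alpha>"
  by (subst measurable_cong_sets[OF sets_alpha refl])

lemma Ln_integrable: "integrable \<alpha> (\<lambda>x. Ln (1 - \<i> * of_real (t * (x - c))))"
proof (rule Bochner_Integration.integrable_bound)
  show "integrable \<alpha> (\<lambda>x. ln (1 + \<bar>t * (x - c)\<bar>) + pi)"
    using log_integrable_affine[OF \<alpha>.finite_measure_axioms sets_alpha log_integrable] by simp
  show "(\<lambda>x. Ln (1 - \<i> * of_real (t * (x - c)))) \<in> borel_measurable \<alpha>"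
    by (rule borel_measurable_alpha) measurable
  show "AE x in \<alpha>. norm (Ln (1 - \<i> * of_real (t * (x - c)))) \<le> norm (ln (1 + \<bar>t * (x - c)\<bar>) + pi)"
    using norm_Ln_one_minus_i_le by (intro AE_I2) (smt (verit) real_norm_def)
qed

text \<open>
  As \<open>t \<rightarrow> \<infinity>\<close> the kernel \<open>cauchy_kernel a (t (x - c))\<close> tends to the indicator of \<open>c\<close>. The modulus of
  the other side of the identity is \<open>exp (- \<integral> ln |1 - i t (x - c)| d\<alpha>)\<close>, which vanishes in the limit
  because \<open>\<alpha>\<close> charges some set \<open>|x - c| \<ge> d > 0\<close>.
\<close>

lemma no_atom:
  assumes "measure \<alpha> {c} < a"
  shows "measure \<mu> {c} = 0"
proof -
  have lim1: "(\<lambda>n. LINT x|\<mu>. cauchy_kernel a (real n * (x - c))) \<longlonglongrightarrow> (LINT x|\<mu>. of_real (indicator {c} x))"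
  proof (rule integral_dominated_convergence[where w = "\<lambda>_. 1"])
    show "AE x in \<mu>. (\<lambda>n. cauchy_kernel a (real n * (x - c))) \<longlonglongrightarrow> complex_of_real (indicator {c} x)"
    proof (rule AE_I2)
      fix x
      consider "x = c" | "x > c" | "x < c" by linarith
      then show "(\<lambda>n. cauchy_kernel a (real n * (x - c))) \<longlonglongrightarrow> complex_of_real (indicator {c} x)"
      proof cases
        case 1
        then show ?thesis by simp
      next
        case 2
        then have "filterlim (\<lambda>n. real n * (x - c)) at_top sequentially"
          by (intro filterlim_at_top_mult_tendsto_pos[OF tendsto_const] filterlim_real_sequentially) auto
        from cauchy_kernel_at_top[OF a_pos this] 2 show ?thesis by simp
      next
        case 3
        have cnj: "norm (cauchy_kernel a y) = norm (cauchy_kernel a (- y))" for y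
          unfolding norm_cauchy_kernel norm_one_minus_i by simp
        have "filterlim (\<lambda>n. real n * (c - x)) at_top sequentially"
          using 3 by (intro filterlim_at_top_mult_tendsto_pos[OF tendsto_const] filterlim_real_sequentially) auto
        from tendsto_norm[OF cauchy_kernel_at_top[OF a_pos this]]
        have "(\<lambda>n. norm (cauchy_kernel a (real n * (x - c)))) \<longlonglongrightarrow> 0"
          by (subst cnj) (simp add: algebra_simps)
        then show ?thesis using 3 by (simp add: tendsto_norm_zero_iff)
      qed
    qed
    show "AE x in \<mu>. norm (cauchy_kernel a (real n * (x - c))) \<le> 1" for n
      by (simp add: norm_cauchy_kernel_le a_pos)
  qed (auto intro!: borel_measurable_mu)
  define B where "B k = {x. inverse (real (Suc k)) \<le> \<bar>x - c\<bar>}" for k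
  have B_sets [measurable]: "B k \<in> sets borel" for k unfolding B_def by measurable
  have "(\<lambda>k. measure \<alpha> (B k)) \<longlonglongrightarrow> measure \<alpha> (\<Union>k. B k)"
  proof (rule \<alpha>.finite_Lim_measure_incseq)
    show "incseq B" unfolding B_def incseq_Suc_iff
    proof (intro allI subsetI CollectI)
      fix n x assume "x \<in> {x. inverse (real (Suc n)) \<le> \<bar>x - c\<bar>}"
      then have "inverse (real (Suc n)) \<le> \<bar>x - c\<bar>" by (rule CollectD)
      moreover have "inverse (real (Suc (Suc n))) \<le> inverse (real (Suc n))" by (intro le_imp_inverse_le) auto
      ultimately show "inverse (real (Suc (Suc n))) \<le> \<bar>x - c\<bar>" by linarith
    qed
  qed (auto simp: sets_alpha)
  also have "(\<Union>k. B k) = UNIV - {c}"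
  proof (intro set_eqI iffI)
    fix x assume "x \<in> UNIV - {c}"
    then have "\<bar>x - c\<bar> > 0" by simp
    from reals_Archimedean[OF this] show "x \<in> (\<Union>k. B k)" by (auto simp: B_def intro: less_imp_le)
  qed (auto simp: B_def)
  also have "measure \<alpha> (UNIV - {c}) = a - measure \<alpha> {c}"
    using \<alpha>.finite_measure_compl[of "{c}"] by (simp add: space_alpha sets_alpha total_mass)
  finally have "(\<lambda>k. measure \<alpha> (B k)) \<longlonglongrightarrow> a - measure \<alpha> {c}" .
  from order_tendstoD(1)[OF this, of 0] assms
  obtain k where k: "measure \<alpha> (B k) > 0" by (auto dest: eventually_happens)
  define m where "m = measure \<alpha> (B k)"
  define d where "d = inverse (real (Suc k))"
  have d: "d > 0" by (simp add: d_def)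
  have lower: "m * ln (real n * d) \<le> Re (LINT x|\<alpha>. Ln (1 - \<i> * of_real (real n * (x - c))))" if n: "n > 0" for n
  proof -
    have "m * ln (real n * d) = (LINT x|\<alpha>. indicator (B k) x * ln (real n * d))"
      by (simp add: m_def space_alpha)
    also have "\<dots> \<le> (LINT x|\<alpha>. Re (Ln (1 - \<i> * of_real (real n * (x - c)))))"
    proof (rule integral_mono)
      show "integrable \<alpha> (\<lambda>x. indicator (B k) x * ln (real n * d))"
        by (intro integrable_mult_left integrable_real_indicator) (auto simp: sets_alpha less_top[symmetric])
      show "integrable \<alpha> (\<lambda>x. Re (Ln (1 - \<i> * of_real (real n * (x - c)))))"
        by (rule integrable_Re[OF Ln_integrable])
      fix x
      let ?z = "1 - \<i> * complex_of_real (real n * (x - c))"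
      have z: "Re (Ln ?z) = ln (norm ?z)" using one_minus_i_nonzero by (intro Re_Ln)
      show "indicator (B k) x * ln (real n * d) \<le> Re (Ln ?z)"
      proof (cases "x \<in> B k")
        case True
        then have "real n * d \<le> \<bar>real n * (x - c)\<bar>" by (simp add: B_def d_def abs_mult mult_left_mono)
        also have "\<dots> \<le> norm ?z" by (rule norm_one_minus_i_bounds(2))
        finally have "ln (real n * d) \<le> ln (norm ?z)" using n d by (intro ln_mono) auto
        then show ?thesis unfolding z using True by simp
      next
        case False
        then show ?thesis unfolding z using norm_one_minus_i_bounds(1)[of "real n * (x - c)"] by simp
      qed
    qed
    also have "\<dots> = Re (LINT x|\<alpha>. Ln (1 - \<i> * of_real (real n * (x - c))))"
      by (rule integral_Re[OF Ln_integrable])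
    finally show ?thesis .
  qed
  have lim2: "(\<lambda>n. exp (- (LINT x|\<alpha>. Ln (1 - \<i> * of_real (real n * (x - c)))))) \<longlonglongrightarrow> 0"
  proof (rule Lim_null_comparison)
    have "filterlim (\<lambda>n. m * ln (real n * d)) at_top sequentially"
      by (intro filterlim_tendsto_pos_mult_at_top[OF tendsto_const] filterlim_compose[OF ln_at_top]
            filterlim_at_top_mult_tendsto_pos[OF tendsto_const] filterlim_real_sequentially) (use d k m_def in auto)
    then show "(\<lambda>n. exp (- (m * ln (real n * d)))) \<longlonglongrightarrow> 0"
      by (intro filterlim_compose[OF exp_at_bot] filterlim_uminus_at_bot[THEN iffD1]) (simp add: filterlim_uminus_at_bot)
    show "\<forall>\<^sub>F n in sequentially. norm (exp (- (LINT x|\<alpha>. Ln (1 - \<i> * of_real (real n * (x - c)))))) \<le> exp (- (m * ln (real n * d)))"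
      using eventually_gt_at_top[of 0] by eventually_elim (use lower in \<open>simp add: norm_exp_eq_Re\<close>)
  qed
  have "(LINT x|\<mu>. complex_of_real (indicator {c} x)) = 0"
    by (rule LIMSEQ_unique[OF lim1[unfolded identity] lim2])
  then show ?thesis by (simp add: space_mu)
qed

text \<open>
  Up to a constant factor \<open>W\<close> in the right half-plane, \<open>1 + w x\<close> is \<open>1 - i t (x - c)\<close> with real \<open>t\<close>
  and \<open>c\<close>. Both factors lie in the right half-plane, so the principal logarithms add up.
\<close>

lemma half_plane_identity:
  assumes w: "Im w > 0"
  shows "(LINT x|\<mu>. exp (- of_real a * Ln (1 + w * of_real x))) = exp (- zeta_transform \<alpha> w)"
proof -
  have w0: "w \<noteq> 0" using w by auto
  define r where "r = Im w / (cmod w)\<^sup>2"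
  define s where "s = Re w / (cmod w)\<^sup>2"
  have r: "r > 0" using w w0 by (simp add: r_def)
  \<comment> \<open>With \<open>1 / w = s - i r\<close> one has \<open>1 + w x = w (x + s - i r) = (- i w r) (1 + i (x + s) / r)\<close>.\<close>
  define W where "W = - \<i> * w * of_real r"
  have ReW: "Re W > 0" using w r by (simp add: W_def)
  have inv: "complex_of_real s - \<i> * of_real r = 1 / w"
  proof -
    have "(Re w)\<^sup>2 + (Im w)\<^sup>2 \<noteq> 0" using w by (simp add: sum_power2_eq_zero_iff)
    then have "w * (complex_of_real s - \<i> * of_real r) = 1"
      by (simp add: complex_eq_iff r_def s_def cmod_power2 add_divide_distrib[symmetric] power2_eq_square[symmetric])
    then show ?thesis using w0 by (simp add: field_simps)
  qed
  have fac: "1 + w * of_real x = W * (1 - \<i> * of_real ((- 1 / r) * (x - (- s))))" for x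
  proof -
    have "W * (1 - \<i> * of_real ((- 1 / r) * (x - (- s)))) = w * (of_real s - \<i> * of_real r + of_real x)"
      using r by (simp add: W_def field_simps)
    also have "\<dots> = 1 + w * of_real x" unfolding inv using w0 by (simp add: field_simps)
    finally show ?thesis by simp
  qed
  have Ln_fac: "Ln (1 + w * of_real x) = Ln W + Ln (1 - \<i> * of_real ((- 1 / r) * (x - (- s))))" for x
  proof -
    let ?q = "1 - \<i> * complex_of_real ((- 1 / r) * (x - (- s)))"
    have "W \<noteq> 0" using ReW by auto
    moreover have "?q \<noteq> 0" by (rule one_minus_i_nonzero)
    moreover have "\<bar>Im (Ln W)\<bar> < pi / 2" using Re_Ln_pos_lt[OF \<open>W \<noteq> 0\<close>] ReW by simp
    moreover have "\<bar>Im (Ln ?q)\<bar> < pi / 2" using Re_Ln_pos_lt[OF \<open>?q \<noteq> 0\<close>] by simp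
    ultimately show ?thesis unfolding fac by (intro Ln_times_simple) linarith+
  qed
  have "(LINT x|\<mu>. exp (- of_real a * Ln (1 + w * of_real x))) =
        (LINT x|\<mu>. exp (- of_real a * Ln W) * cauchy_kernel a ((- 1 / r) * (x - (- s))))"
    unfolding Ln_fac cauchy_kernel_exp by (simp add: exp_add[symmetric] algebra_simps)
  also have "\<dots> = exp (- of_real a * Ln W) * exp (- (LINT x|\<alpha>. Ln (1 - \<i> * of_real ((- 1 / r) * (x - (- s))))))"
    by (subst integral_mult_right_zero, subst identity) simp
  also have "\<dots> = exp (- zeta_transform \<alpha> w)"
  proof -
    have "zeta_transform \<alpha> w = of_real a * Ln W + (LINT x|\<alpha>. Ln (1 - \<i> * of_real ((- 1 / r) * (x - (- s)))))"
      unfolding zeta_transform_def Ln_fac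
      by (subst Bochner_Integration.integral_add[OF _ Ln_integrable])
         (auto simp: space_alpha total_mass scaleR_conv_of_real)
    then show ?thesis by (simp add: exp_add[symmetric])
  qed
  finally show ?thesis .
qed

end

lemma mean_law_markov_krein_pair:
  assumes D: "dirichlet_process \<alpha> M \<phi>" and \<alpha>: "\<alpha> \<in> log_finite_measures a" and a: "a > 0"
  shows "markov_krein_pair (mean_law M \<phi>) \<alpha> a"
proof -
  have al: "finite_measure \<alpha>" "sets \<alpha> = sets borel" "measure \<alpha> UNIV = a"
    and int: "integrable \<alpha> (\<lambda>x. ln (1 + \<bar>x\<bar>))"
    using \<alpha> by (auto simp: log_finite_measures_def)
  interpret M: prob_space M using D by (simp add: dirichlet_process_def)
  have \<phi> [measurable]: "\<phi> \<in> M \<rightarrow>\<^sub>M subprob_algebra borel"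
    using D by (auto simp: dirichlet_process_def intro: measurable_prob_algebraD)
  define X where "X \<omega> = (LINT x|\<phi> \<omega>. x)" for \<omega>
  have X [measurable]: "X \<in> borel_measurable M" unfolding X_def by measurable
  have law: "mean_law M \<phi> = distr M borel X" by (simp add: mean_law_def X_def[abs_def])
  have AE_id: "AE \<omega> in M. integrable (\<phi> \<omega>) (\<lambda>x. x)"
    by (rule dirichlet_process_markov_krein(1)[OF D al a]) (use int in auto)
  have "(LINT x|mean_law M \<phi>. cauchy_kernel a (t * (x - c))) = exp (- (LINT x|\<alpha>. Ln (1 - \<i> * of_real (t * (x - c)))))" for t c
  proof -
    have "(LINT x|mean_law M \<phi>. cauchy_kernel a (t * (x - c))) = (LINT \<omega>|M. cauchy_kernel a (t * (X \<omega> - c)))"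
      unfolding law by (rule integral_distr) auto
    also have "\<dots> = (LINT \<omega>|M. cauchy_kernel a (LINT x|\<phi> \<omega>. t * (x - c)))"
    proof (rule integral_cong_AE)
      show "AE \<omega> in M. cauchy_kernel a (t * (X \<omega> - c)) = cauchy_kernel a (LINT x|\<phi> \<omega>. t * (x - c))"
        using AE_id AE_space
      proof eventually_elim
        case (elim \<omega>)
        interpret \<phi>: prob_space "\<phi> \<omega>" by (rule dirichlet_process_space[OF D elim(2)])
        have "(LINT x|\<phi> \<omega>. t * (x - c)) = t * (X \<omega> - c)"
          unfolding X_def integral_mult_right_zero
          by (subst Bochner_Integration.integral_diff) (use elim(1) \<phi>.prob_space in auto)
        then show ?case by (simp only:)
      qed
    qed auto
    also have "\<dots> = exp (- (LINT x|\<alpha>. Ln (1 - \<i> * of_real (t * (x - c)))))"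
      by (rule dirichlet_process_markov_krein(2)[OF D al a]) (use log_integrable_affine[OF al(1,2) int] in auto)
    finally show ?thesis .
  qed
  moreover have "prob_space (mean_law M \<phi>)" unfolding law by (rule M.prob_space_distr) measurable
  ultimately show ?thesis
    unfolding markov_krein_pair_def markov_krein_pair_axioms_def using a al int by (auto simp: law)
qed

section \<open>Lowering the exponent from \<open>a\<close> to \<open>1\<close>\<close>

lemma one_plus_upper_not_nonpos:
  assumes "Im u > 0"
  shows "1 + u * complex_of_real x \<notin> \<real>\<^sub>\<le>\<^sub>0"
  using assms by (cases "x = 0") (auto simp: complex_nonpos_Reals_iff)

lemma one_plus_upper_nonzero:
  assumes "Im u > 0"
  shows "1 + u * complex_of_real x \<noteq> 0"
  using one_plus_upper_not_nonpos[OF assms, of x] by auto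

text \<open>
  The ratio \<open>Im u / |u|\<close> is the sine of the angle between \<open>u\<close> and the real axis, that is the
  distance from \<open>- 1\<close> to the line through \<open>0\<close> and \<open>u\<close>.
\<close>

lemma norm_one_plus_upper_ge:
  assumes "Im u > 0"
  shows "norm (1 + u * complex_of_real x) \<ge> Im u / norm u"
proof -
  have u: "norm u > 0" using assms by auto
  have "Im u \<le> \<bar>Im (cnj u * (1 + u * complex_of_real x))\<bar>" by (simp add: algebra_simps)
  also have "\<dots> \<le> norm (cnj u * (1 + u * complex_of_real x))" by (rule abs_Im_le_cmod)
  also have "\<dots> = norm u * norm (1 + u * complex_of_real x)" by (simp add: norm_mult)
  finally show ?thesis using u by (simp add: field_simps)
qed

lemma aperture_pos: "Im u > 0 \<Longrightarrow> Im u / norm u > 0"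
  by (intro divide_pos_pos) auto

lemma aperture_le_1: "Im u / norm u \<le> 1"
  using abs_Im_le_cmod[of u] by (cases "u = 0") (auto simp: field_simps)

lemma norm_exp_Ln: "z \<noteq> 0 \<Longrightarrow> norm (exp (complex_of_real r * Ln z)) = norm z powr r"
  using norm_powr_of_real[of z r] by (simp add: powr_def)

lemma norm_exp_Ln_one_plus_le:
  assumes "Im u > 0"
  shows "norm (exp (complex_of_real r * Ln (1 + u * of_real x))) \<le> (Im u / norm u) powr r + (1 + norm u * \<bar>x\<bar>) powr r"
proof -
  let ?z = "1 + u * complex_of_real x"
  have z: "?z \<noteq> 0" by (rule one_plus_upper_nonzero[OF assms])
  have lo: "Im u / norm u \<le> norm ?z" by (rule norm_one_plus_upper_ge[OF assms])
  have hi: "norm ?z \<le> 1 + norm u * \<bar>x\<bar>"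
    using norm_triangle_ineq[of 1 "u * complex_of_real x"] by (simp add: norm_mult)
  have p: "0 \<le> (Im u / norm u) powr r" "0 \<le> (1 + norm u * \<bar>x\<bar>) powr r" by auto
  show ?thesis
  proof (cases "r \<ge> 0")
    case True
    then have "norm ?z powr r \<le> (1 + norm u * \<bar>x\<bar>) powr r" using hi by (intro powr_mono2) auto
    then show ?thesis unfolding norm_exp_Ln[OF z] using p by linarith
  next
    case False
    then have "norm ?z powr r \<le> (Im u / norm u) powr r" using lo aperture_pos[OF assms] by (intro powr_mono2') auto
    then show ?thesis unfolding norm_exp_Ln[OF z] using p by linarith
  qed
qed

lemma continuous_on_Ln_one_plus_upper:
  assumes "Im u > 0"
  shows "continuous_on UNIV (\<lambda>x. Ln (1 + u * complex_of_real x))"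
  by (intro continuous_intros) (use one_plus_upper_not_nonpos[OF assms] in auto)

context markov_krein_pair
begin

text \<open>
  The exponent \<open>1 - a\<close> makes the value at \<open>v = 0\<close> independent of \<open>a\<close> and produces the
  Markov--Krein exponent \<open>- a\<close> in the derivative.
\<close>

definition resolvent_power :: "complex \<Rightarrow> complex \<Rightarrow> complex" where
  "resolvent_power w v = (LINT x|\<mu>. exp (of_real (1 - a) * Ln (1 + v * w * of_real x)) / (1 + w * of_real x))"

lemma linear_fraction_bound:
  assumes "Im w > 0"
  shows "norm (1 / (1 + w * complex_of_real x)) \<le> norm w / Im w"
    and "norm (w * complex_of_real x / (1 + w * complex_of_real x)) \<le> 1 + norm w / Im w"
proof -
  let ?z = "1 + w * complex_of_real x"
  have z: "?z \<noteq> 0" by (rule one_plus_upper_nonzero[OF assms])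
  have w: "norm w > 0" using assms by auto
  have "norm w * norm ?z \<ge> Im w"
    using norm_one_plus_upper_ge[OF assms, of x] w by (simp add: field_simps)
  then show 1: "norm (1 / ?z) \<le> norm w / Im w"
    using assms z by (simp add: norm_divide field_simps)
  have "w * complex_of_real x / ?z = 1 - 1 / ?z" using z by (simp add: field_simps)
  then have "norm (w * complex_of_real x / ?z) \<le> norm (1::complex) + norm (1 / ?z)"
    by (simp only: norm_triangle_ineq4)
  with 1 show "norm (w * complex_of_real x / ?z) \<le> 1 + norm w / Im w" by simp
qed

text \<open>
  Since \<open>1 - a < 1\<close>, the numerator grows at most linearly in \<open>x\<close> (it stays bounded when \<open>a \<ge> 1\<close>,
  at a cost that depends on the angle of \<open>v w\<close>), and the denominator compensates for linear
  growth.
\<close>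

lemma resolvent_integrand_bound:
  assumes w: "Im w > 0" and vw: "Im (v * w) > 0"
  shows "norm (exp (of_real (1 - a) * Ln (1 + v * w * of_real x)) / (1 + w * of_real x))
     \<le> ((Im (v * w) / norm (v * w)) powr (1 - a) + 1) * (norm w / Im w) + norm v * (1 + norm w / Im w)"
proof -
  let ?K = "(Im (v * w) / norm (v * w)) powr (1 - a)"
  let ?d = "norm (1 + w * complex_of_real x)"
  have d: "?d > 0" using one_plus_upper_nonzero[OF w] by simp
  have "(1 + norm (v * w) * \<bar>x\<bar>) powr (1 - a) \<le> (1 + norm (v * w) * \<bar>x\<bar>) powr 1"
    using a_pos by (intro powr_mono) auto
  then have "(1 + norm (v * w) * \<bar>x\<bar>) powr (1 - a) \<le> 1 + norm v * norm (w * complex_of_real x)"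
    by (simp add: norm_mult mult_ac add_nonneg_nonneg)
  then have "norm (exp (of_real (1 - a) * Ln (1 + v * w * of_real x))) \<le> ?K + (1 + norm v * norm (w * complex_of_real x))"
    using norm_exp_Ln_one_plus_le[OF vw, of "1 - a" x] by linarith
  then have "norm (exp (of_real (1 - a) * Ln (1 + v * w * of_real x)) / (1 + w * of_real x)) \<le>
     (?K + (1 + norm v * norm (w * complex_of_real x))) / ?d"
    unfolding norm_divide using d by (intro divide_right_mono) auto
  also have "\<dots> = (?K + 1) * norm (1 / (1 + w * complex_of_real x)) + norm v * norm (w * complex_of_real x / (1 + w * complex_of_real x))"
    by (simp add: norm_divide norm_mult add_divide_distrib distrib_right)
  also have "\<dots> \<le> (?K + 1) * (norm w / Im w) + norm v * (1 + norm w / Im w)"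
    by (intro add_mono mult_left_mono linear_fraction_bound[OF w]) auto
  finally show ?thesis .
qed

lemma borel_measurable_resolvent_integrand:
  assumes "Im w > 0" "Im (v * w) > 0"
  shows "(\<lambda>x. exp (of_real r * Ln (1 + v * w * of_real x)) / (1 + w * of_real x)) \<in> borel_measurable \<mu>"
    and "(\<lambda>x. exp (of_real r * Ln (1 + v * w * of_real x))) \<in> borel_measurable \<mu>"
    by (auto intro!: borel_measurable_mu borel_measurable_continuous_onI continuous_intros
         continuous_on_Ln_one_plus_upper[OF assms(2)] one_plus_upper_nonzero[OF assms(1)])

lemma resolvent_integrand_integrable:
  assumes "Im w > 0" "Im (v * w) > 0"
  shows "integrable \<mu> (\<lambda>x. exp (of_real (1 - a) * Ln (1 + v * w * of_real x)) / (1 + w * of_real x))"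
  by (rule \<mu>.integrable_const_bound[OF _ borel_measurable_resolvent_integrand(1)[OF assms]])
     (use resolvent_integrand_bound[OF assms] in auto)

lemma norm_exp_neg_a_le:
  assumes "Im u > 0"
  shows "norm (exp (- of_real a * Ln (1 + u * of_real x))) \<le> (Im u / norm u) powr (- a)"
proof -
  have "norm (exp (complex_of_real (- a) * Ln (1 + u * of_real x))) = norm (1 + u * complex_of_real x) powr (- a)"
    by (rule norm_exp_Ln[OF one_plus_upper_nonzero[OF assms]])
  also have "\<dots> \<le> (Im u / norm u) powr (- a)"
    using a_pos norm_one_plus_upper_ge[OF assms] aperture_pos[OF assms] by (intro powr_mono2') auto
  finally show ?thesis by simp
qed

lemma norm_exp_zeta_le:
  assumes "Im u > 0"
  shows "norm (exp (- zeta_transform \<alpha> u)) \<le> (Im u / norm u) powr (- a)"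
proof -
  have "integrable \<mu> (\<lambda>x. exp (- of_real a * Ln (1 + u * of_real x)))"
    by (rule \<mu>.integrable_const_bound[of _ "(Im u / norm u) powr (- a)"])
       (use norm_exp_neg_a_le[OF assms] borel_measurable_resolvent_integrand(2)[of u 1 "- a"] assms in auto)
  have "norm (LINT x|\<mu>. exp (- of_real a * Ln (1 + u * of_real x))) \<le> (LINT x|\<mu>. (Im u / norm u) powr (- a))"
    by (intro Bochner_Integration.integral_norm_bound_integral norm_exp_neg_a_le[OF assms]) (fact, auto)
  then show ?thesis unfolding half_plane_identity[OF assms] by (simp add: \<mu>.prob_space)
qed

text \<open>
  Differentiation under the integral sign. Near \<open>v0\<close> the number \<open>v w\<close> stays away from the real
  axis, so the difference quotients are bounded uniformly in \<open>x\<close> and dominated convergence applies.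
\<close>

lemma resolvent_power_deriv:
  assumes w: "Im w > 0" and v0: "Im (v0 * w) > 0"
  shows "(resolvent_power w has_field_derivative
          of_real (1 - a) * (LINT x|\<mu>. w * of_real x * exp (- of_real a * Ln (1 + v0 * w * of_real x)) / (1 + w * of_real x))) (at v0)"
proof -
  define h where "h v x = exp (of_real (1 - a) * Ln (1 + v * w * of_real x)) / (1 + w * of_real x)" for v and x :: real
  define h' where "h' v x = of_real (1 - a) * (w * of_real x * exp (- of_real a * Ln (1 + v * w * of_real x)) / (1 + w * of_real x))" for v and x :: real
  \<comment> \<open>On the ball \<open>U\<close> the imaginary part of \<open>v w\<close> is at least half its value at \<open>v0\<close>.\<close>
  define \<eta> where "\<eta> = Im (v0 * w) / 2"
  have \<eta>: "\<eta> > 0" using v0 by (simp add: \<eta>_def)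
  have nw: "norm w > 0" using w by auto
  define U where "U = ball v0 (\<eta> / norm w)"
  have U: "v0 \<in> U" "open U" "convex U" using \<eta> nw by (auto simp: U_def)
  define R where "R = norm (v0 * w) + \<eta>"
  have R: "R > 0" using \<eta> by (simp add: R_def add_nonneg_pos)
  have U_bounds: "\<eta> \<le> Im (v * w)" "norm (v * w) \<le> R" if "v \<in> U" for v
  proof -
    have "norm (v - v0) * norm w \<le> \<eta>"
      using that nw by (simp add: U_def dist_norm norm_minus_commute[of v v0] field_simps)
    then have "norm ((v - v0) * w) \<le> \<eta>" by (simp only: norm_mult)
    then have 1: "norm (v * w - v0 * w) \<le> \<eta>" by (simp add: algebra_simps)
    then have "\<bar>Im (v * w - v0 * w)\<bar> \<le> \<eta>" using abs_Im_le_cmod order_trans by blast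
    moreover have "Im (v * w - v0 * w) = Im (v * w) - Im (v0 * w)" by (rule minus_complex.sel(2))
    moreover have "Im (v0 * w) = 2 * \<eta>" by (simp add: \<eta>_def)
    ultimately show "\<eta> \<le> Im (v * w)" by linarith
    show "norm (v * w) \<le> R"
      using norm_triangle_ineq2[of "v * w" "v0 * w"] 1 unfolding R_def by linarith
  qed
  have U_pos: "Im (v * w) > 0" if "v \<in> U" for v using U_bounds(1)[OF that] \<eta> by linarith
  have deriv: "((\<lambda>v. h v x) has_field_derivative h' v x) (at v within U)" if v: "v \<in> U" for v x
  proof -
    let ?z = "1 + v * w * complex_of_real x"
    have z: "?z \<notin> \<real>\<^sub>\<le>\<^sub>0" "?z \<noteq> 0"
      using one_plus_upper_not_nonpos[OF U_pos[OF v]] one_plus_upper_nonzero[OF U_pos[OF v]] by auto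
    have "exp (of_real (1 - a) * Ln ?z) / ?z = exp (of_real (1 - a) * Ln ?z) * exp (- Ln ?z)"
      using z by (simp add: exp_minus divide_inverse)
    also have "\<dots> = exp (- of_real a * Ln ?z)" by (simp add: exp_add[symmetric] algebra_simps)
    finally have e: "exp (of_real (1 - a) * Ln ?z) / ?z = exp (- of_real a * Ln ?z)" .
    have L: "((\<lambda>v. Ln (1 + v * w * of_real x)) has_field_derivative w * of_real x / ?z) (at v within U)"
      using z by (auto intro!: derivative_eq_intros simp: divide_inverse mult_ac)
    have "((\<lambda>v. h v x) has_field_derivative
        exp (of_real (1 - a) * Ln ?z) * (of_real (1 - a) * (w * of_real x / ?z)) / (1 + w * of_real x)) (at v within U)"
      unfolding h_def by (rule DERIV_cdivide[OF DERIV_chain'[OF DERIV_cmult[OF L] DERIV_exp]])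
    also have "exp (of_real (1 - a) * Ln ?z) * (of_real (1 - a) * (w * of_real x / ?z)) / (1 + w * of_real x) =
       of_real (1 - a) * (w * of_real x * (exp (of_real (1 - a) * Ln ?z) / ?z) / (1 + w * of_real x))"
      by (simp add: mult_ac)
    also have "\<dots> = h' v x" unfolding e h'_def ..
    finally show ?thesis .
  qed
  define B where "B = \<bar>1 - a\<bar> * ((\<eta> / R) powr (- a) * (1 + norm w / Im w))"
  have h'_bound: "norm (h' v x) \<le> B" if v: "v \<in> U" for v x
  proof -
    have "norm (exp (- of_real a * Ln (1 + v * w * of_real x))) \<le> (Im (v * w) / norm (v * w)) powr (- a)"
      by (rule norm_exp_neg_a_le[OF U_pos[OF v]])
    also have "\<dots> \<le> (\<eta> / R) powr (- a)"
      using U_bounds[OF v] \<eta> R a_pos U_pos[OF v] by (intro powr_mono2' frac_le divide_pos_pos) auto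
    finally have "norm (exp (- of_real a * Ln (1 + v * w * of_real x)) * (w * of_real x / (1 + w * of_real x))) \<le>
        (\<eta> / R) powr (- a) * (1 + norm w / Im w)"
      unfolding norm_mult by (intro mult_mono linear_fraction_bound(2)[OF w, unfolded norm_mult norm_divide] linear_fraction_bound(2)[OF w]) auto
    then have "\<bar>1 - a\<bar> * norm (exp (- of_real a * Ln (1 + v * w * of_real x)) * (w * of_real x / (1 + w * of_real x))) \<le> B"
      unfolding B_def by (rule mult_left_mono) simp
    moreover have "h' v x = of_real (1 - a) * (exp (- of_real a * Ln (1 + v * w * of_real x)) * (w * of_real x / (1 + w * of_real x)))"
      unfolding h'_def by simp
    then have "norm (h' v x) = \<bar>1 - a\<bar> * norm (exp (- of_real a * Ln (1 + v * w * of_real x)) * (w * of_real x / (1 + w * of_real x)))"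
      by (simp only: norm_mult norm_of_real)
    ultimately show ?thesis by simp
  qed
  have int: "integrable \<mu> (h v)" if "v \<in> U" for v
    unfolding h_def by (rule resolvent_integrand_integrable[OF w U_pos[OF that]])
  have h_meas: "h v \<in> borel_measurable \<mu>" if "v \<in> U" for v
    using int[OF that] by (rule borel_measurable_integrable)
  have h'_meas: "h' v0 \<in> borel_measurable \<mu>"
  proof -
    have "(\<lambda>x. of_real (1 - a) * (w * complex_of_real x)) \<in> borel_measurable \<mu>"
      by (rule borel_measurable_mu) measurable
    from borel_measurable_times[OF this borel_measurable_resolvent_integrand(1)[OF w v0, of "- a"]]
    show ?thesis unfolding h'_def[abs_def] by (simp add: mult.assoc)
  qed
  have "((\<lambda>v. LINT x|\<mu>. h v x) has_field_derivative (LINT x|\<mu>. h' v0 x)) (at v0 within U)"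
    unfolding has_field_derivative_iff tendsto_at_iff_sequentially
  proof (intro allI impI)
    fix X assume X: "\<forall>i. X i \<in> U - {v0}" and X0: "X \<longlonglongrightarrow> v0"
    have "(\<lambda>n. LINT x|\<mu>. (h (X n) x - h v0 x) / (X n - v0)) \<longlonglongrightarrow> (LINT x|\<mu>. h' v0 x)"
    proof (rule integral_dominated_convergence[where w = "\<lambda>_. B"])
      show "(\<lambda>x. (h (X n) x - h v0 x) / (X n - v0)) \<in> borel_measurable \<mu>" for n
        using X U(1) h_meas by (intro borel_measurable_divide borel_measurable_diff borel_measurable_const) auto
      show "AE x in \<mu>. (\<lambda>n. (h (X n) x - h v0 x) / (X n - v0)) \<longlonglongrightarrow> h' v0 x"
        using deriv[OF U(1)] X X0 unfolding has_field_derivative_iff tendsto_at_iff_sequentially comp_def by blast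
      show "AE x in \<mu>. norm ((h (X n) x - h v0 x) / (X n - v0)) \<le> B" for n
      proof (rule AE_I2)
        fix x
        have "norm (h (X n) x - h v0 x) \<le> B * norm (X n - v0)"
          by (rule field_differentiable_bound[OF U(3), of "\<lambda>v. h v x" "\<lambda>v. h' v x"])
             (use deriv h'_bound X U(1) in auto)
        moreover have "norm (X n - v0) > 0" using X by auto
        ultimately show "norm ((h (X n) x - h v0 x) / (X n - v0)) \<le> B"
          by (simp add: norm_divide field_simps)
      qed
    qed (use h'_meas in auto)
    moreover have "(LINT x|\<mu>. (h (X n) x - h v0 x) / (X n - v0)) = ((LINT x|\<mu>. h (X n) x) - (LINT x|\<mu>. h v0 x)) / (X n - v0)" for n
      using X U(1) int by (simp add: Bochner_Integration.integral_diff)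
    ultimately show "((\<lambda>y. ((LINT x|\<mu>. h y x) - (LINT x|\<mu>. h v0 x)) / (y - v0)) \<circ> X) \<longlonglongrightarrow> (LINT x|\<mu>. h' v0 x)"
      by (simp only: comp_def)
  qed
  then have "((\<lambda>v. LINT x|\<mu>. h v x) has_field_derivative (LINT x|\<mu>. h' v0 x)) (at v0)"
    unfolding at_within_open[OF U(1,2)] .
  moreover have "resolvent_power w = (\<lambda>v. LINT x|\<mu>. h v x)" by (simp add: fun_eq_iff resolvent_power_def h_def)
  moreover have "(LINT x|\<mu>. h' v0 x) = of_real (1 - a) * (LINT x|\<mu>. w * of_real x * exp (- of_real a * Ln (1 + v0 * w * of_real x)) / (1 + w * of_real x))"
    unfolding h'_def by (rule integral_mult_right_zero)
  ultimately show ?thesis by simp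
qed

lemma resolvent_power_0: "resolvent_power w 0 = (LINT x|\<mu>. 1 / (1 + w * of_real x))"
  by (simp add: resolvent_power_def)

text \<open>
  The identity \<open>(1 + v w x) + (1 - v) w x = 1 + w x\<close> cancels the denominator and leaves the
  Markov--Krein integrand. The equation says that \<open>- (1 - v) powr (a - 1)\<close> times this function
  has derivative \<open>(a - 1) (1 - v) powr (a - 2) exp (- \<zeta>(v w))\<close>.
\<close>

lemma resolvent_power_ode:
  assumes w: "Im w > 0" and v: "Im (v * w) > 0" "v \<noteq> 1"
  shows "(resolvent_power w has_field_derivative
          of_real (a - 1) / (1 - v) * (resolvent_power w v - exp (- zeta_transform \<alpha> (v * w)))) (at v)"
proof -
  let ?E = "\<lambda>x. exp (- of_real a * Ln (1 + v * w * complex_of_real x))"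
  let ?D = "\<lambda>x. w * complex_of_real x * ?E x / (1 + w * of_real x)"
  have int_E: "integrable \<mu> ?E"
    by (rule \<mu>.integrable_const_bound[of _ "(Im (v * w) / norm (v * w)) powr (- a)"])
       (use norm_exp_neg_a_le[OF v(1)] borel_measurable_resolvent_integrand(2)[OF w v(1), of "- a"] in auto)
  have split: "?E x = exp (of_real (1 - a) * Ln (1 + v * w * of_real x)) / (1 + w * of_real x) + (1 - v) * ?D x" for x
  proof -
    let ?z = "1 + v * w * complex_of_real x" and ?d = "1 + w * complex_of_real x"
    have nz: "?z \<noteq> 0" "?d \<noteq> 0" using one_plus_upper_nonzero[OF w] one_plus_upper_nonzero[OF v(1)] by auto
    have "exp (of_real (1 - a) * Ln ?z) = ?E x * exp (Ln ?z)"
      by (simp add: exp_add[symmetric] algebra_simps)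
    also have "exp (Ln ?z) = ?z" using nz by simp
    finally have e: "exp (of_real (1 - a) * Ln ?z) = ?E x * ?z" .
    have "?E x * ?d = ?E x * ?z + (1 - v) * (w * of_real x * ?E x)"
      by (simp add: algebra_simps)
    then have "?E x = (?E x * ?z + (1 - v) * (w * of_real x * ?E x)) / ?d"
      using nz(2) by (metis nonzero_mult_div_cancel_right)
    then show ?thesis unfolding e by (simp only: add_divide_distrib times_divide_eq_right)
  qed
  have div: "y = z / (1 - v)" if "(1 - v) * y = z" for y z
    using that v(2) by auto
  have "(LINT x|\<mu>. (1 - v) * ?D x) = (LINT x|\<mu>. ?E x - exp (of_real (1 - a) * Ln (1 + v * w * of_real x)) / (1 + w * of_real x))"
    by (rule Bochner_Integration.integral_cong[OF refl], unfold eq_diff_eq, subst add.commute, rule split[symmetric])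
  also have "\<dots> = exp (- zeta_transform \<alpha> (v * w)) - resolvent_power w v"
    unfolding resolvent_power_def half_plane_identity[OF v(1), symmetric]
    by (rule Bochner_Integration.integral_diff[OF int_E resolvent_integrand_integrable[OF w v(1)]])
  finally have "(1 - v) * (LINT x|\<mu>. ?D x) = exp (- zeta_transform \<alpha> (v * w)) - resolvent_power w v"
    by (simp only: integral_mult_right_zero)
  then have D: "(LINT x|\<mu>. ?D x) = (exp (- zeta_transform \<alpha> (v * w)) - resolvent_power w v) / (1 - v)"
    by (rule div)
  have "of_real (1 - a) * (LINT x|\<mu>. ?D x) = of_real (a - 1) / (1 - v) * (resolvent_power w v - exp (- zeta_transform \<alpha> (v * w)))"
    unfolding D by (simp add: divide_inverse algebra_simps)
  with resolvent_power_deriv[OF w v(1)] show ?thesis by (simp only:)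
qed

text \<open>
  The point \<open>0\<close> lies on the boundary of the half-plane, so continuity there is obtained along paths on
  which the angle factor stays bounded: any path if \<open>a < 1\<close>, and the real segment in general.
\<close>

lemma resolvent_power_tendsto_0:
  fixes g :: "real \<Rightarrow> complex"
  assumes w: "Im w > 0" and g: "(g \<longlongrightarrow> 0) (at t0 within T)"
    and up: "\<And>t. t \<in> T - {t0} \<Longrightarrow> Im (g t * w) > 0"
    and bd: "\<And>t. t \<in> T - {t0} \<Longrightarrow> (Im (g t * w) / norm (g t * w)) powr (1 - a) \<le> C"
  shows "((\<lambda>t. resolvent_power w (g t)) \<longlongrightarrow> resolvent_power w 0) (at t0 within T)"
  unfolding tendsto_at_iff_sequentially
proof (intro allI impI)
  fix X assume X: "\<forall>i. X i \<in> T - {t0}" "X \<longlonglongrightarrow> t0"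
  have gX: "(\<lambda>n. g (X n)) \<longlonglongrightarrow> 0"
    using g X unfolding tendsto_at_iff_sequentially comp_def by blast
  have upX: "Im (g (X n) * w) > 0" for n using up X(1) by blast
  obtain B where B: "\<And>n. norm (g (X n)) \<le> B"
    using convergent_imp_Bseq[of "\<lambda>n. g (X n)"] gX by (auto simp: convergent_def Bseq_def)
  have q: "norm w / Im w \<ge> 0" using w by simp
  have "(\<lambda>n. resolvent_power w (g (X n))) \<longlonglongrightarrow> resolvent_power w 0"
    unfolding resolvent_power_def
  proof (rule integral_dominated_convergence[where w = "\<lambda>_. (C + 1) * (norm w / Im w) + B * (1 + norm w / Im w)"])
    show "(\<lambda>x. exp (of_real (1 - a) * Ln (1 + g (X n) * w * of_real x)) / (1 + w * of_real x)) \<in> borel_measurable \<mu>" for n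
      by (rule borel_measurable_resolvent_integrand(1)[OF w upX])
    show "(\<lambda>x. exp (of_real (1 - a) * Ln (1 + 0 * w * of_real x)) / (1 + w * of_real x)) \<in> borel_measurable \<mu>"
      by (auto intro!: borel_measurable_mu borel_measurable_continuous_onI continuous_intros one_plus_upper_nonzero[OF w])
    show "AE x in \<mu>. (\<lambda>n. exp (of_real (1 - a) * Ln (1 + g (X n) * w * of_real x)) / (1 + w * of_real x)) \<longlonglongrightarrow>
       exp (of_real (1 - a) * Ln (1 + 0 * w * of_real x)) / (1 + w * of_real x)"
      by (intro AE_I2 tendsto_intros gX one_plus_upper_nonzero[OF w]) auto
    show "AE x in \<mu>. norm (exp (of_real (1 - a) * Ln (1 + g (X n) * w * of_real x)) / (1 + w * of_real x)) \<le>
       (C + 1) * (norm w / Im w) + B * (1 + norm w / Im w)" for n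
    proof (rule AE_I2)
      fix x
      have "(Im (g (X n) * w) / norm (g (X n) * w)) powr (1 - a) \<le> C" using bd X(1) by blast
      then have "((Im (g (X n) * w) / norm (g (X n) * w)) powr (1 - a) + 1) * (norm w / Im w) + norm (g (X n)) * (1 + norm w / Im w)
         \<le> (C + 1) * (norm w / Im w) + B * (1 + norm w / Im w)"
        using q B[of n] by (intro add_mono mult_right_mono) auto
      with resolvent_integrand_bound[OF w upX[of n], of x]
      show "norm (exp (of_real (1 - a) * Ln (1 + g (X n) * w * of_real x)) / (1 + w * of_real x)) \<le>
       (C + 1) * (norm w / Im w) + B * (1 + norm w / Im w)" by linarith
    qed
  qed simp
  then show "((\<lambda>t. resolvent_power w (g t)) \<circ> X) \<longlonglongrightarrow> resolvent_power w 0" by (simp add: comp_def)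
qed

text \<open>
  The primitive \<open>F\<close> of the integrand is continuous off the cut \<open>(-\<infinity>, 1]\<close> wherever
  \<open>Im (v w) > 0\<close>. At the start of the loop the branch of \<open>(1 - v) powr (a - 1)\<close> equals \<open>1\<close> and at its end \<open>exp (2 \<pi> i (a - 1))\<close>, so the
  integral is the jump of \<open>F\<close> between the two sides of \<open>0\<close>.
\<close>

lemma loop_integral:
  assumes w: "Im w > 0" and a1: "a < 1" and \<gamma>: "loop_contour \<gamma>"
    and up: "\<And>t. t \<in> {0<..<1} \<Longrightarrow> Im (\<gamma> t * w) > 0"
  shows "contour_integral \<gamma> (\<lambda>v. exp (- zeta_transform \<alpha> (v * w)) * beta_kernel a v) =
         (1 - exp (2 * of_real pi * \<i> * of_real (a - 1))) * (LINT x|\<mu>. 1 / (1 + w * of_real x))"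
proof -
  define E where "E = exp (2 * of_real pi * \<i> * complex_of_real (a - 1))"
  define P where "P v = exp (of_real (a - 1) * (Ln (v - 1) + \<i> * of_real pi))" for v
  define F where "F v = - (P v * resolvent_power w v)" for v
  define H where "H t = (if t = 0 then - resolvent_power w 0 else if t = 1 then - (E * resolvent_power w 0) else F (\<gamma> t))" for t :: real
  have vp: "valid_path \<gamma>" and \<gamma>0: "\<gamma> 0 = 0" and \<gamma>1: "\<gamma> 1 = 0"
    and \<gamma>_in: "\<And>t. t \<in> {0<..<1} \<Longrightarrow> 0 < Re (\<gamma> t) \<and> \<gamma> t \<notin> complex_of_real ` {0<..1}"
    and start: "\<forall>\<^sub>F t in at_right 0. Im (\<gamma> t) < 0" and fin: "\<forall>\<^sub>F t in at_left 1. 0 < Im (\<gamma> t)"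
    using \<gamma> by (auto simp: loop_contour_def pathstart_def pathfinish_def)
  have cont\<gamma>: "continuous_on {0..1} \<gamma>"
    using valid_path_imp_path[OF vp] by (simp add: path_def)
  obtain S where S: "finite S" "\<gamma> C1_differentiable_on {0..1} - S"
    using vp by (auto simp: valid_path_def piecewise_C1_differentiable_on_def)
  have slit: "\<gamma> t - 1 \<notin> \<real>\<^sub>\<le>\<^sub>0" if t: "t \<in> {0<..<1}" for t
  proof
    assume "\<gamma> t - 1 \<in> \<real>\<^sub>\<le>\<^sub>0"
    then have "Re (\<gamma> t) \<le> 1" "Im (\<gamma> t) = 0" by (auto simp: complex_nonpos_Reals_iff)
    then have "\<gamma> t = of_real (Re (\<gamma> t))" "Re (\<gamma> t) \<in> {0<..1}" using \<gamma>_in[OF t] by (auto simp: complex_eq_iff)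
    then show False using \<gamma>_in[OF t] by blast
  qed
  have ne1: "\<gamma> t \<noteq> 1" if t: "t \<in> {0<..<1}" for t using slit[OF t] by auto
  \<comment> \<open>Since \<open>Arg2pi (1 - v) = Im (Ln (v - 1)) + \<pi>\<close>, the branch is a principal logarithm of \<open>v - 1\<close>.\<close>
  have beta: "beta_kernel a v = of_real (a - 1) * (P v / (1 - v))" if v: "v - 1 \<notin> \<real>\<^sub>\<le>\<^sub>0" for v
  proof -
    have v1: "v \<noteq> 1" using v by auto
    have "a - 1 \<notin> \<int>\<^sub>\<le>\<^sub>0"
    proof
      assume "a - 1 \<in> \<int>\<^sub>\<le>\<^sub>0"
      then obtain n where n: "a - 1 = of_int n" by (auto elim!: nonpos_Ints_cases)
      then have "real_of_int (- 1) < of_int n" "real_of_int n < of_int 0" using a1 a_pos by auto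
      then show False unfolding of_int_less_iff by linarith
    qed
    then have "Gamma a = (a - 1) * Gamma (a - 1)"
      using Gamma_plus1[of "a - 1"] by simp
    moreover have "Gamma (a - 1) \<noteq> 0" using \<open>a - 1 \<notin> \<int>\<^sub>\<le>\<^sub>0\<close> by (simp add: Gamma_eq_zero_iff)
    ultimately have G: "Gamma a / Gamma (a - 1) = a - 1" by simp
    have "Arg2pi (1 - v) \<noteq> 0"
      using v by (auto simp: Arg2pi_eq_0 complex_nonpos_Reals_iff complex_is_Real_iff)
    then have "0 < Arg2pi (1 - v)" using Arg2pi_ge_0[of "1 - v"] by simp
    then have A: "Arg2pi (1 - v) = Im (Ln (v - 1)) + pi" using Arg2pi_Ln[of "1 - v"] by simp
    have "Re (Ln (v - 1)) = ln (cmod (1 - v))" using v1 by (simp add: norm_minus_commute)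
    then have L: "of_real (ln (cmod (1 - v))) + \<i> * of_real (Arg2pi (1 - v)) = Ln (v - 1) + \<i> * of_real pi"
      unfolding A by (simp add: complex_eq_iff)
    have "exp (Ln (v - 1) + \<i> * of_real pi) = 1 - v"
      using v1 by (simp add: exp_add exp_pi_i')
    moreover have "of_real (a - 2) * (Ln (v - 1) + \<i> * of_real pi) =
        of_real (a - 1) * (Ln (v - 1) + \<i> * of_real pi) - (Ln (v - 1) + \<i> * of_real pi)"
      by (simp add: algebra_simps)
    ultimately show ?thesis
      unfolding beta_kernel_def G L P_def by (simp add: exp_diff)
  qed
  have F_deriv: "(F has_field_derivative exp (- zeta_transform \<alpha> (v * w)) * beta_kernel a v) (at v)"
    if v: "v - 1 \<notin> \<real>\<^sub>\<le>\<^sub>0" and vw: "Im (v * w) > 0" for v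
  proof -
    have v1: "v \<noteq> 1" using v by auto
    have P': "(P has_field_derivative P v * (of_real (a - 1) / (v - 1))) (at v)"
      unfolding P_def using v by (auto intro!: derivative_eq_intros simp: divide_inverse mult_ac)
    have "(F has_field_derivative - (P v * (of_real (a - 1) / (v - 1)) * resolvent_power w v +
        of_real (a - 1) / (1 - v) * (resolvent_power w v - exp (- zeta_transform \<alpha> (v * w))) * P v)) (at v)"
      unfolding F_def by (intro DERIV_minus DERIV_mult P' resolvent_power_ode[OF w vw v1])
    also have "of_real (a - 1) / (v - 1) = - (complex_of_real (a - 1) / (1 - v))"
      by (metis minus_diff_eq minus_divide_right)
    also have "- (P v * - (complex_of_real (a - 1) / (1 - v)) * resolvent_power w v +
        of_real (a - 1) / (1 - v) * (resolvent_power w v - exp (- zeta_transform \<alpha> (v * w))) * P v) =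
        exp (- zeta_transform \<alpha> (v * w)) * beta_kernel a v"
      unfolding beta[OF v] by (simp add: algebra_simps)
    finally show ?thesis .
  qed
  have bd: "(Im (\<gamma> t * w) / norm (\<gamma> t * w)) powr (1 - a) \<le> 1" if "t \<in> {0<..<1}" for t
  proof (rule powr_le1)
    show "\<bar>Im (\<gamma> t * w) / norm (\<gamma> t * w)\<bar> \<le> 1"
      unfolding abs_of_pos[OF aperture_pos[OF up[OF that]]] by (rule aperture_le_1)
  qed (use a1 in simp)
  have lim0: "(\<gamma> \<longlongrightarrow> 0) (at 0 within {0<..<1})" and lim1: "(\<gamma> \<longlongrightarrow> 0) (at 1 within {0<..<1})"
  proof -
    have "(\<gamma> \<longlongrightarrow> \<gamma> t) (at t within {0<..<1})" if "t \<in> {0..1}" for t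
      by (rule tendsto_within_subset[where S = "{0..1}"]) (use cont\<gamma> that in \<open>auto simp: continuous_on_def\<close>)
    from this[of 0] this[of 1] show "(\<gamma> \<longlongrightarrow> 0) (at 0 within {0<..<1})" "(\<gamma> \<longlongrightarrow> 0) (at 1 within {0<..<1})"
      using \<gamma>0 \<gamma>1 by simp_all
  qed
  have at0: "at (0::real) within {0<..<1} = at_right 0"
    by (rule at_within_nhd[of _ "{..<1}"]) auto
  have at1: "at (1::real) within {0<..<1} = at_left 1"
    by (rule at_within_nhd[of _ "{0<..}"]) auto
  have G0: "((\<lambda>t. resolvent_power w (\<gamma> t)) \<longlongrightarrow> resolvent_power w 0) (at 0 within {0<..<1})"
    by (rule resolvent_power_tendsto_0[OF w lim0, of 1]) (use up bd in auto)
  have G1: "((\<lambda>t. resolvent_power w (\<gamma> t)) \<longlongrightarrow> resolvent_power w 0) (at 1 within {0<..<1})"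
    by (rule resolvent_power_tendsto_0[OF w lim1, of 1]) (use up bd in auto)
  have Ln1: "((\<lambda>t. Ln (1 - \<gamma> t)) \<longlongrightarrow> 0) Fl" if "(\<gamma> \<longlongrightarrow> 0) Fl" for Fl
  proof -
    have "((\<lambda>t. Ln (1 - \<gamma> t)) \<longlongrightarrow> Ln (1 - 0)) Fl"
      by (intro tendsto_intros that) auto
    then show ?thesis by simp
  qed
  \<comment> \<open>For \<open>v\<close> near \<open>0\<close>, \<open>Ln (v - 1)\<close> is \<open>Ln (1 - v) - i \<pi>\<close> below the real axis and
    \<open>Ln (1 - v) + i \<pi>\<close> above it.\<close>
  have P0: "((\<lambda>t. P (\<gamma> t)) \<longlongrightarrow> 1) (at 0 within {0<..<1})"
  proof -
    have "((\<lambda>t. exp (of_real (a - 1) * Ln (1 - \<gamma> t))) \<longlongrightarrow> exp (of_real (a - 1) * 0)) (at 0 within {0<..<1})"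
      by (intro tendsto_intros Ln1 lim0)
    moreover have "\<forall>\<^sub>F t in at 0 within {0<..<1}. exp (of_real (a - 1) * Ln (1 - \<gamma> t)) = P (\<gamma> t)"
      unfolding at0 using start
    proof eventually_elim
      case (elim t)
      then have "1 - \<gamma> t \<noteq> 0" by auto
      then have "Ln (\<gamma> t - 1) = Ln (1 - \<gamma> t) - \<i> * of_real pi"
        using Ln_minus[of "1 - \<gamma> t"] elim by simp
      then show ?case by (simp add: P_def)
    qed
    ultimately show ?thesis by (auto elim: Lim_transform_eventually)
  qed
  have P1: "((\<lambda>t. P (\<gamma> t)) \<longlongrightarrow> E) (at 1 within {0<..<1})"
  proof -
    have "((\<lambda>t. exp (of_real (a - 1) * (Ln (1 - \<gamma> t) + 2 * \<i> * of_real pi))) \<longlongrightarrow> exp (of_real (a - 1) * (0 + 2 * \<i> * of_real pi))) (at 1 within {0<..<1})"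
      by (intro tendsto_intros Ln1 lim1)
    moreover have "exp (of_real (a - 1) * (0 + 2 * \<i> * of_real pi)) = E" by (simp add: E_def mult_ac)
    moreover have "\<forall>\<^sub>F t in at 1 within {0<..<1}. exp (of_real (a - 1) * (Ln (1 - \<gamma> t) + 2 * \<i> * of_real pi)) = P (\<gamma> t)"
      unfolding at1 using fin
    proof eventually_elim
      case (elim t)
      then have "1 - \<gamma> t \<noteq> 0" by auto
      then have "Ln (\<gamma> t - 1) = Ln (1 - \<gamma> t) + \<i> * of_real pi"
        using Ln_minus[of "1 - \<gamma> t"] elim by simp
      then show ?case by (simp add: P_def algebra_simps)
    qed
    ultimately show ?thesis by (auto elim: Lim_transform_eventually)
  qed
  have "continuous_on {0..1} H"
    unfolding continuous_on_def
  proof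
    fix t :: real assume t: "t \<in> {0..1}"
    consider "t = 0" | "t = 1" | "t \<in> {0<..<1}" using t by force
    then show "(H \<longlongrightarrow> H t) (at t within {0..1})"
    proof cases
      case 1
      have "((\<lambda>t. F (\<gamma> t)) \<longlongrightarrow> - (1 * resolvent_power w 0)) (at 0 within {0<..<1})"
        unfolding F_def by (intro tendsto_intros P0 G0)
      then have "((\<lambda>t. F (\<gamma> t)) \<longlongrightarrow> H 0) (at_right 0)" unfolding at0 by (simp add: H_def)
      moreover have "\<forall>\<^sub>F t in at_right 0. F (\<gamma> t) = H t"
        using eventually_at_right_real[of 0 "1::real"] by (auto elim!: eventually_mono simp: H_def)
      ultimately have "(H \<longlongrightarrow> H 0) (at_right 0)" by (rule Lim_transform_eventually)
      then show ?thesis using 1 by (simp add: at_within_Icc_at_right)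
    next
      case 2
      have "((\<lambda>t. F (\<gamma> t)) \<longlongrightarrow> - (E * resolvent_power w 0)) (at 1 within {0<..<1})"
        unfolding F_def by (intro tendsto_intros P1 G1)
      then have "((\<lambda>t. F (\<gamma> t)) \<longlongrightarrow> H 1) (at_left 1)" unfolding at1 by (simp add: H_def)
      moreover have "\<forall>\<^sub>F t in at_left 1. F (\<gamma> t) = H t"
        using eventually_at_left_real[of 0 "1::real"] by (auto elim!: eventually_mono simp: H_def)
      ultimately have "(H \<longlongrightarrow> H 1) (at_left 1)" by (rule Lim_transform_eventually)
      then show ?thesis using 2 by (simp add: at_within_Icc_at_left)
    next
      case 3
      have "isCont F (\<gamma> t)" using F_deriv[OF slit[OF 3] up[OF 3]] by (rule DERIV_isCont)
      moreover have "(\<gamma> \<longlongrightarrow> \<gamma> t) (at t within {0..1})" using cont\<gamma> t by (auto simp: continuous_on_def)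
      ultimately have "((\<lambda>t. F (\<gamma> t)) \<longlongrightarrow> F (\<gamma> t)) (at t within {0..1})" by (rule isCont_tendsto_compose)
      moreover have "\<forall>\<^sub>F s in at t within {0..1}. F (\<gamma> s) = H s"
      proof -
        have "\<forall>\<^sub>F s in at t within {0..1}. s \<in> {0<..<1}"
          using 3 by (intro eventually_at_topological[THEN iffD2] exI[of _ "{0<..<1}"]) auto
        then show ?thesis by eventually_elim (auto simp: H_def)
      qed
      ultimately show ?thesis using 3 by (auto simp: H_def elim: Lim_transform_eventually)
    qed
  qed
  moreover have "(H has_vector_derivative exp (- zeta_transform \<alpha> (\<gamma> t * w)) * beta_kernel a (\<gamma> t) * vector_derivative \<gamma> (at t within {0..1})) (at t)"
    if t: "t \<in> {0<..<1} - S" for t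
  proof -
    have t': "t \<in> {0<..<1}" using t by simp
    have gd: "(\<gamma> has_vector_derivative vector_derivative \<gamma> (at t)) (at t)"
      using S(2) t by (auto simp: C1_differentiable_on_eq vector_derivative_works)
    have vd: "vector_derivative \<gamma> (at t within {0..1}) = vector_derivative \<gamma> (at t)"
      by (rule vector_derivative_at_within_ivl[OF gd]) (use t' in auto)
    have "((F \<circ> \<gamma>) has_vector_derivative vector_derivative \<gamma> (at t within {0..1}) *
       (exp (- zeta_transform \<alpha> (\<gamma> t * w)) * beta_kernel a (\<gamma> t))) (at t)"
      unfolding vd by (rule field_vector_diff_chain_at[of \<gamma> _ t F, OF gd F_deriv[OF slit[OF t'] up[OF t']]])
    then have "(H has_vector_derivative vector_derivative \<gamma> (at t within {0..1}) *
       (exp (- zeta_transform \<alpha> (\<gamma> t * w)) * beta_kernel a (\<gamma> t))) (at t)"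
      by (rule has_vector_derivative_transform_within_open[of _ _ _ "{0<..<1}"]) (use t' in \<open>auto simp: H_def\<close>)
    then show ?thesis by (simp add: mult_ac)
  qed
  ultimately have "((\<lambda>t. exp (- zeta_transform \<alpha> (\<gamma> t * w)) * beta_kernel a (\<gamma> t) * vector_derivative \<gamma> (at t within {0..1}))
     has_integral (H 1 - H 0)) {0..1}"
    by (intro fundamental_theorem_of_calculus_interior_strong[OF S(1)]) auto
  then have "contour_integral \<gamma> (\<lambda>v. exp (- zeta_transform \<alpha> (v * w)) * beta_kernel a v) = H 1 - H 0"
    by (intro contour_integral_unique) (simp add: has_contour_integral_def)
  also have "\<dots> = (1 - E) * resolvent_power w 0" by (simp add: H_def algebra_simps)
  finally show ?thesis by (simp add: E_def resolvent_power_0)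
qed

text \<open>
  Here \<open>(1 - u) powr (a - 1)\<close> vanishes at \<open>u = 1\<close>, so only the endpoint \<open>u = 0\<close> of the primitive
  contributes. The fundamental theorem yields a gauge integral; the bound by a multiple of
  \<open>(1 - u) powr (a - 2)\<close> turns it into a Lebesgue integral.
\<close>

lemma euler_integral:
  assumes w: "Im w > 0" and a1: "a > 1"
  shows "(LINT u:{0..1}|lborel. exp (- zeta_transform \<alpha> (of_real u * w)) * of_real ((1 - u) powr (a - 2))) =
         (LINT x|\<mu>. 1 / (1 + w * of_real x)) / of_real (a - 1)"
proof -
  define f where "f u = exp (- zeta_transform \<alpha> (of_real u * w)) * complex_of_real ((1 - u) powr (a - 2))" for u
  define F where "F u = - (complex_of_real ((1 - u) powr (a - 1)) * resolvent_power w (of_real u))" for u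
  have up: "Im (of_real u * w) > 0" if "u > 0" for u using that w by simp
  have ap: "Im (of_real u * w) / norm (of_real u * w) = Im w / norm w" if "u > 0" for u
    using that by (simp add: norm_mult)
  have P': "((\<lambda>u. (1 - u) powr (a - 1)) has_real_derivative - ((a - 1) * (1 - u) powr (a - 2))) (at u)" if "u < 1" for u :: real
    using that by (auto intro!: derivative_eq_intros simp: diff_diff_eq)
  have Pc: "continuous_on {0..1} (\<lambda>u::real. (1 - u) powr (a - 1))"
    using a1 by (intro continuous_on_powr' continuous_intros) auto
  have Gc: "continuous_on {0..1} (\<lambda>u. resolvent_power w (of_real u))"
    unfolding continuous_on_def
  proof
    fix u :: real assume u: "u \<in> {0..1}"
    show "((\<lambda>u. resolvent_power w (of_real u)) \<longlongrightarrow> resolvent_power w (of_real u)) (at u within {0..1})"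
    proof (cases "u = 0")
      case True
      have "((\<lambda>u. complex_of_real u) \<longlongrightarrow> 0) (at 0 within {0..1})"
        by (rule tendsto_eq_intros | simp)+
      from resolvent_power_tendsto_0[OF w this, of "(Im w / norm w) powr (1 - a)"] True
      show ?thesis using up ap by simp
    next
      case False
      then have "isCont (resolvent_power w) (of_real u)"
        using u by (intro DERIV_isCont[OF resolvent_power_deriv[OF w up]]) auto
      then show ?thesis by (rule isCont_tendsto_compose) (intro tendsto_intros)
    qed
  qed
  have Fc: "continuous_on {0..1} F"
    unfolding F_def by (intro continuous_intros Pc Gc)
  have F': "(F has_vector_derivative of_real (a - 1) * f u) (at u)" if u: "u \<in> {0<..<1}" for u
  proof -
    have u1: "1 - u > 0" "complex_of_real u \<noteq> 1" "Im (of_real u * w) > 0" using u up[of u] by auto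
    let ?Z = "exp (- zeta_transform \<alpha> (of_real u * w))"
    let ?G = "resolvent_power w (of_real u)"
    have G': "((\<lambda>u. resolvent_power w (of_real u)) has_vector_derivative of_real (a - 1) / (1 - of_real u) * (?G - ?Z)) (at u)"
      by (rule has_vector_derivative_real_field[OF resolvent_power_ode[OF w u1(3,2)]])
    have p: "((\<lambda>u. complex_of_real ((1 - u) powr (a - 1))) has_vector_derivative of_real (- ((a - 1) * (1 - u) powr (a - 2)))) (at u)"
      using P'[of u] u by (intro has_vector_derivative_of_real) (simp add: has_real_derivative_iff_has_vector_derivative)
    have "(F has_vector_derivative - (complex_of_real ((1 - u) powr (a - 1)) * (of_real (a - 1) / (1 - of_real u) * (?G - ?Z)) +
        of_real (- ((a - 1) * (1 - u) powr (a - 2))) * ?G)) (at u)"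
      unfolding F_def by (intro has_vector_derivative_minus has_vector_derivative_mult p G')
    also have "(1 - u) powr (a - 1) = (1 - u) * (1 - u) powr (a - 2)"
      using u1(1) powr_add[of "1 - u" 1 "a - 2"] by simp
    also have "- (complex_of_real ((1 - u) * (1 - u) powr (a - 2)) * (of_real (a - 1) / (1 - of_real u) * (?G - ?Z)) +
        of_real (- ((a - 1) * (1 - u) powr (a - 2))) * ?G) = of_real (a - 1) * f u"
    proof -
      have "complex_of_real ((1 - u) * (1 - u) powr (a - 2)) * (of_real (a - 1) / (1 - of_real u) * (?G - ?Z)) =
         complex_of_real ((1 - u) powr (a - 2)) * of_real (a - 1) * (?G - ?Z)"
        using u1(2) by simp
      then show ?thesis unfolding f_def by (simp only: of_real_minus of_real_mult) (simp add: algebra_simps)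
    qed
    finally show ?thesis .
  qed
  have "((\<lambda>u. of_real (a - 1) * f u) has_integral (F 1 - F 0)) {0..1}"
    by (rule fundamental_theorem_of_calculus_interior[OF _ Fc F']) auto
  then have "((\<lambda>u. (1 / of_real (a - 1)) * (of_real (a - 1) * f u)) has_integral ((1 / of_real (a - 1)) * (F 1 - F 0))) {0..1}"
    by (rule has_integral_mult_right)
  moreover have "(1 / of_real (a - 1)) * (of_real (a - 1) * f u) = f u" for u using a1 by simp
  moreover have "F 1 - F 0 = resolvent_power w 0" using a1 by (simp add: F_def)
  ultimately have f_int: "(f has_integral (resolvent_power w 0 / of_real (a - 1))) {0..1}" by simp
  have g_int: "(\<lambda>u. ((Im w / norm w) powr (- a) + 1) * (1 - u) powr (a - 2)) integrable_on {0..1}"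
  proof -
    have "((\<lambda>u. - ((a - 1) * (1 - u) powr (a - 2))) has_integral ((1 - 1) powr (a - 1) - (1 - 0) powr (a - 1))) {0..1}"
      by (rule fundamental_theorem_of_calculus_interior[OF _ Pc])
         (use P' in \<open>auto simp: has_real_derivative_iff_has_vector_derivative\<close>)
    then have "(\<lambda>u. (- ((Im w / norm w) powr (- a) + 1) / (a - 1)) * (- ((a - 1) * (1 - u) powr (a - 2)))) integrable_on {0..1}"
      by (rule has_integral_integrable[OF has_integral_mult_right])
    moreover have "(- ((Im w / norm w) powr (- a) + 1) / (a - 1)) * (- ((a - 1) * y)) = ((Im w / norm w) powr (- a) + 1) * y" for y
      using a1 by (simp add: field_simps)
    ultimately show ?thesis by simp
  qed
  have zeta0: "exp (- zeta_transform \<alpha> 0) = 1" by (simp add: zeta_transform_def)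
  have "f absolutely_integrable_on {0..1}"
  proof (rule absolutely_integrable_integrable_bound[OF _ _ g_int])
    show "f integrable_on {0..1}" using f_int by (auto simp: integrable_on_def)
    fix u :: real assume u: "u \<in> {0..1}"
    have "norm (exp (- zeta_transform \<alpha> (of_real u * w))) \<le> (Im w / norm w) powr (- a) + 1"
    proof (cases "u = 0")
      case True
      then show ?thesis using zeta0 by simp
    next
      case False
      then have "u > 0" using u by simp
      from norm_exp_zeta_le[OF up[OF this]] show ?thesis unfolding ap[OF \<open>u > 0\<close>] by simp
    qed
    then show "norm (f u) \<le> ((Im w / norm w) powr (- a) + 1) * (1 - u) powr (a - 2)"
      unfolding f_def norm_mult by (intro mult_mono) auto
  qed
  from set_lebesgue_integral_eq_integral(2)[OF this]
  have "(LINT u:{0..1}|lebesgue. f u) = resolvent_power w 0 / of_real (a - 1)"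
    using f_int by (simp add: integral_unique)
  moreover have "(LINT u:{0..1}|lebesgue. f u) = (LINT u:{0..1}|lborel. f u)"
    unfolding set_lebesgue_integral_def
  proof (rule integral_completion)
    \<comment> \<open>The maximum keeps the argument of the logarithm off the cut for all real \<open>u\<close>, so that
      measurability follows from continuity in both variables.\<close>
    define k where "k u = (LINT x|\<mu>. exp (- of_real a * Ln (1 + of_real (max u 0) * w * of_real x)))" for u :: real
    have "(\<lambda>(u, x). exp (- of_real a * Ln (1 + of_real (max u 0) * w * complex_of_real x))) \<in> borel_measurable (borel \<Otimes>\<^sub>M borel)"
    proof -
      have "1 + of_real (max u 0) * w * complex_of_real x \<notin> \<real>\<^sub>\<le>\<^sub>0" for u x
        using one_plus_upper_not_nonpos[OF up, of "max u 0" x] by (cases "u > 0") auto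
      then have "continuous_on UNIV (\<lambda>p::real \<times> real. exp (- of_real a * Ln (1 + of_real (max (fst p) 0) * w * complex_of_real (snd p))))"
        by (intro continuous_intros) auto
      then show ?thesis unfolding borel_prod case_prod_unfold by (rule borel_measurable_continuous_onI)
    qed
    moreover have "sets (borel \<Otimes>\<^sub>M \<mu>) = sets (borel \<Otimes>\<^sub>M borel)"
      by (rule sets_pair_measure_cong[OF refl sets_mu])
    ultimately have "(\<lambda>(u, x). exp (- of_real a * Ln (1 + of_real (max u 0) * w * complex_of_real x))) \<in> borel_measurable (borel \<Otimes>\<^sub>M \<mu>)"
      by (subst measurable_cong_sets[OF _ refl])
    then have k_meas: "k \<in> borel_measurable borel"
      unfolding k_def[abs_def] by (rule \<mu>.borel_measurable_lebesgue_integral)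
    have "indicator {0..1} u *\<^sub>R f u = indicator {0..1} u *\<^sub>R (k u * of_real ((1 - u) powr (a - 2)))" for u :: real
    proof -
      consider "u < 0" | "u = 0" | "u > 0" by linarith
      then show ?thesis
      proof cases
        case 2
        have "zeta_transform \<alpha> 0 = 0" by (simp add: zeta_transform_def)
        then show ?thesis unfolding 2 f_def k_def using \<mu>.prob_space by simp
      next
        case 3
        then show ?thesis using half_plane_identity[OF up[OF 3]] by (simp add: f_def k_def)
      qed simp
    qed
    moreover have "(\<lambda>u::real. indicator {0..1} u *\<^sub>R (k u * of_real ((1 - u) powr (a - 2)))) \<in> borel_measurable lborel"
      using k_meas by measurable
    ultimately show "(\<lambda>u. indicator {0..1} u *\<^sub>R f u) \<in> borel_measurable lborel" by (simp only:)
  qed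
  ultimately show ?thesis by (simp add: f_def resolvent_power_0)
qed

end

section \<open>Stieltjes inversion\<close>

text \<open>
  The imaginary part of \<open>1 / (x - l - i \<epsilon>)\<close> has the primitive \<open>arctan ((l - x) / \<epsilon>)\<close> in \<open>l\<close>. After
  exchanging the integrals, the differences of arctangents are bounded by \<open>\<pi>\<close> and tend to \<open>\<pi>\<close>
  inside the interval and to \<open>0\<close> outside.
\<close>

lemma stieltjes_inversion:
  fixes \<mu> :: "real measure"
  assumes "prob_space \<mu>" and sets_mu: "sets \<mu> = sets borel" and x12: "x1 < x2"
    and atoms: "measure \<mu> {x1} = 0" "measure \<mu> {x2} = 0"
  shows "((\<lambda>\<epsilon>. 1 / pi * Im (LINT l:{x1..x2}|lborel. (LINT x|\<mu>. 1 / (of_real x - of_real l - \<i> * of_real \<epsilon>))))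
          \<longlongrightarrow> measure \<mu> {x1<..<x2}) (at_right 0)"
proof -
  interpret \<mu>: prob_space \<mu> by fact
  interpret P: pair_sigma_finite "lborel :: real measure" \<mu> ..
  have space_mu: "space \<mu> = UNIV" using sets_eq_imp_space_eq[OF sets_mu] by simp
  have meas_mu: "f \<in> borel_measurable borel \<Longrightarrow> f \<in> borel_measurable \<mu>" for f :: "real \<Rightarrow> 'b :: topological_space"
    by (subst measurable_cong_sets[OF sets_mu refl])
  have formula: "Im (LINT l:{x1..x2}|lborel. (LINT x|\<mu>. 1 / (of_real x - of_real l - \<i> * of_real \<epsilon>))) =
      (LINT x|\<mu>. arctan ((x2 - x) / \<epsilon>) - arctan ((x1 - x) / \<epsilon>))" if \<epsilon>: "\<epsilon> > 0" for \<epsilon>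
  proof -
    define g where "g l x = indicator {x1..x2} l *\<^sub>R (1 / (complex_of_real x - of_real l - \<i> * of_real \<epsilon>))" for l x :: real
    have nz: "complex_of_real x - of_real l - \<i> * of_real \<epsilon> \<noteq> 0" for x l
      using \<epsilon> by (auto simp: complex_eq_iff)
    have g_bound: "norm (g l x) \<le> 1 / \<epsilon>" for l x
    proof -
      have "\<epsilon> \<le> \<bar>Im (complex_of_real x - of_real l - \<i> * of_real \<epsilon>)\<bar>" by simp
      also have "\<dots> \<le> norm (complex_of_real x - of_real l - \<i> * of_real \<epsilon>)" by (rule abs_Im_le_cmod)
      finally show ?thesis using \<epsilon> by (auto simp: g_def norm_divide indicator_def intro!: divide_left_mono mult_pos_pos)
    qed
    have "(\<lambda>(l, x). g l x) \<in> borel_measurable (borel \<Otimes>\<^sub>M borel)"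
    proof -
      have "continuous_on UNIV (\<lambda>p::real \<times> real. 1 / (complex_of_real (snd p) - of_real (fst p) - \<i> * of_real \<epsilon>))"
        using nz by (intro continuous_intros) auto
      then have "(\<lambda>p::real \<times> real. 1 / (complex_of_real (snd p) - of_real (fst p) - \<i> * of_real \<epsilon>)) \<in> borel_measurable (borel \<Otimes>\<^sub>M borel)"
        unfolding borel_prod by (rule borel_measurable_continuous_onI)
      then show ?thesis unfolding g_def case_prod_unfold by measurable
    qed
    moreover have "sets (lborel \<Otimes>\<^sub>M \<mu>) = sets (borel \<Otimes>\<^sub>M borel)"
      by (rule sets_pair_measure_cong) (simp_all add: sets_mu)
    ultimately have g_meas: "(\<lambda>(l, x). g l x) \<in> borel_measurable (lborel \<Otimes>\<^sub>M \<mu>)"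
      by (subst measurable_cong_sets[OF _ refl])
    have g_int: "integrable (lborel \<Otimes>\<^sub>M \<mu>) (\<lambda>(l, x). g l x)"
    proof (rule integrableI_bounded_set[where A = "{x1..x2} \<times> space \<mu>" and B = "1 / \<epsilon>"])
      show "emeasure (lborel \<Otimes>\<^sub>M \<mu>) ({x1..x2} \<times> space \<mu>) < \<infinity>"
        by (subst \<mu>.emeasure_pair_measure_Times) (use x12 in \<open>auto simp: \<mu>.emeasure_space_1\<close>)
      show "{x1..x2} \<times> space \<mu> \<in> sets (lborel \<Otimes>\<^sub>M \<mu>)" by (intro pair_measureI) auto
      show "AE p in lborel \<Otimes>\<^sub>M \<mu>. p \<in> {x1..x2} \<times> space \<mu> \<longrightarrow> norm (case p of (l, x) \<Rightarrow> g l x) \<le> 1 / \<epsilon>"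
        by (intro AE_I2) (use g_bound in \<open>auto split: prod.split\<close>)
      show "AE p in lborel \<Otimes>\<^sub>M \<mu>. p \<notin> {x1..x2} \<times> space \<mu> \<longrightarrow> (case p of (l, x) \<Rightarrow> g l x) = 0"
        by (intro AE_I2) (auto simp: g_def space_mu indicator_def)
    qed (rule g_meas)
    have inner: "integrable lborel (\<lambda>l. g l x)" "Im (LINT l|lborel. g l x) = arctan ((x2 - x) / \<epsilon>) - arctan ((x1 - x) / \<epsilon>)" for x
    proof -
      have c: "continuous_on {x1..x2} (\<lambda>l. 1 / (complex_of_real x - of_real l - \<i> * of_real \<epsilon>))"
        using nz by (intro continuous_intros) auto
      show i: "integrable lborel (\<lambda>l. g l x)"
        using borel_integrable_atLeastAtMost'[OF c] by (simp add: g_def set_integrable_def)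
      have "Im (LINT l|lborel. g l x) = (LINT l|lborel. Im (g l x))"
        by (rule integral_Im[OF i, symmetric])
      also have "\<dots> = (LINT l|lborel. indicator {x1..x2} l *\<^sub>R (\<epsilon> / ((x - l)\<^sup>2 + \<epsilon>\<^sup>2)))"
        by (intro Bochner_Integration.integral_cong refl) (simp add: g_def Im_divide indicator_def)
      also have "\<dots> = arctan ((x2 - x) / \<epsilon>) - arctan ((x1 - x) / \<epsilon>)"
      proof (rule integral_FTC_Icc)
        show "continuous_on {x1..x2} (\<lambda>l. \<epsilon> / ((x - l)\<^sup>2 + \<epsilon>\<^sup>2))"
          using \<epsilon> by (intro continuous_intros) (auto simp: sum_power2_eq_zero_iff)
        fix l :: real
        have "((\<lambda>l. arctan ((l - x) / \<epsilon>)) has_real_derivative \<epsilon> / ((x - l)\<^sup>2 + \<epsilon>\<^sup>2)) (at l within {x1..x2})"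
        proof -
          have "inverse (1 + ((l - x) / \<epsilon>)\<^sup>2) * (1 / \<epsilon>) = \<epsilon> / ((x - l)\<^sup>2 + \<epsilon>\<^sup>2)"
          proof -
            have "1 + ((l - x) / \<epsilon>)\<^sup>2 = ((x - l)\<^sup>2 + \<epsilon>\<^sup>2) / \<epsilon>\<^sup>2"
              using \<epsilon> by (simp add: power_divide field_simps power2_commute)
            then show ?thesis using \<epsilon> by (simp add: power2_eq_square)
          qed
          moreover have "((\<lambda>l. arctan ((l - x) / \<epsilon>)) has_real_derivative inverse (1 + ((l - x) / \<epsilon>)\<^sup>2) * (1 / \<epsilon>)) (at l within {x1..x2})"
            using \<epsilon> by (auto intro!: derivative_eq_intros)
          ultimately show ?thesis by simp
        qed
        then show "((\<lambda>l. arctan ((l - x) / \<epsilon>)) has_vector_derivative \<epsilon> / ((x - l)\<^sup>2 + \<epsilon>\<^sup>2)) (at l within {x1..x2})"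
          by (simp add: has_real_derivative_iff_has_vector_derivative)
      qed (use x12 in simp)
      finally show "Im (LINT l|lborel. g l x) = arctan ((x2 - x) / \<epsilon>) - arctan ((x1 - x) / \<epsilon>)" .
    qed
    have "(LINT l:{x1..x2}|lborel. (LINT x|\<mu>. 1 / (of_real x - of_real l - \<i> * of_real \<epsilon>))) =
        (LINT l|lborel. LINT x|\<mu>. g l x)"
      unfolding set_lebesgue_integral_def g_def by simp
    also have "\<dots> = (LINT x|\<mu>. LINT l|lborel. g l x)"
      by (rule P.Fubini_integral[symmetric, OF g_int])
    also have "Im \<dots> = (LINT x|\<mu>. Im (LINT l|lborel. g l x))"
      by (rule integral_Im[symmetric]) (use P.integrable_snd[OF g_int] in simp)
    finally show ?thesis unfolding inner(2) .
  qed
  have ae: "AE x in \<mu>. x \<noteq> x1 \<and> x \<noteq> x2"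
  proof -
    have "emeasure \<mu> {x1} = 0" "emeasure \<mu> {x2} = 0" using atoms by (auto simp: \<mu>.emeasure_eq_measure)
    then have "{x1} \<in> null_sets \<mu>" "{x2} \<in> null_sets \<mu>" by (auto simp: null_sets_def sets_mu)
    then have "AE x in \<mu>. x \<notin> {x1}" "AE x in \<mu>. x \<notin> {x2}" by (auto dest: AE_not_in)
    then show ?thesis by eventually_elim auto
  qed
  show ?thesis
    unfolding tendsto_at_iff_sequentially comp_def
  proof (intro allI impI)
    fix X :: "nat \<Rightarrow> real" assume X: "\<forall>i. X i \<in> {0<..} - {0}" and X0: "X \<longlonglongrightarrow> 0"
    have Xpos: "X n > 0" for n using X by auto
    have inv: "filterlim (\<lambda>n. inverse (X n)) at_top sequentially"
      using X0 Xpos by (intro filterlim_inverse_at_top) auto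
    have at_lim: "(\<lambda>n. arctan (y / X n)) \<longlonglongrightarrow> sgn y * (pi / 2)" if "y \<noteq> 0" for y
    proof (cases "y > 0")
      case True
      have "filterlim (\<lambda>n. y * inverse (X n)) at_top sequentially"
        using True by (intro filterlim_tendsto_pos_mult_at_top[OF tendsto_const _ inv])
      from filterlim_compose[OF tendsto_arctan_at_top this] True show ?thesis
        by (simp only: sgn_pos mult_1_left divide_inverse)
    next
      case False
      then have "y < 0" using that by simp
      have "filterlim (\<lambda>n. - y * inverse (X n)) at_top sequentially"
        using \<open>y < 0\<close> by (intro filterlim_tendsto_pos_mult_at_top[OF tendsto_const _ inv]) simp
      from tendsto_minus[OF filterlim_compose[OF tendsto_arctan_at_top this]] \<open>y < 0\<close>
      show ?thesis by (simp only: sgn_neg mult_minus_left mult_1_left divide_inverse arctan_minus minus_minus)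
    qed
    have "(\<lambda>n. LINT x|\<mu>. arctan ((x2 - x) / X n) - arctan ((x1 - x) / X n)) \<longlonglongrightarrow> (LINT x|\<mu>. pi * indicator {x1<..<x2} x)"
    proof (rule integral_dominated_convergence[where w = "\<lambda>_. pi"])
      show "AE x in \<mu>. (\<lambda>n. arctan ((x2 - x) / X n) - arctan ((x1 - x) / X n)) \<longlonglongrightarrow> pi * indicator {x1<..<x2} x"
        using ae
      proof eventually_elim
        case (elim x)
        have "(\<lambda>n. arctan ((x2 - x) / X n) - arctan ((x1 - x) / X n)) \<longlonglongrightarrow> sgn (x2 - x) * (pi / 2) - sgn (x1 - x) * (pi / 2)"
          using elim by (intro tendsto_diff at_lim) auto
        moreover have "sgn (x2 - x) * (pi / 2) - sgn (x1 - x) * (pi / 2) = pi * indicator {x1<..<x2} x"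
          using elim x12 by (auto simp: sgn_if indicator_def)
        ultimately show ?case by simp
      qed
      show "AE x in \<mu>. norm (arctan ((x2 - x) / X n) - arctan ((x1 - x) / X n)) \<le> pi" for n
      proof (rule AE_I2)
        fix x
        show "norm (arctan ((x2 - x) / X n) - arctan ((x1 - x) / X n)) \<le> pi"
          using arctan_bounded[of "(x2 - x) / X n"] arctan_bounded[of "(x1 - x) / X n"] by (auto simp: abs_le_iff)
      qed
    qed (auto intro!: meas_mu)
    then have "(\<lambda>n. 1 / pi * (LINT x|\<mu>. arctan ((x2 - x) / X n) - arctan ((x1 - x) / X n))) \<longlonglongrightarrow> 1 / pi * (LINT x|\<mu>. pi * indicator {x1<..<x2} x)"
      by (rule tendsto_mult_left)
    then show "(\<lambda>n. 1 / pi * Im (LINT l:{x1..x2}|lborel. (LINT x|\<mu>. 1 / (of_real x - of_real l - \<i> * of_real (X n)))))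
        \<longlonglongrightarrow> measure \<mu> {x1<..<x2}"
      unfolding formula[OF Xpos] by (simp add: space_mu)
  qed
qed

section \<open>The inversion formulas\<close>

lemma Im_inverse_lower:
  assumes "\<epsilon> > 0"
  shows "Im (1 / (- complex_of_real l - \<i> * of_real \<epsilon>)) > 0"
proof -
  have "l\<^sup>2 + \<epsilon>\<^sup>2 > 0" using assms by (simp add: sum_power2_gt_zero_iff)
  then show ?thesis using assms by (simp add: Im_divide)
qed

context markov_krein_pair
begin

lemma cauchy_transform_eq:
  assumes "\<epsilon> > 0"
  shows "1 / (- complex_of_real l - \<i> * of_real \<epsilon>) * (LINT x|\<mu>. 1 / (1 + 1 / (- complex_of_real l - \<i> * of_real \<epsilon>) * of_real x)) =
         (LINT x|\<mu>. 1 / (of_real x - of_real l - \<i> * of_real \<epsilon>))"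
proof -
  define z where "z = - complex_of_real l - \<i> * of_real \<epsilon>"
  have z: "z \<noteq> 0" using assms by (auto simp: z_def complex_eq_iff)
  have "1 / z * (1 / (1 + 1 / z * of_real x)) = 1 / (of_real x - of_real l - \<i> * of_real \<epsilon>)" for x
  proof -
    have "1 + 1 / z * of_real x = (of_real x - of_real l - \<i> * of_real \<epsilon>) / z"
      using z by (simp add: field_simps) (simp add: z_def)
    then show ?thesis using z by simp
  qed
  then have "(LINT x|\<mu>. 1 / (of_real x - of_real l - \<i> * of_real \<epsilon>)) = (LINT x|\<mu>. 1 / z * (1 / (1 + 1 / z * of_real x)))"
    by simp
  also have "\<dots> = 1 / z * (LINT x|\<mu>. 1 / (1 + 1 / z * of_real x))"
    by (rule integral_mult_right_zero)
  finally show ?thesis by (simp only: z_def)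
qed

end

theorem mainTheorem5:
  fixes a x1 x2 :: real and \<alpha> :: "real measure"
    and M :: "'w measure" and \<phi> :: "'w \<Rightarrow> real measure"
  assumes "a > 0"
    and "\<alpha> \<in> log_finite_measures a"
    and "\<And>x. measure \<alpha> {x} < a"
    and "dirichlet_process \<alpha> M \<phi>"
    and "x1 < x2"
  shows
    "(a = 1 \<longrightarrow>
       ((\<lambda>\<epsilon>. 1 / pi * Im (LINT l:{x1..x2}|lborel.
            1 / (- of_real l - \<i> * of_real \<epsilon>) *
            exp (- zeta_transform \<alpha> (1 / (- of_real l - \<i> * of_real \<epsilon>)))))
        \<longlongrightarrow> measure (mean_law M \<phi>) {x1<..<x2}) (at_right 0)) \<and>
     (a > 1 \<longrightarrow>
       ((\<lambda>\<epsilon>. (a - 1) / pi * Im (LINT l:{x1..x2}|lborel.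
            1 / (- of_real l - \<i> * of_real \<epsilon>) *
            (LINT u:{0..1}|lborel.
               exp (- zeta_transform \<alpha> (of_real u / (- of_real l - \<i> * of_real \<epsilon>))) *
               of_real ((1 - u) powr (a - 2)))))
        \<longlongrightarrow> measure (mean_law M \<phi>) {x1<..<x2}) (at_right 0)) \<and>
     (a < 1 \<longrightarrow>
       (\<forall>\<gamma> :: real \<Rightarrow> real \<Rightarrow> real \<Rightarrow> complex.
          (\<forall>\<epsilon>>0. \<forall>l\<in>{x1..x2}. loop_contour (\<gamma> \<epsilon> l) \<and>
             (\<forall>t\<in>{0<..<1}. Im (\<gamma> \<epsilon> l t / (- of_real l - \<i> * of_real \<epsilon>)) > 0)) \<longrightarrow>
          ((\<lambda>\<epsilon>. 1 / pi * Im (LINT l:{x1..x2}|lborel.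
               1 / ((1 - exp (2 * of_real pi * \<i> * of_real (a - 1))) *
                    (- of_real l - \<i> * of_real \<epsilon>)) *
               contour_integral (\<gamma> \<epsilon> l)
                 (\<lambda>w. exp (- zeta_transform \<alpha> (w / (- of_real l - \<i> * of_real \<epsilon>))) *
                      beta_kernel a w)))
           \<longlongrightarrow> measure (mean_law M \<phi>) {x1<..<x2}) (at_right 0)))"
proof -
  define \<mu> where "\<mu> = mean_law M \<phi>"
  interpret markov_krein_pair \<mu> \<alpha> a
    unfolding \<mu>_def by (rule mean_law_markov_krein_pair[OF assms(4,2,1)])
  define R where "R \<epsilon> l = (LINT x|\<mu>. 1 / (of_real x - of_real l - \<i> * of_real \<epsilon>))" for \<epsilon> l :: real
  have lim: "((\<lambda>\<epsilon>. 1 / pi * Im (LINT l:{x1..x2}|lborel. R \<epsilon> l)) \<longlongrightarrow> measure (mean_law M \<phi>) {x1<..<x2}) (at_right 0)"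
    unfolding R_def \<mu>_def[symmetric]
    by (rule stieltjes_inversion[OF \<mu>.prob_space_axioms sets_mu assms(5)]) (intro no_atom assms(3))+
  have transfer: "(f \<longlongrightarrow> measure (mean_law M \<phi>) {x1<..<x2}) (at_right 0)"
    if "\<And>\<epsilon>. \<epsilon> > 0 \<Longrightarrow> f \<epsilon> = 1 / pi * Im (LINT l:{x1..x2}|lborel. R \<epsilon> l)" for f :: "real \<Rightarrow> real"
  proof (rule Lim_transform_eventually[OF lim])
    show "\<forall>\<^sub>F \<epsilon> in at_right 0. 1 / pi * Im (LINT l:{x1..x2}|lborel. R \<epsilon> l) = f \<epsilon>"
      using eventually_at_right_less[of "0::real"] by eventually_elim (simp add: that)
  qed
  note up = Im_inverse_lower
  show ?thesis
  proof (intro conjI impI allI)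
    assume a1: "a = 1"
    show "((\<lambda>\<epsilon>. 1 / pi * Im (LINT l:{x1..x2}|lborel.
            1 / (- of_real l - \<i> * of_real \<epsilon>) *
            exp (- zeta_transform \<alpha> (1 / (- of_real l - \<i> * of_real \<epsilon>)))))
        \<longlongrightarrow> measure (mean_law M \<phi>) {x1<..<x2}) (at_right 0)"
    proof (rule transfer)
      fix \<epsilon> :: real assume \<epsilon>: "\<epsilon> > 0"
      have "1 / (- of_real l - \<i> * of_real \<epsilon>) * exp (- zeta_transform \<alpha> (1 / (- of_real l - \<i> * of_real \<epsilon>))) = R \<epsilon> l" for l
      proof -
        let ?w = "1 / (- complex_of_real l - \<i> * of_real \<epsilon>)"
        have "exp (- of_real a * Ln (1 + ?w * of_real x)) = 1 / (1 + ?w * of_real x)" for x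
          using one_plus_upper_nonzero[OF up[OF \<epsilon>], of l x] unfolding a1 of_real_1 mult_minus_left mult_1
          by (subst exp_minus, subst exp_Ln) (simp_all only: inverse_eq_divide not_False_eq_True)
        then have "exp (- zeta_transform \<alpha> ?w) = (LINT x|\<mu>. 1 / (1 + ?w * of_real x))"
          unfolding half_plane_identity[OF up[OF \<epsilon>], symmetric] by (simp only:)
        then show ?thesis unfolding R_def cauchy_transform_eq[OF \<epsilon>, symmetric] by (simp only:)
      qed
      then show "1 / pi * Im (LINT l:{x1..x2}|lborel.
            1 / (- of_real l - \<i> * of_real \<epsilon>) *
            exp (- zeta_transform \<alpha> (1 / (- of_real l - \<i> * of_real \<epsilon>)))) =
          1 / pi * Im (LINT l:{x1..x2}|lborel. R \<epsilon> l)" by (simp only:)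
    qed
  next
    assume a1: "a > 1"
    show "((\<lambda>\<epsilon>. (a - 1) / pi * Im (LINT l:{x1..x2}|lborel.
            1 / (- of_real l - \<i> * of_real \<epsilon>) *
            (LINT u:{0..1}|lborel.
               exp (- zeta_transform \<alpha> (of_real u / (- of_real l - \<i> * of_real \<epsilon>))) *
               of_real ((1 - u) powr (a - 2)))))
        \<longlongrightarrow> measure (mean_law M \<phi>) {x1<..<x2}) (at_right 0)"
    proof (rule transfer)
      fix \<epsilon> :: real assume \<epsilon>: "\<epsilon> > 0"
      have "1 / (- of_real l - \<i> * of_real \<epsilon>) *
            (LINT u:{0..1}|lborel. exp (- zeta_transform \<alpha> (of_real u / (- of_real l - \<i> * of_real \<epsilon>))) *
               of_real ((1 - u) powr (a - 2))) = of_real (1 / (a - 1)) * R \<epsilon> l" for l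
        unfolding euler_integral[OF up[OF \<epsilon>] a1, unfolded times_divide_eq_right mult_1_right]
          R_def cauchy_transform_eq[OF \<epsilon>, symmetric] by simp
      then have "(LINT l:{x1..x2}|lborel. 1 / (- of_real l - \<i> * of_real \<epsilon>) *
            (LINT u:{0..1}|lborel. exp (- zeta_transform \<alpha> (of_real u / (- of_real l - \<i> * of_real \<epsilon>))) *
               of_real ((1 - u) powr (a - 2)))) = of_real (1 / (a - 1)) * (LINT l:{x1..x2}|lborel. R \<epsilon> l)"
        by (simp only: set_integral_mult_right)
      then show "(a - 1) / pi * Im (LINT l:{x1..x2}|lborel.
            1 / (- of_real l - \<i> * of_real \<epsilon>) *
            (LINT u:{0..1}|lborel.
               exp (- zeta_transform \<alpha> (of_real u / (- of_real l - \<i> * of_real \<epsilon>))) *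
               of_real ((1 - u) powr (a - 2)))) = 1 / pi * Im (LINT l:{x1..x2}|lborel. R \<epsilon> l)"
        using a1 by (simp only: Im_complex_of_real Re_complex_of_real times_complex.sel) simp
    qed
  next
    fix \<gamma> :: "real \<Rightarrow> real \<Rightarrow> real \<Rightarrow> complex"
    assume a1: "a < 1" and \<gamma>: "\<forall>\<epsilon>>0. \<forall>l\<in>{x1..x2}. loop_contour (\<gamma> \<epsilon> l) \<and>
             (\<forall>t\<in>{0<..<1}. Im (\<gamma> \<epsilon> l t / (- of_real l - \<i> * of_real \<epsilon>)) > 0)"
    define E where "E = exp (2 * of_real pi * \<i> * complex_of_real (a - 1))"
    have E: "1 - E \<noteq> 0"
    proof
      assume "1 - E = 0"
      then have "E = 1" by simp
      then obtain n :: int where "2 * pi * (a - 1) = of_int (2 * n) * pi"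
        by (auto simp: E_def exp_eq_1)
      then have "a - 1 = of_int n" by simp
      then have "real_of_int (- 1) < of_int n" "real_of_int n < of_int 0" using a1 assms(1) by auto
      then show False unfolding of_int_less_iff by linarith
    qed
    show "((\<lambda>\<epsilon>. 1 / pi * Im (LINT l:{x1..x2}|lborel.
               1 / ((1 - exp (2 * of_real pi * \<i> * of_real (a - 1))) *
                    (- of_real l - \<i> * of_real \<epsilon>)) *
               contour_integral (\<gamma> \<epsilon> l)
                 (\<lambda>w. exp (- zeta_transform \<alpha> (w / (- of_real l - \<i> * of_real \<epsilon>))) *
                      beta_kernel a w)))
           \<longlongrightarrow> measure (mean_law M \<phi>) {x1<..<x2}) (at_right 0)"
    proof (rule transfer)
      fix \<epsilon> :: real assume \<epsilon>: "\<epsilon> > 0"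
      have "1 / ((1 - E) * (- of_real l - \<i> * of_real \<epsilon>)) *
               contour_integral (\<gamma> \<epsilon> l) (\<lambda>w. exp (- zeta_transform \<alpha> (w / (- of_real l - \<i> * of_real \<epsilon>))) * beta_kernel a w)
            = R \<epsilon> l" if l: "l \<in> {x1..x2}" for l
      proof -
        let ?w = "1 / (- complex_of_real l - \<i> * of_real \<epsilon>)"
        have "contour_integral (\<gamma> \<epsilon> l) (\<lambda>v. exp (- zeta_transform \<alpha> (v * ?w)) * beta_kernel a v) =
            (1 - E) * (LINT x|\<mu>. 1 / (1 + ?w * of_real x))"
          unfolding E_def by (rule loop_integral[OF up[OF \<epsilon>] a1]) (use \<gamma> \<epsilon> l in auto)
        then have "1 / ((1 - E) * (- of_real l - \<i> * of_real \<epsilon>)) *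
               contour_integral (\<gamma> \<epsilon> l) (\<lambda>w. exp (- zeta_transform \<alpha> (w / (- of_real l - \<i> * of_real \<epsilon>))) * beta_kernel a w)
            = 1 / ((1 - E) * (- of_real l - \<i> * of_real \<epsilon>)) * ((1 - E) * (LINT x|\<mu>. 1 / (1 + ?w * of_real x)))"
          by (simp only: times_divide_eq_right mult_1_right)
        also have "\<dots> = ?w * (LINT x|\<mu>. 1 / (1 + ?w * of_real x))"
          using E by simp
        finally show ?thesis unfolding R_def cauchy_transform_eq[OF \<epsilon>, symmetric] .
      qed
      then have "(LINT l:{x1..x2}|lborel. 1 / ((1 - E) * (- of_real l - \<i> * of_real \<epsilon>)) *
               contour_integral (\<gamma> \<epsilon> l) (\<lambda>w. exp (- zeta_transform \<alpha> (w / (- of_real l - \<i> * of_real \<epsilon>))) * beta_kernel a w))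
          = (LINT l:{x1..x2}|lborel. R \<epsilon> l)"
        by (intro set_lebesgue_integral_cong) auto
      then show "1 / pi * Im (LINT l:{x1..x2}|lborel.
               1 / ((1 - exp (2 * of_real pi * \<i> * of_real (a - 1))) *
                    (- of_real l - \<i> * of_real \<epsilon>)) *
               contour_integral (\<gamma> \<epsilon> l)
                 (\<lambda>w. exp (- zeta_transform \<alpha> (w / (- of_real l - \<i> * of_real \<epsilon>))) *
                      beta_kernel a w)) = 1 / pi * Im (LINT l:{x1..x2}|lborel. R \<epsilon> l)"
        unfolding E_def by (simp only:)
    qed
  qed
qed

end
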